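(* Let $\Omega_*\in H^1(\mathbb R)$ be the self-similar profile of the De Gregorio model constructed by Chen, Hou and Huang, which after proper rescaling is odd, supported on $[-1,1]$, strictly negative on $(0,1)$, and solves $$(c_l x+u)\,\partial_x\Omega_*=(c_\omega+u_x)\,\Omega_*,\qquad u_x=\mathbf H(\Omega_* ),\qquad u(0)=0,$$ with $c_l=c_\omega=(-\Delta)^{-1/2}\Omega_*(1)$. Then $\Omega_*$ is identical, up to rescaling, to the leading eigenfunction $f_*$ of the operator $\mathbf M$ on $\mathbb V$ (the eigenfunction for its largest eigenvalue); that is, when $\Omega_*$ is rescaled so that it is odd, supported on $[-1,1]$, strictly negative on $(0,1)$, and satisfies $c_l=c_\omega=(-\Delta)^{-1/2}\Omega_*(1)$, one has $\Omega_*=\alpha f_*$ for some constant $\alpha\neq0$.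
   Context: All functions are real-valued. $\mathbf H(f)(x)=\frac1\pi\,\mathrm{P.V.}\!\int_{\mathbb R}\frac{f(y)}{x-y}\,dy$. $(-\Delta)^{-1/2}f(x)=-\frac1\pi\int_{\mathbb R}f(y)\ln|x-y|\,dy$. $\mathbb V=\{f: f(-x)=-f(x),\ f\in H_0^1([-1,1])\}$ (functions extended by $0$ to $\mathbb R$), with inner product $\langle f,g\rangle_{\dot H^1}=\int f_xg_x\,dx$. For $f\in\mathbb V$, $c(f)=(-\Delta)^{-1/2}f(1)=-\frac1\pi\int_{\mathbb R}f(y)\ln|1-y|\,dy$ and $\mathbf M(f)(x)=\chi_{[-1,1]}(x)\big((-\Delta)^{-1/2}f(x)-c(f)x\big)$; $\mathbf M$ is a compact, self-adjoint, positive operator $\mathbb V\to\mathbb V$. The De Gregorio model is $\omega_t+u\omega_x=u_x\omega$, $u_x=\mathbf H(\omega)$, $u(0)=0$ on $\mathbb R$. Rescaling of a profile means $\omega(x)\mapsto\alpha\omega(\beta x)$ with $(c_l,c_\omega)\mapsto(\alpha c_l,\alpha c_\omega)$, $\alpha,\beta\ne0$. *)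

theory Defs
  imports "HOL-Analysis.Analysis"
begin

(* Weak derivatives on the real line, with C^1 test functions of compact support. Local
   integrability is required explicitly, since the Bochner integral of a non-integrable function
   is 0. *)

definition locally_integrable :: "(real \<Rightarrow> real) \<Rightarrow> bool" where
  "locally_integrable f \<longleftrightarrow> (\<forall>R. set_integrable lborel {-R..R} f)"

definition has_weak_derivative :: "(real \<Rightarrow> real) \<Rightarrow> (real \<Rightarrow> real) \<Rightarrow> bool" where
  "has_weak_derivative f g \<longleftrightarrow>
     locally_integrable f \<and> locally_integrable g \<and>
     (\<forall>\<phi> \<phi>'. (\<forall>x. (\<phi> has_real_derivative \<phi>' x) (at x)) \<and> continuous_on UNIV \<phi>' \<and>
             (\<exists>R. \<forall>x. \<bar>x\<bar> > R \<longrightarrow> \<phi> x = 0) \<longrightarrow>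
        (LINT x|lborel. f x * \<phi>' x) = - (LINT x|lborel. g x * \<phi> x))"

definition square_integrable :: "(real \<Rightarrow> real) \<Rightarrow> bool" where
  "square_integrable f \<longleftrightarrow> f \<in> borel_measurable lborel \<and> integrable lborel (\<lambda>x. (f x)\<^sup>2)"

(* A class in H^1(R) is represented by its unique continuous member, so that pointwise statements
   (values at points, sign conditions, equality of functions) are meaningful. *)

definition H1 :: "(real \<Rightarrow> real) set" where
  "H1 = {f. continuous_on UNIV f \<and> square_integrable f \<and>
            (\<exists>g. square_integrable g \<and> has_weak_derivative f g)}"

(* H^1_0([-1,1]), its elements being extended by 0 to the line; continuity of the elements of H1
   forces the zero boundary values at -1 and 1. *)

definition H10 :: "(real \<Rightarrow> real) set" where
  "H10 = {f \<in> H1. \<forall>x. x \<notin> {-1..1} \<longrightarrow> f x = 0}"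

definition odd_fun :: "(real \<Rightarrow> real) \<Rightarrow> bool" where
  "odd_fun f \<longleftrightarrow> (\<forall>x. f (- x) = - f x)"

definition VV :: "(real \<Rightarrow> real) set" where
  "VV = {f. odd_fun f \<and> f \<in> H10}"

(* The principal value exists at every x when f is in H1 (Hoelder continuity near x,
   Cauchy-Schwarz away from x). *)

definition hilbert :: "(real \<Rightarrow> real) \<Rightarrow> real \<Rightarrow> real" where
  "hilbert f x =
     1 / pi * Lim (at_right 0) (\<lambda>\<epsilon>. LINT y:{y. \<bar>x - y\<bar> > \<epsilon>}|lborel. f y / (x - y))"

definition inv_half_laplacian :: "(real \<Rightarrow> real) \<Rightarrow> real \<Rightarrow> real" where
  "inv_half_laplacian f x = - (1 / pi) * (LINT y|lborel. f y * ln \<bar>x - y\<bar>)"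

definition c_const :: "(real \<Rightarrow> real) \<Rightarrow> real" where
  "c_const f = inv_half_laplacian f 1"

definition MM :: "(real \<Rightarrow> real) \<Rightarrow> real \<Rightarrow> real" where
  "MM f x = indicator {-1..1} x * (inv_half_laplacian f x - c_const f * x)"

definition eigenfunction :: "real \<Rightarrow> (real \<Rightarrow> real) \<Rightarrow> bool" where
  "eigenfunction \<mu> f \<longleftrightarrow> f \<in> VV \<and> f \<noteq> (\<lambda>x. 0) \<and> MM f = (\<lambda>x. \<mu> * f x)"

definition leading_eigenfunction :: "(real \<Rightarrow> real) \<Rightarrow> bool" where
  "leading_eigenfunction f \<longleftrightarrow>
     (\<exists>\<mu>. eigenfunction \<mu> f \<and> (\<forall>\<nu> g. eigenfunction \<nu> g \<longrightarrow> \<nu> \<le> \<mu>))"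

(* The profile equation (c_l x + u) W_x = (c_w + u_x) W with u_x = H(W), u(0) = 0.
   W_x is a weak derivative, hence the equation holds almost everywhere; u is the classical
   primitive of H(W), which is continuous for W in H1. *)

definition self_similar_profile :: "(real \<Rightarrow> real) \<Rightarrow> real \<Rightarrow> real \<Rightarrow> bool" where
  "self_similar_profile W c\<^sub>l c\<^sub>w \<longleftrightarrow>
     (\<exists>u W'. u 0 = 0 \<and> (\<forall>x. (u has_real_derivative hilbert W x) (at x)) \<and>
             has_weak_derivative W W' \<and>
             (AE x in lborel. (c\<^sub>l * x + u x) * W' x = (c\<^sub>w + hilbert W x) * W x))"

definition rescale :: "real \<Rightarrow> real \<Rightarrow> (real \<Rightarrow> real) \<Rightarrow> real \<Rightarrow> real" where
  "rescale \<alpha> \<beta> f = (\<lambda>x. \<alpha> * f (\<beta> * x))"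

end

theory Submission
  imports Defs
begin

text \<open>
  Let \<Omega> be the profile, \<psi> its potential (the inverse half Laplacian of \<Omega>) and c = \<psi> 1. The
  potential is continuously differentiable with derivative -H(\<Omega>), so u = -\<psi>, and with
  c_l = c_w = c the profile equation says that \<Omega> and c x - \<psi> have the same logarithmic derivative.
  As \<Omega> has no zero in (0,1), they are proportional there, and this is the eigenvalue equation of M:
  the positive function f = -\<Omega> satisfies M f = \<mu> f (lemma \<open>negative_profile_eigenprofile\<close>). It
  remains to see that \<mu> is the largest eigenvalue and that it is simple. The kernel of M is not
  positive, so positivity of f alone is not enough for a Perron-Frobenius argument; two further
  ideas are used.

  First, f x / x is strictly decreasing. The function p(y) = f |y| / |y| is radial on
  three-dimensional space, and \<psi>_f(x) / x becomes its potential with kernel 1 / (2 pi^2 |x - y|^2).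
  Hence p is positive in the unit ball, vanishes outside, and in the ball \<mu> p is its own potential
  minus a constant. The method of moving planes applies: if p is at most its reflected value at all
  points beyond a plane, for all planes of height at least \<rho>, then the potential has the same
  property with a strict gain (\<open>potential_gap\<close>), and so the plane can be moved further
  (\<open>decreasing_beyond_step\<close>), down to the centre of the ball (\<open>radial_potential_decreasing\<close>).
  Because p is radial, only points on one axis are needed.

  Secondly, in terms of q = -(f x / x)' the eigenvalue equation becomes
  pi \<mu> x^2 q(x) = integral of A(x,t) q(t) over 0 < t < 1, with
  A(x,t) = (x^2 + t^2) / 2 * ln |(x + t) / (x - t)| - x t, which is symmetric and positive
  (\<open>kernel_identity\<close>, \<open>radial_kernel_pos\<close>). This reflects that the inner product of
  V is twice the integral of x^2 q_f q_g. For a symmetric positive kernel a positive eigenfunction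
  belongs to the largest eigenvalue, and that eigenvalue is simple
  (\<open>ground_state_comparison\<close>, \<open>leading_eigenprofile\<close>). In particular \<Omega> itself is
  a leading eigenfunction, and every other one is a multiple of it.
\<close>

section \<open>Weak derivatives on the line\<close>

(* The scales Suc n of the test functions are to stay atomic. *)
declare of_nat_Suc [simp del]

text \<open>The test functions only need to be of class C^1, so a step can be assembled from squares of positive
parts: its derivative is a tent on [0,1] of integral 1.\<close>

definition sqpos :: "real \<Rightarrow> real" where "sqpos t = (max 0 t)\<^sup>2"

lemma has_real_derivative_sqpos:
  "(sqpos has_real_derivative 2 * max 0 t) (at t)"
proof (cases "t = 0")
  case False
  show ?thesis
  proof (cases "t > 0")
    case True
    have "((\<lambda>x. x\<^sup>2) has_real_derivative 2 * max 0 t) (at t)"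
      using True by (auto intro!: derivative_eq_intros)
    moreover have "\<forall>\<^sub>F x in nhds t. x\<^sup>2 = sqpos x"
      using eventually_nhds_in_open[of "{0<..}" t] True
      by (auto elim!: eventually_mono simp: sqpos_def)
    ultimately show ?thesis by (simp add: DERIV_cong_ev)
  next
    case False
    with \<open>t \<noteq> 0\<close> have "t < 0" by simp
    then have "((\<lambda>x. 0) has_real_derivative 2 * max 0 t) (at t)" by simp
    moreover have "\<forall>\<^sub>F x in nhds t. 0 = sqpos x"
      using eventually_nhds_in_open[of "{..<0}" t] \<open>t < 0\<close>
      by (auto elim!: eventually_mono simp: sqpos_def)
    ultimately show ?thesis
      using DERIV_cong_ev[OF refl] by fastforce
  qed
next
  case True
  have "((\<lambda>h. (sqpos (0 + h) - sqpos 0) / h) \<longlongrightarrow> 0) (at 0)"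
  proof (rule Lim_null_comparison)
    show "\<forall>\<^sub>F h in at 0. norm ((sqpos (0 + h) - sqpos 0) / h) \<le> \<bar>h\<bar>"
      by (auto simp: eventually_at_filter sqpos_def max_def power2_eq_square intro!: always_eventually)
    show "((\<lambda>h::real. \<bar>h\<bar>) \<longlongrightarrow> 0) (at 0)" by (auto intro!: tendsto_eq_intros)
  qed
  with True show ?thesis by (simp add: DERIV_def)
qed

definition bump :: "real \<Rightarrow> real" where
  "bump t = 4 * (max 0 t - 2 * max 0 (t - 1/2) + max 0 (t - 1))"

definition step :: "real \<Rightarrow> real" where
  "step t = 2 * (sqpos t - 2 * sqpos (t - 1/2) + sqpos (t - 1))"

lemma has_real_derivative_step: "(step has_real_derivative bump t) (at t)"
proof -
  have "((\<lambda>t. sqpos (t - c)) has_real_derivative 2 * max 0 (t - c)) (at t)" for c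
    using DERIV_shift[of sqpos "2 * max 0 (t - c)" t "- c"] has_real_derivative_sqpos[of "t - c"]
    by simp
  from this[of "1/2"] this[of 1] show ?thesis
    unfolding step_def bump_def
    by (auto intro!: derivative_eq_intros has_real_derivative_sqpos)
qed

lemma continuous_bump [continuous_intros]: "continuous_on S g \<Longrightarrow> continuous_on S (\<lambda>x. bump (g x))"
  unfolding bump_def by (intro continuous_intros)

lemma bump_measurable [measurable]: "bump \<in> borel_measurable borel"
  unfolding bump_def by measurable

lemma bump_nonneg: "0 \<le> bump t" and bump_le: "bump t \<le> 2"
  and bump_outside: "t \<notin> {0..1} \<Longrightarrow> bump t = 0"
  by (auto simp: bump_def max_def)

lemma step_0: "t \<le> 0 \<Longrightarrow> step t = 0" and step_1: "1 \<le> t \<Longrightarrow> step t = 1"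
  by (auto simp: step_def sqpos_def max_def power2_eq_square algebra_simps)

lemma step_bounds: "0 \<le> step t" "step t \<le> 1"
proof -
  have mono: "step a \<le> step b" if "a \<le> b" for a b
    using DERIV_nonneg_imp_nondecreasing[OF that] has_real_derivative_step bump_nonneg by blast
  show "0 \<le> step t" using mono[of "min 0 t" t] step_0[of "min 0 t"] by simp
  show "step t \<le> 1" using mono[of t "max 1 t"] step_1[of "max 1 t"] by simp
qed

lemma step_measurable [measurable]: "step \<in> borel_measurable borel"
  unfolding step_def sqpos_def by measurable

lemma bump_integral: "(LINT t|lborel. bump t) = 1"
proof -
  have "(bump has_integral (step 1 - step 0)) {0..1}"
    by (intro fundamental_theorem_of_calculus)
       (auto simp flip: has_real_derivative_iff_has_vector_derivative
             intro: has_field_derivative_at_within has_real_derivative_step)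
  then have "integral {0..1} bump = 1" by (simp add: step_0 step_1 integral_unique)
  moreover have "set_integrable lborel {0..1} bump"
    by (intro borel_integrable_atLeastAtMost') (intro continuous_intros)
  ultimately have "(LINT t:{0..1}|lborel. bump t) = 1"
    by (simp add: set_borel_integral_eq_integral)
  moreover have "(\<lambda>t. indicator {0..1} t *\<^sub>R bump t) = bump"
    using bump_outside by (auto simp: fun_eq_iff indicator_def simp del: of_bool_def)
  ultimately show ?thesis by (simp only: set_lebesgue_integral_def)
qed

lemma bump_approximates_evaluation:
  fixes k :: "real \<Rightarrow> real"
  assumes "continuous_on UNIV k"
  shows "(\<lambda>n. LINT x|lborel. k x * (real (Suc n) * bump (real (Suc n) * (x - a)))) \<longlonglongrightarrow> k a"
proof -
  have km [measurable]: "k \<in> borel_measurable borel" 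
    using assms by (rule borel_measurable_continuous_onI)
  have eq: "(LINT x|lborel. k x * (real (Suc n) * bump (real (Suc n) * (x - a))))
    = (LINT t|lborel. k (a + t / real (Suc n)) * bump t)" for n
    by (subst lborel_integral_real_affine[where c="1 / real (Suc n)" and t=a])
       (simp_all add: mult.left_commute)
  have "compact (k ` {a..a+1})"
    by (intro compact_continuous_image continuous_on_subset[OF assms]) auto
  then obtain M where M: "\<And>x. x \<in> {a..a+1} \<Longrightarrow> \<bar>k x\<bar> \<le> M"
    using compact_imp_bounded bounded_iff by (metis image_eqI real_norm_def)
  have M0: "0 \<le> M" using M[of a] by auto
  have "(\<lambda>n. LINT t|lborel. k (a + t / real (Suc n)) * bump t) \<longlonglongrightarrow> (LINT t|lborel. k a * bump t)"
  proof (rule integral_dominated_convergence[where w="\<lambda>t. indicator {0..1} t * (M * 2)"])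
    show "integrable lborel (\<lambda>t::real. indicator {0..1} t * (M * 2) :: real)"
    proof -
      have "integrable lborel (indicator {0..1} :: real \<Rightarrow> real)"
        by (intro integrable_real_indicator) auto
      then show ?thesis by simp
    qed
    show "AE t in lborel. norm (k (a + t / real (Suc n)) * bump t) \<le> indicator {0..1} t * (M * 2)" for n
    proof (rule AE_I2)
      fix t :: real
      show "norm (k (a + t / real (Suc n)) * bump t) \<le> indicator {0..1} t * (M * 2)"
      proof (cases "t \<in> {0..1}")
        case True
        then have "\<bar>k (a + t / real (Suc n))\<bar> \<le> M" by (intro M) (auto simp: field_simps)
        moreover have "\<bar>bump t\<bar> \<le> 2" using bump_nonneg[of t] bump_le[of t] by simp
        ultimately show ?thesis using True M0 by (simp add: abs_mult mult_mono)
      qed (simp add: bump_outside)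
    qed
    show "AE t in lborel. (\<lambda>n. k (a + t / real (Suc n)) * bump t) \<longlonglongrightarrow> k a * bump t"
    proof (rule AE_I2)
      fix t :: real
      have "(\<lambda>n. a + t / real (Suc n)) \<longlonglongrightarrow> a + 0"
        by (intro tendsto_intros LIMSEQ_Suc[OF lim_const_over_n])
      then have "(\<lambda>n. k (a + t / real (Suc n))) \<longlonglongrightarrow> k a"
        using assms by (metis UNIV_I add.right_neutral continuous_on_eq_continuous_at isCont_tendsto_compose open_UNIV)
      then show "(\<lambda>n. k (a + t / real (Suc n)) * bump t) \<longlonglongrightarrow> k a * bump t" by (intro tendsto_intros)
    qed
  qed measurable
  then show ?thesis by (simp add: eq bump_integral)
qed

text \<open>For a < b and large n this approximates the indicator of (a,b]; its derivative approximates the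
  difference of the point masses at a and b.\<close>

definition plateau :: "nat \<Rightarrow> real \<Rightarrow> real \<Rightarrow> real \<Rightarrow> real" where
  "plateau n a b x = step (real (Suc n) * (x - a)) - step (real (Suc n) * (x - b))"

definition plateau' :: "nat \<Rightarrow> real \<Rightarrow> real \<Rightarrow> real \<Rightarrow> real" where
  "plateau' n a b x = real (Suc n) * bump (real (Suc n) * (x - a)) - real (Suc n) * bump (real (Suc n) * (x - b))"

lemma has_real_derivative_plateau:
  "(plateau n a b has_real_derivative plateau' n a b x) (at x)"
  unfolding plateau_def plateau'_def
  by (auto intro!: derivative_eq_intros DERIV_chain2[OF has_real_derivative_step])

lemma continuous_plateau': "continuous_on S (plateau' n a b)"
  unfolding plateau'_def by (intro continuous_intros)

lemma plateau_measurable [measurable]: "plateau n a b \<in> borel_measurable borel"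
  "plateau' n a b \<in> borel_measurable borel"
  unfolding plateau_def plateau'_def by measurable

lemma plateau_outside:
  assumes "a \<le> b" "x \<notin> {a..b + 1 / real (Suc n)}"
  shows "plateau n a b x = 0" "plateau' n a b x = 0"
proof -
  consider "x < a" | "x > b + 1 / real (Suc n)" using assms by force
  then show "plateau n a b x = 0" "plateau' n a b x = 0"
  proof (atomize (full), cases)
    case 1
    then have "real (Suc n) * (x - a) < 0" "real (Suc n) * (x - b) < 0"
      using assms by (auto simp: mult_pos_neg)
    then show "plateau n a b x = 0 \<and> plateau' n a b x = 0"
      by (auto simp: plateau_def plateau'_def step_0 bump_outside)
  next
    case 2
    then have "real (Suc n) * (x - b) > 1" by (simp add: field_simps)
    moreover have "real (Suc n) * (x - b) \<le> real (Suc n) * (x - a)"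
      using assms by (intro mult_left_mono) auto
    ultimately have "real (Suc n) * (x - a) > 1" "real (Suc n) * (x - b) > 1" by linarith+
    then show "plateau n a b x = 0 \<and> plateau' n a b x = 0"
      by (simp add: plateau_def plateau'_def step_1 bump_outside)
  qed
qed

lemma plateau_bound: "\<bar>plateau n a b x\<bar> \<le> 1"
  unfolding plateau_def using step_bounds[of "real (Suc n) * (x - a)"] step_bounds[of "real (Suc n) * (x - b)"]
  by linarith

text \<open>Testing a continuous function against the derivative of a plateau recovers its increment. All weak
identities below are turned into pointwise ones in this way.\<close>

lemma plateau_test_function:
  fixes k :: "real \<Rightarrow> real"
  assumes "continuous_on UNIV k" "a \<le> b"
  shows "(\<lambda>n. LINT x|lborel. k x * plateau' n a b x) \<longlonglongrightarrow> k a - k b"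
proof -
  have km [measurable]: "k \<in> borel_measurable borel" 
    using assms by (intro borel_measurable_continuous_onI)
  have int: "integrable lborel (\<lambda>x. k x * (real (Suc n) * bump (real (Suc n) * (x - c))))" for n c
  proof -
    have "set_integrable lborel {c..c+1} (\<lambda>x. k x * (real (Suc n) * bump (real (Suc n) * (x - c))))"
      by (intro borel_integrable_atLeastAtMost' continuous_intros continuous_on_subset[OF assms(1)]) auto
    moreover have "(\<lambda>x. indicator {c..c+1} x *\<^sub>R (k x * (real (Suc n) * bump (real (Suc n) * (x - c)))))
      = (\<lambda>x. k x * (real (Suc n) * bump (real (Suc n) * (x - c))))"
    proof (rule ext)
      fix x
      show "indicator {c..c+1} x *\<^sub>R (k x * (real (Suc n) * bump (real (Suc n) * (x - c))))
        = k x * (real (Suc n) * bump (real (Suc n) * (x - c)))"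
      proof (cases "x \<in> {c..c+1}")
        case False
        have "real (Suc n) * (x - c) \<notin> {0..1}"
        proof
          assume *: "real (Suc n) * (x - c) \<in> {0..1}"
          then have "0 \<le> x - c" by (simp add: zero_le_mult_iff)
          moreover have "1 * (x - c) \<le> real (Suc n) * (x - c)" by (intro mult_right_mono) (use \<open>0 \<le> x - c\<close> in auto)
          ultimately show False using False * by auto
        qed
        then show ?thesis by (simp add: bump_outside)
      qed simp
    qed
    ultimately show ?thesis by (simp only: set_integrable_def)
  qed
  have "(LINT x|lborel. k x * plateau' n a b x) =
     (LINT x|lborel. k x * (real (Suc n) * bump (real (Suc n) * (x - a)))) -
     (LINT x|lborel. k x * (real (Suc n) * bump (real (Suc n) * (x - b))))" for n
    
    by (subst Bochner_Integration.integral_diff[symmetric, OF int int]) (simp add: plateau'_def algebra_simps)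
  then show ?thesis
    by (auto intro!: tendsto_intros bump_approximates_evaluation assms)
qed

lemma weak_derivative_increment:
  assumes w: "has_weak_derivative f g" and c: "continuous_on UNIV f" and "a < b"
  shows "f b - f a = (LINT x|lborel. g x * indicator {a<..b} x)"
proof -
  let ?h = "\<lambda>x. g x * indicator {a..b+1} x"
  have g: "set_integrable lborel {-R..R} g" for R
    using w by (auto simp: has_weak_derivative_def locally_integrable_def)
  have gi: "integrable lborel ?h"
  proof -
    have "set_integrable lborel {a..b+1} g"
      by (rule set_integrable_subset[OF g[of "\<bar>a\<bar> + \<bar>b\<bar> + 1"]]) auto
    then show ?thesis by (simp add: set_integrable_def mult.commute)
  qed
  have "\<exists>R. \<forall>x. \<bar>x\<bar> > R \<longrightarrow> plateau n a b x = 0" for n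
  proof (intro exI allI impI plateau_outside)
    fix x assume "\<bar>x\<bar> > \<bar>a\<bar> + \<bar>b\<bar> + 1"
    moreover have "1 / real (Suc n) \<le> 1" by simp
    ultimately show "x \<notin> {a..b + 1 / real (Suc n)}" unfolding atLeastAtMost_iff by linarith
  qed (use \<open>a < b\<close> in simp)
  then have eq: "(LINT x|lborel. f x * plateau' n a b x) = - (LINT x|lborel. g x * plateau n a b x)" for n
    using w has_real_derivative_plateau continuous_plateau'[of UNIV n a b] unfolding has_weak_derivative_def by blast
  have eq2: "g x * plateau n a b x = ?h x * plateau n a b x" for x n
  proof (cases "x \<in> {a..b+1}")
    case False
    have "1 / real (Suc n) \<le> 1" by simp
    with False have "x \<notin> {a..b + 1 / real (Suc n)}" unfolding atLeastAtMost_iff by linarith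
    then show ?thesis using \<open>a < b\<close> by (simp add: plateau_outside)
  qed simp
  have "(\<lambda>n. LINT x|lborel. ?h x * plateau n a b x) \<longlonglongrightarrow>
        (LINT x|lborel. ?h x * indicator {a<..b} x)"
  proof (rule integral_dominated_convergence[where w="\<lambda>x. \<bar>?h x\<bar>"])
    show "integrable lborel (\<lambda>x. \<bar>?h x\<bar>)"
      using gi by (rule integrable_abs)
    show "(\<lambda>x. ?h x * indicator {a<..b} x) \<in> borel_measurable lborel"
      using gi by measurable
    show "(\<lambda>x. ?h x * plateau n a b x) \<in> borel_measurable lborel" for n
      using gi by measurable
    show "AE x in lborel. norm (?h x * plateau n a b x) \<le> \<bar>?h x\<bar>" for n
      using plateau_bound[of n a b] by (intro AE_I2) (simp add: abs_mult mult_left_le)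
    have conv: "(\<lambda>n. step (real (Suc n) * (x - c))) \<longlonglongrightarrow> indicator {c<..} x" for x c
    proof (cases "x \<le> c")
      case True
      then have "step (real (Suc n) * (x - c)) = 0" for n by (intro step_0) (simp add: mult_nonneg_nonpos)
      with True show ?thesis by simp
    next
      case False
      then obtain N where N: "1 / (x - c) < real N" using reals_Archimedean2 by blast
      have "\<forall>\<^sub>F n in sequentially. step (real (Suc n) * (x - c)) = 1"
        using eventually_ge_at_top[of N]
      proof eventually_elim
        case (elim n)
        then have "1 / (x - c) \<le> real (Suc n)" using N by linarith
        then show ?case using False by (intro step_1) (simp add: field_simps)
      qed
      then show ?thesis using False by (auto intro: tendsto_eventually)
    qed
    show "AE x in lborel. (\<lambda>n. ?h x * plateau n a b x) \<longlonglongrightarrow> ?h x * indicator {a<..b} x"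
    proof (intro AE_I2 tendsto_intros)
      fix x
      have "(\<lambda>n. plateau n a b x) \<longlonglongrightarrow> indicator {a<..} x - indicator {b<..} x"
        unfolding plateau_def by (intro tendsto_intros conv)
      moreover have "indicator {a<..} x - indicator {b<..} x = (indicator {a<..b} x :: real)"
        using \<open>a < b\<close> by (auto simp: indicator_def)
      ultimately show "(\<lambda>n. plateau n a b x) \<longlonglongrightarrow> indicator {a<..b} x" by simp
    qed
  qed
  moreover have "?h x * indicator {a<..b} x = g x * indicator {a<..b} x" for x
    by (auto simp: indicator_def)
  ultimately have "(\<lambda>n. LINT x|lborel. g x * plateau n a b x) \<longlonglongrightarrow> (LINT x|lborel. g x * indicator {a<..b} x)"
    by (simp flip: eq2)
  then have "(\<lambda>n. LINT x|lborel. f x * plateau' n a b x) \<longlonglongrightarrow> - (LINT x|lborel. g x * indicator {a<..b} x)"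
    unfolding eq by (rule tendsto_minus)
  from LIMSEQ_unique[OF this plateau_test_function[OF c]] \<open>a < b\<close> show ?thesis by simp
qed

text \<open>The increment of f over (a,b] is the integral of g, and the Cauchy-Schwarz bound for it follows from
the inequality of the means for |g| with the weight s = sqrt (b - a).\<close>

lemma H1_holder:
  assumes "f \<in> H1"
  obtains C where "\<And>a b. \<bar>f a - f b\<bar> \<le> C * sqrt \<bar>a - b\<bar>"
proof -
  obtain g where c: "continuous_on UNIV f" and g: "square_integrable g" and w: "has_weak_derivative f g"
    using assms by (auto simp: H1_def)
  define K where "K = (LINT x|lborel. (g x)\<^sup>2)"
  have gm [measurable]: "g \<in> borel_measurable borel" and g2: "integrable lborel (\<lambda>x. (g x)\<^sup>2)"
    using g by (auto simp: square_integrable_def)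
  have *: "\<bar>f b - f a\<bar> \<le> (1 + K) / 2 * sqrt (b - a)" if "a < b" for a b
  proof -
    define s where "s = sqrt (b - a)"
    have s: "s > 0" "s * s = b - a" using that by (auto simp: s_def)
    have "integrable lborel (indicator {a<..b} :: real \<Rightarrow> real)"
      using that by (intro integrable_real_indicator) auto
    then have int: "integrable lborel (\<lambda>x. (indicator {a<..b} x / s + s * (g x)\<^sup>2) / 2 :: real)"
      using g2 by (intro integrable_divide_zero Bochner_Integration.integrable_add integrable_mult_right) auto
    have pw: "\<bar>g x * indicator {a<..b} x\<bar> \<le> (indicator {a<..b} x / s + s * (g x)\<^sup>2) / 2" for x
    proof (cases "x \<in> {a<..b}")
      case True
      have "0 \<le> (1 - s * \<bar>g x\<bar>)\<^sup>2" by simp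
      also have "\<dots> = 1 - 2 * s * \<bar>g x\<bar> + s * s * (g x)\<^sup>2" by (simp add: power2_eq_square algebra_simps)
      finally have "2 * s * \<bar>g x\<bar> \<le> 1 + s * s * (g x)\<^sup>2" by simp
      then have "s * (2 * \<bar>g x\<bar>) \<le> s * (1 / s + s * (g x)\<^sup>2)" using s(1) by (simp add: algebra_simps)
      then have "\<bar>g x\<bar> \<le> (1 / s + s * (g x)\<^sup>2) / 2" using s(1) by simp
      then show ?thesis using True by simp
    qed (use s in simp)
    have "\<bar>f b - f a\<bar> = \<bar>LINT x|lborel. g x * indicator {a<..b} x\<bar>"
      using weak_derivative_increment[OF w c that] by simp
    also have "\<dots> \<le> (LINT x|lborel. \<bar>g x * indicator {a<..b} x\<bar>)" by (rule integral_abs_bound)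
    also have "\<dots> \<le> (LINT x|lborel. (indicator {a<..b} x / s + s * (g x)\<^sup>2) / 2)"
    proof (intro integral_mono pw int Bochner_Integration.integrable_bound[OF int] AE_I2)
      show "norm \<bar>g x * indicator {a<..b} x\<bar> \<le> norm ((indicator {a<..b} x / s + s * (g x)\<^sup>2) / 2)" for x
        using pw[of x] by (simp del: abs_mult)
    qed (use g2 in measurable)
    also have "\<dots> = ((b - a) / s + s * K) / 2"
      using that g2 by (simp add: K_def)
    also have "\<dots> = (1 + K) / 2 * s" using s by (simp add: field_simps)
    finally show ?thesis by (simp add: s_def)
  qed
  have "\<bar>f a - f b\<bar> \<le> (1 + K) / 2 * sqrt \<bar>a - b\<bar>" for a b
  proof (cases a b rule: linorder_cases)
    case less then show ?thesis using *[of a b] by (simp add: abs_minus_commute)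
  next
    case greater then show ?thesis using *[of b a] by simp
  qed simp
  then show ?thesis by (rule that)
qed

lemma locally_integrable_scale:
  assumes "locally_integrable f" "b \<noteq> 0"
  shows "locally_integrable (\<lambda>x. a * f (b * x))"
  unfolding locally_integrable_def set_integrable_def
proof
  fix R
  let ?R = "\<bar>b\<bar> * R"
  have "integrable lborel (\<lambda>x. indicator {- ?R..?R} x *\<^sub>R f x)"
    using assms(1) by (simp add: locally_integrable_def set_integrable_def)
  then have "integrable lborel (\<lambda>x. indicator {- ?R..?R} (0 + b * x) *\<^sub>R f (0 + b * x))"
    using assms(2) by (rule lborel_integrable_real_affine)
  then have "integrable lborel (\<lambda>x. a * (indicator {- ?R..?R} (0 + b * x) *\<^sub>R f (0 + b * x)))"
    by (rule integrable_mult_right)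
  moreover have "indicator {- ?R..?R} (0 + b * x) = (indicator {-R..R} x :: real)" for x
  proof -
    have "b * x \<in> {- ?R..?R} \<longleftrightarrow> \<bar>b\<bar> * \<bar>x\<bar> \<le> \<bar>b\<bar> * R" by (auto simp: abs_le_iff abs_mult[symmetric])
    also have "\<dots> \<longleftrightarrow> x \<in> {-R..R}" using assms(2) by (auto simp: abs_le_iff)
    finally show ?thesis by (simp add: indicator_def)
  qed
  ultimately show "integrable lborel (\<lambda>x. indicator {-R..R} x *\<^sub>R (a * f (b * x)))"
    by (simp add: mult.left_commute)
qed

lemma square_integrable_scale:
  assumes "square_integrable f" "b \<noteq> 0"
  shows "square_integrable (\<lambda>x. a * f (b * x))"
proof -
  have [measurable]: "f \<in> borel_measurable borel" using assms by (simp add: square_integrable_def)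
  have "integrable lborel (\<lambda>x. (f (0 + b * x))\<^sup>2)"
    using assms by (intro lborel_integrable_real_affine) (auto simp: square_integrable_def)
  then have "integrable lborel (\<lambda>x. a\<^sup>2 * (f (b * x))\<^sup>2)" by simp
  then show ?thesis by (simp add: square_integrable_def power_mult_distrib)
qed

lemma has_weak_derivative_scale:
  assumes w: "has_weak_derivative f g" and b: "b \<noteq> 0"
  shows "has_weak_derivative (\<lambda>x. a * f (b * x)) (\<lambda>x. a * b * g (b * x))"
  unfolding has_weak_derivative_def
proof (intro conjI allI impI)
  show "locally_integrable (\<lambda>x. a * f (b * x))" "locally_integrable (\<lambda>x. a * b * g (b * x))"
    using w b by (auto intro!: locally_integrable_scale simp: has_weak_derivative_def)
  fix \<phi> \<phi>' :: "real \<Rightarrow> real"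
  assume *: "(\<forall>x. (\<phi> has_real_derivative \<phi>' x) (at x)) \<and> continuous_on UNIV \<phi>' \<and> (\<exists>R. \<forall>x. R < \<bar>x\<bar> \<longrightarrow> \<phi> x = 0)"
  then obtain R where R: "\<And>x. R < \<bar>x\<bar> \<Longrightarrow> \<phi> x = 0" by auto
  have 1: "(\<forall>x. ((\<lambda>x. \<phi> (x / b)) has_real_derivative \<phi>' (x / b) / b) (at x))"
  proof
    fix x
    have "(\<phi> has_real_derivative \<phi>' (x / b)) (at (x / b))" using * by blast
    from DERIV_chain2[OF this DERIV_cdivide[OF DERIV_ident]]
    show "((\<lambda>x. \<phi> (x / b)) has_real_derivative \<phi>' (x / b) / b) (at x)" by simp
  qed
  have 2: "continuous_on UNIV (\<lambda>x. \<phi>' (x / b) / b)"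
  proof -
    have c: "continuous_on UNIV \<phi>'" using * by blast
    show ?thesis using b by (intro continuous_on_divide continuous_on_compose2[OF c] continuous_on_id continuous_on_const) auto
  qed
  have 3: "\<exists>R. \<forall>x. R < \<bar>x\<bar> \<longrightarrow> \<phi> (x / b) = 0"
  proof (intro exI allI impI)
    fix x assume "R * \<bar>b\<bar> < \<bar>x\<bar>"
    then have "R < \<bar>x / b\<bar>" using b by (simp add: abs_divide pos_less_divide_eq)
    then show "\<phi> (x / b) = 0" by (rule R)
  qed
  have weak: "(LINT x|lborel. f x * \<eta>' x) = - (LINT x|lborel. g x * \<eta> x)"
    if "\<forall>x. (\<eta> has_real_derivative \<eta>' x) (at x)" "continuous_on UNIV \<eta>'" "\<exists>R. \<forall>x. R < \<bar>x\<bar> \<longrightarrow> \<eta> x = 0" for \<eta> \<eta>'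
    using w that unfolding has_weak_derivative_def by blast
  have key: "(LINT x|lborel. f x * (\<phi>' (x / b) / b)) = - (LINT x|lborel. g x * \<phi> (x / b))"
    by (rule weak[OF 1 2 3])
  have "(LINT x|lborel. a * f (b * x) * \<phi>' x) = \<bar>1 / b\<bar> * (LINT x|lborel. a * f x * \<phi>' (x / b))"
    using lborel_integral_real_affine[of "1 / b" "\<lambda>x. a * f (b * x) * \<phi>' x" 0] b by simp
  also have "(LINT x|lborel. a * f x * \<phi>' (x / b)) = (LINT x|lborel. (a * b) * (f x * (\<phi>' (x / b) / b)))"
    using b by (intro Bochner_Integration.integral_cong refl) simp
  also have "\<dots> = (a * b) * - (LINT x|lborel. g x * \<phi> (x / b))" by (simp only: integral_mult_right_zero key)
  also have "\<bar>1 / b\<bar> * ((a * b) * - (LINT x|lborel. g x * \<phi> (x / b))) = - (\<bar>1 / b\<bar> * (LINT x|lborel. (a * b) * (g x * \<phi> (x / b))))"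
    by simp
  also have "\<bar>1 / b\<bar> * (LINT x|lborel. (a * b) * (g x * \<phi> (x / b))) = (LINT x|lborel. a * b * g (b * x) * \<phi> x)"
    using lborel_integral_real_affine[of "1 / b" "\<lambda>x. a * b * g (b * x) * \<phi> x" 0] b by (simp add: mult.assoc)
  finally show "(LINT x|lborel. a * f (b * x) * \<phi>' x) = - (LINT x|lborel. a * b * g (b * x) * \<phi> x)" .
qed

lemma H1_scale:
  assumes "f \<in> H1" "b \<noteq> 0"
  shows "(\<lambda>x. a * f (b * x)) \<in> H1"
proof -
  obtain g where c: "continuous_on UNIV f" and f: "square_integrable f" and g: "square_integrable g" "has_weak_derivative f g"
    using assms by (auto simp: H1_def)
  have "continuous_on UNIV (\<lambda>x. a * f (b * x))"
    by (intro continuous_intros continuous_on_compose2[OF c]) auto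
  moreover have "square_integrable (\<lambda>x. a * b * g (b * x))" using g assms by (intro square_integrable_scale)
  moreover have "has_weak_derivative (\<lambda>x. a * f (b * x)) (\<lambda>x. a * b * g (b * x))"
    using g assms by (intro has_weak_derivative_scale)
  ultimately show ?thesis using f assms by (auto simp: H1_def intro!: square_integrable_scale)
qed

section \<open>Proportionality from a weak logarithmic derivative\<close>

lemma integrable_supported_continuous:
  fixes k p :: "real \<Rightarrow> real"
  assumes "continuous_on {a..b} k" "continuous_on {a..b} p" "\<And>x. x \<notin> {a..b} \<Longrightarrow> p x = 0"
  shows "integrable lborel (\<lambda>x. k x * p x)"
proof -
  have "set_integrable lborel {a..b} (\<lambda>x. k x * p x)"
    by (intro borel_integrable_atLeastAtMost' continuous_on_mult assms)
  moreover have "(\<lambda>x. indicator {a..b} x *\<^sub>R (k x * p x)) = (\<lambda>x. k x * p x)"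
    using assms(3) by (auto simp: fun_eq_iff indicator_def)
  ultimately show ?thesis unfolding set_integrable_def by simp
qed

text \<open>Where \<psi> has no zero, plateau / \<psi> is an admissible test function, and inserting the equation
\<psi> \<Omega>' = \<psi>' \<Omega> into the weak formulation leaves only the integral of \<Omega> / \<psi> against the
derivative of the plateau. So the quotient has equal values at a and b.\<close>

lemma ratio_constant:
  fixes \<Omega> V \<psi> \<psi>' :: "real \<Rightarrow> real"
  assumes w: "has_weak_derivative \<Omega> V" and c: "continuous_on UNIV \<Omega>"
    and d: "\<And>x. (\<psi> has_real_derivative \<psi>' x) (at x)" and c': "continuous_on UNIV \<psi>'"
    and ae: "AE x in lborel. x \<in> {l<..<r} \<longrightarrow> \<psi> x * V x = \<psi>' x * \<Omega> x"
    and nz: "\<And>x. x \<in> {l<..<r} \<Longrightarrow> \<psi> x \<noteq> 0"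
    and ab: "l < a" "a \<le> b" "b < r"
  shows "\<Omega> a / \<psi> a = \<Omega> b / \<psi> b"
proof -
  define e where "e = (b + r) / 2"
  have e: "b < e" "e < r" using ab by (auto simp: e_def)
  have sub: "{a..e} \<subseteq> {l<..<r}" using ab e by auto
  have cpsi: "continuous_on S \<psi>" for S using d by (meson DERIV_continuous_on has_field_derivative_at_within)
  have kc: "continuous_on {a..e} (\<lambda>x. \<Omega> x / \<psi> x)"
    using nz sub by (intro continuous_on_divide continuous_on_subset[OF c] cpsi) auto
  have k2c: "continuous_on {a..e} (\<lambda>x. \<Omega> x * \<psi>' x / (\<psi> x)\<^sup>2)"
    using nz sub by (intro continuous_on_divide continuous_on_mult continuous_on_power continuous_on_subset[OF c] continuous_on_subset[OF c'] cpsi) auto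
  \<comment> \<open>The plateau overshoots b by 1/(n+1), so the quotient is frozen outside [a,e].\<close>
  define kt where "kt x = (\<lambda>x. \<Omega> x / \<psi> x) (max a (min e x))" for x
  have ktc: "continuous_on UNIV kt"
    unfolding kt_def using ab e by (intro continuous_on_compose2[OF kc] continuous_intros) auto
  obtain N where N: "1 / (e - b) < real N" using reals_Archimedean2 by blast
  have zero: "(LINT x|lborel. kt x * plateau' n a b x) = 0" if "N \<le> n" for n
  proof -
    have "1 / (e - b) < real (Suc n)" using N that by simp
    then have "1 / real (Suc n) < e - b" using e by (simp add: field_simps)
    then have out: "plateau n a b x = 0" "plateau' n a b x = 0" if "x \<notin> {a..e}" for x
      using that ab plateau_outside[of a b x n] by (auto simp: not_le)
    define \<phi> where "\<phi> x = plateau n a b x / \<psi> x" for x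
    define \<phi>' where "\<phi>' x = plateau' n a b x / \<psi> x - plateau n a b x * \<psi>' x / (\<psi> x)\<^sup>2" for x
    have ev: "\<forall>\<^sub>F y in nhds x. y \<notin> {a..e}" if "x \<notin> {a..e}" for x
      using eventually_nhds_in_open[of "- {a..e}" x] that by (simp add: open_Compl)
    have der: "(\<phi> has_real_derivative \<phi>' x) (at x)" for x
    proof (cases "x \<in> {l<..<r}")
      case True
      then have "\<psi> x \<noteq> 0" by (rule nz)
      then show ?thesis unfolding \<phi>_def[abs_def]
        by (intro DERIV_cong[OF DERIV_divide[OF has_real_derivative_plateau d]])
           (simp_all add: \<phi>'_def power2_eq_square diff_divide_distrib)
    next
      case False
      then have x: "x \<notin> {a..e}" using sub by auto
      have "\<forall>\<^sub>F y in nhds x. 0 = \<phi> y" using ev[OF x] by eventually_elim (simp add: \<phi>_def out)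
      moreover have "\<phi>' x = 0" using out[OF x] by (simp add: \<phi>'_def)
      ultimately show ?thesis using DERIV_cong_ev[OF refl, of "\<lambda>_. 0" \<phi> x 0 0] by simp
    qed
    have "continuous_on UNIV \<phi>'"
    proof (intro continuous_at_imp_continuous_on ballI)
      fix x
      show "isCont \<phi>' x"
      proof (cases "x \<in> {l<..<r}")
        case True
        then have "\<psi> x \<noteq> 0" by (rule nz)
        moreover have "isCont \<psi> x" "isCont (plateau n a b) x"
          by (rule DERIV_isCont[OF d], rule DERIV_isCont[OF has_real_derivative_plateau])
        moreover have "isCont (plateau' n a b) x" "isCont \<psi>' x"
          using continuous_plateau'[of UNIV n a b] c' by (simp_all add: continuous_on_eq_continuous_at)
        ultimately show ?thesis unfolding \<phi>'_def[abs_def] by (intro continuous_intros) auto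
      next
        case False
        then have x: "x \<notin> {a..e}" using sub by auto
        have "\<forall>\<^sub>F y in nhds x. \<phi>' y = 0" using ev[OF x] by eventually_elim (simp add: \<phi>'_def out)
        then show ?thesis using isCont_cong[of \<phi>' "\<lambda>_. 0" x] by simp
      qed
    qed
    moreover have "\<exists>R. \<forall>x. R < \<bar>x\<bar> \<longrightarrow> \<phi> x = 0"
    proof (intro exI allI impI)
      fix x assume "\<bar>a\<bar> + \<bar>e\<bar> < \<bar>x\<bar>"
      then have "x \<notin> {a..e}" unfolding atLeastAtMost_iff by linarith
      then show "\<phi> x = 0" by (simp add: \<phi>_def out)
    qed
    ultimately have weak: "(LINT x|lborel. \<Omega> x * \<phi>' x) = - (LINT x|lborel. V x * \<phi> x)"
      using w der unfolding has_weak_derivative_def by blast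
    define A where "A x = \<Omega> x / \<psi> x * plateau' n a b x" for x
    define B where "B x = \<Omega> x * \<psi>' x / (\<psi> x)\<^sup>2 * plateau n a b x" for x
    have iA: "integrable lborel A" unfolding A_def
      by (intro integrable_supported_continuous[OF kc continuous_plateau']) (simp add: out)
    have iB: "integrable lborel B" unfolding B_def
    proof (intro integrable_supported_continuous[OF k2c])
      show "continuous_on {a..e} (plateau n a b)"
        using has_real_derivative_plateau by (meson DERIV_continuous_on has_field_derivative_at_within)
    qed (simp add: out)
    have "(LINT x|lborel. \<Omega> x * \<phi>' x) = (LINT x|lborel. A x - B x)"
      by (intro Bochner_Integration.integral_cong refl) (simp add: A_def B_def \<phi>'_def right_diff_distrib mult_ac)
    also have "\<dots> = (LINT x|lborel. A x) - (LINT x|lborel. B x)"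
      using iA iB by (rule Bochner_Integration.integral_diff)
    finally have 1: "(LINT x|lborel. \<Omega> x * \<phi>' x) = (LINT x|lborel. A x) - (LINT x|lborel. B x)" .
    have Vm [measurable]: "V \<in> borel_measurable lborel"
    proof -
      have "set_borel_measurable lborel {- real i..real i} V" for i
        using w unfolding has_weak_derivative_def locally_integrable_def set_integrable_def set_borel_measurable_def by blast
      then have m: "(\<lambda>x. indicator {- real i..real i} x *\<^sub>R V x) \<in> borel_measurable lborel" for i
        unfolding set_borel_measurable_def .
      show ?thesis
      proof (rule borel_measurable_LIMSEQ_real[OF _ m])
        fix x
        obtain n0 where n0: "\<bar>x\<bar> < real n0" using reals_Archimedean2 by blast
        have "\<forall>\<^sub>F i in sequentially. indicator {- real i..real i} x *\<^sub>R V x = V x"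
        proof (rule eventually_mono[OF eventually_ge_at_top[of n0]])
          fix i assume "n0 \<le> i"
          then have "real n0 \<le> real i" by simp
          with n0 have "- real i \<le> x" "x \<le> real i" by linarith+
          then show "indicator {- real i..real i} x *\<^sub>R V x = V x" by simp
        qed
        then show "(\<lambda>i. indicator {- real i..real i} x *\<^sub>R V x) \<longlonglongrightarrow> V x" by (rule tendsto_eventually)
      qed
    qed
    have "(LINT x|lborel. V x * \<phi> x) = (LINT x|lborel. B x)"
    proof (rule integral_cong_AE)
      show "AE x in lborel. V x * \<phi> x = B x"
        using ae
      proof eventually_elim
        case (elim x)
        show ?case
        proof (cases "x \<in> {a..e}")
          case True
          then have x: "x \<in> {l<..<r}" using sub by auto
          have "V x = \<psi>' x * \<Omega> x / \<psi> x" using elim x nz[OF x] by (simp add: field_simps)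
          then show ?thesis using nz[OF x] by (simp add: B_def \<phi>_def power2_eq_square)
        qed (simp add: B_def \<phi>_def out)
      qed
      have "\<phi> \<in> borel_measurable borel"
        using der by (intro borel_measurable_continuous_onI) (meson DERIV_continuous_on has_field_derivative_at_within)
      then show "(\<lambda>x. V x * \<phi> x) \<in> borel_measurable lborel" by measurable
      show "B \<in> borel_measurable lborel" using iB by simp
    qed
    with 1 weak have "(LINT x|lborel. A x) = 0" by simp
    moreover have "A x = kt x * plateau' n a b x" for x
    proof (cases "x \<in> {a..e}")
      case True
      then have "max a (min e x) = x" by auto
      then show ?thesis by (simp add: A_def kt_def)
    qed (simp add: A_def out)
    ultimately show ?thesis by simp
  qed
  have "(\<lambda>n. LINT x|lborel. kt x * plateau' n a b x) \<longlonglongrightarrow> 0"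
  proof (rule tendsto_eventually)
    show "\<forall>\<^sub>F n in sequentially. (LINT x|lborel. kt x * plateau' n a b x) = 0"
      using eventually_ge_at_top[of N] by eventually_elim (rule zero)
  qed
  from LIMSEQ_unique[OF this plateau_test_function[OF ktc ab(2)]] have "kt a = kt b" by simp
  then show ?thesis using ab e by (simp add: kt_def max_def min_def)
qed

text \<open>Zeros of \<psi> are excluded by the non-vanishing of \<Omega>: the set on which \<Omega> is the given multiple of
\<psi> is closed, and it is open because \<psi> cannot vanish on it, so that the quotient is locally
constant there. By connectedness it is the whole interval.\<close>

lemma proportional_of_logarithmic_derivative:
  fixes \<Omega> V \<psi> \<psi>' :: "real \<Rightarrow> real"
  assumes w: "has_weak_derivative \<Omega> V" and c: "continuous_on UNIV \<Omega>"
    and d: "\<And>x. (\<psi> has_real_derivative \<psi>' x) (at x)" and c': "continuous_on UNIV \<psi>'"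
    and ae: "AE x in lborel. x \<in> {l<..<r} \<longrightarrow> \<psi> x * V x = \<psi>' x * \<Omega> x"
    and nz: "\<And>x. x \<in> {l<..<r} \<Longrightarrow> \<Omega> x \<noteq> 0"
    and x0: "x0 \<in> {l<..<r}" "\<psi> x0 \<noteq> 0"
  shows "\<forall>x\<in>{l<..<r}. \<Omega> x = \<Omega> x0 / \<psi> x0 * \<psi> x"
proof -
  let ?S = "{l<..<r}"
  define T where "T = {x \<in> ?S. \<Omega> x * \<psi> x0 - \<Omega> x0 * \<psi> x = 0}"
  have cpsi: "continuous_on S \<psi>" for S using d by (meson DERIV_continuous_on has_field_derivative_at_within)
  have "closedin (top_of_set ?S) T"
    unfolding T_def
    by (intro continuous_closedin_preimage_constant continuous_intros cpsi continuous_on_subset[OF c]) auto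
  moreover have "openin (top_of_set ?S) T"
  proof (subst openin_open_eq)
    show "open ?S" by simp
    have "open T"
    proof (rule openI)
      fix x assume "x \<in> T"
      then have x: "x \<in> ?S" "\<Omega> x * \<psi> x0 = \<Omega> x0 * \<psi> x" by (auto simp: T_def)
      have px: "\<psi> x \<noteq> 0" using x nz[OF x(1)] x0 by auto
      have "open (?S \<inter> \<psi> -` (- {0}))"
        by (intro continuous_open_preimage cpsi) auto
      moreover have "x \<in> ?S \<inter> \<psi> -` (- {0})" using x px by auto
      ultimately obtain \<epsilon> where eps: "0 < \<epsilon>" "ball x \<epsilon> \<subseteq> ?S \<inter> \<psi> -` (- {0})"
        using open_contains_ball by blast
      have J: "{x - \<epsilon><..<x + \<epsilon>} \<subseteq> ?S \<inter> \<psi> -` (- {0})" using eps(2) by (simp add: ball_eq_greaterThanLessThan)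
      have ratio: "\<Omega> s / \<psi> s = \<Omega> t / \<psi> t" if "x - \<epsilon> < s" "s \<le> t" "t < x + \<epsilon>" for s t
      proof (rule ratio_constant[OF w c d c' _ _ that])
        show "AE x' in lborel. x' \<in> {x - \<epsilon><..<x + \<epsilon>} \<longrightarrow> \<psi> x' * V x' = \<psi>' x' * \<Omega> x'"
          using ae by eventually_elim (use J in blast)
      qed (use J in blast)
      have "ball x \<epsilon> \<subseteq> T"
      proof
        fix y assume "y \<in> ball x \<epsilon>"
        then have y: "x - \<epsilon> < y" "y < x + \<epsilon>" by (auto simp: ball_eq_greaterThanLessThan)
        then have yS: "y \<in> ?S" "\<psi> y \<noteq> 0" using J by auto
        have "\<Omega> y / \<psi> y = \<Omega> x / \<psi> x"
        proof (cases "y \<le> x")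
          case True
          then show ?thesis using y eps(1) by (intro ratio) auto
        next
          case False
          then have "\<Omega> x / \<psi> x = \<Omega> y / \<psi> y" using y eps(1) by (intro ratio) auto
          then show ?thesis by (rule sym)
        qed
        moreover have "\<Omega> x / \<psi> x = \<Omega> x0 / \<psi> x0" using x(2) px x0(2) by (simp add: field_simps)
        ultimately have "\<Omega> y / \<psi> y = \<Omega> x0 / \<psi> x0" by simp
        then have "\<Omega> y * \<psi> x0 = \<Omega> x0 * \<psi> y" using yS(2) x0(2) by (simp add: field_simps)
        then show "y \<in> T" using yS(1) by (simp add: T_def)
      qed
      then show "\<exists>e>0. ball x e \<subseteq> T" using eps(1) by blast
    qed
    then show "open T \<and> T \<subseteq> ?S" by (auto simp: T_def)
  qed
  moreover have "x0 \<in> T" using x0 by (simp add: T_def)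
  moreover have "connected ?S" by simp
  ultimately have "T = ?S" by (metis connected_clopen empty_iff)
  then show ?thesis using x0(2) unfolding T_def by (auto simp: field_simps)
qed

section \<open>The logarithmic potential of an odd profile\<close>

text \<open>The real logarithm is extended by ln (-x) = ln x and ln 0 = 0. Hence ln may be written for ln |.| in
all logarithmic kernels, and 1/x is its derivative on both sides of 0.\<close>

lemma DERIV_ln_nonzero:
  fixes x :: real
  assumes "x \<noteq> 0"
  shows "(ln has_real_derivative 1 / x) (at x)"
proof (cases "x > 0")
  case True
  then show ?thesis by (rule DERIV_ln_divide)
next
  case False
  with assms have "((\<lambda>x. ln (- x)) has_real_derivative 1 / (- x) * (- 1)) (at x)"
    by (intro DERIV_chain2[OF DERIV_ln_divide]) (auto intro!: derivative_eq_intros)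
  then show ?thesis by (simp add: ln_minus)
qed

lemma ln_abs: "ln \<bar>x\<bar> = ln x" for x :: real
  by (simp add: abs_if ln_minus)

lemma ln_abs_diff: "ln \<bar>x - y\<bar> = ln (y - x)" for x y :: real
  using ln_minus[of "y - x"] by (simp add: ln_abs)

lemma ln_swap: "ln (y - x) = ln (x - y)" for x y :: real
  using ln_minus[of "y - x"] by simp

lemma abs_ln_le:
  fixes x :: real
  shows "\<bar>ln x\<bar> \<le> 2 / sqrt \<bar>x\<bar> + \<bar>x\<bar>"
proof (cases "x = 0")
  case False
  define y where "y = \<bar>x\<bar>"
  have y: "y > 0" and eq: "ln x = ln y"
    using False by (auto simp: y_def abs_real_def ln_minus)
  have "ln y \<le> y" using ln_le_minus_one[OF y] by simp
  moreover have "- ln y \<le> 2 / sqrt y"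
  proof -
    have "ln (1 / sqrt y) \<le> 1 / sqrt y - 1" using y by (intro ln_le_minus_one) auto
    moreover have "ln (1 / sqrt y) = - (ln y / 2)" using y by (simp add: ln_div ln_sqrt)
    ultimately show ?thesis by simp
  qed
  moreover have "0 \<le> 2 / sqrt y" using y by simp
  ultimately have "\<bar>ln y\<bar> \<le> 2 / sqrt y + y" using y by linarith
  then show ?thesis by (simp add: eq y_def)
qed simp

lemma abs_mult_ln_le: "\<bar>x * ln x\<bar> \<le> 2 * sqrt \<bar>x\<bar> + x\<^sup>2" for x :: real
proof (cases "x = 0")
  case False
  have "\<bar>x * ln x\<bar> \<le> \<bar>x\<bar> * (2 / sqrt \<bar>x\<bar> + \<bar>x\<bar>)"
    unfolding abs_mult by (intro mult_left_mono abs_ln_le) auto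
  also have "\<dots> = 2 * (\<bar>x\<bar> / sqrt \<bar>x\<bar>) + \<bar>x\<bar> * \<bar>x\<bar>" by (simp add: distrib_left)
  also have "\<bar>x\<bar> / sqrt \<bar>x\<bar> = sqrt \<bar>x\<bar>" by (rule real_div_sqrt) simp
  finally show ?thesis by (simp add: power2_eq_square)
qed simp

lemma nonneg_has_integral_set_integrable:
  fixes g :: "real \<Rightarrow> real"
  assumes "(g has_integral I) {a..b}" "\<And>x. x \<in> {a..b} \<Longrightarrow> 0 \<le> g x" "g \<in> borel_measurable borel"
  shows "set_integrable lborel {a..b} g"
proof -
  have "g absolutely_integrable_on {a..b}"
    using assms by (intro nonnegative_absolutely_integrable_1) (auto simp: has_integral_integrable)
  then show ?thesis
    using assms(3) by (simp add: set_integrable_def integrable_completion)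
qed

lemma integrable_inverse_sqrt:
  assumes "0 \<le> R"
  shows "integrable lborel (\<lambda>z. indicator {-R..R} z * (1 / sqrt \<bar>z\<bar>) :: real)"
proof -
  have "((\<lambda>z. 1 / sqrt z) has_integral 2 * sqrt R - 2 * sqrt 0) {0..R}"
    using assms
    by (intro fundamental_theorem_of_calculus_interior)
       (auto intro!: derivative_eq_intros continuous_intros
             simp flip: has_real_derivative_iff_has_vector_derivative simp: field_simps)
  then have "set_integrable lborel {0..R} (\<lambda>z. 1 / sqrt z)"
    by (intro nonneg_has_integral_set_integrable) auto
  then have 1: "integrable lborel (\<lambda>z. indicator {0..R} z * (1 / sqrt z))"
    by (simp add: set_integrable_def)
  have 2: "integrable lborel (\<lambda>z. indicator {0..R} (- z) * (1 / sqrt (- z)))"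
    using lborel_integrable_real_affine[OF 1, of "-1" 0] by simp
  have "integrable lborel (\<lambda>z. indicator {0..R} z * (1 / sqrt z) + indicator {0..R} (- z) * (1 / sqrt (- z)))"
    using 1 2 by (rule Bochner_Integration.integrable_add)
  moreover have "(\<lambda>z. indicator {0..R} z * (1 / sqrt z) + indicator {0..R} (- z) * (1 / sqrt (- z)))
     = (\<lambda>z. indicator {-R..R} z * (1 / sqrt \<bar>z\<bar>))"
    by (auto simp: indicator_def abs_real_def fun_eq_iff)
  ultimately show ?thesis by simp
qed

lemma integrable_ln:
  assumes "0 \<le> R"
  shows "integrable lborel (\<lambda>z. indicator {-R..R} z * ln z :: real)"
proof (rule Bochner_Integration.integrable_bound)
  show "integrable lborel (\<lambda>z. 2 * (indicator {-R..R} z * (1 / sqrt \<bar>z\<bar>)) + R * indicator {-R..R} z)"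
    using integrable_inverse_sqrt[OF assms] assms
    by (intro Bochner_Integration.integrable_add integrable_mult_right integrable_real_indicator) auto
  show "AE z in lborel. norm (indicator {-R..R} z * ln z) \<le>
      norm (2 * (indicator {-R..R} z * (1 / sqrt \<bar>z\<bar>)) + R * indicator {-R..R} z)"
  proof (intro AE_I2)
    fix z :: real
    show "norm (indicator {-R..R} z * ln z) \<le>
      norm (2 * (indicator {-R..R} z * (1 / sqrt \<bar>z\<bar>)) + R * indicator {-R..R} z)"
      using abs_ln_le[of z] assms by (auto simp: indicator_def)
  qed
qed measurable

text \<open>Hoelder continuity of exponent 1/2, which every member of V has, makes the singular integrals
  below absolutely convergent.\<close>

locale odd_profile =
  fixes f :: "real \<Rightarrow> real" and C :: real
  assumes cont: "continuous_on UNIV f"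
    and odd: "\<And>x. f (- x) = - f x"
    and supp: "\<And>x. 1 \<le> \<bar>x\<bar> \<Longrightarrow> f x = 0"
    and holder: "\<And>a b. \<bar>f a - f b\<bar> \<le> C * sqrt \<bar>a - b\<bar>"
begin

abbreviation \<psi> :: "real \<Rightarrow> real" where "\<psi> \<equiv> inv_half_laplacian f"

lemma C_nonneg: "0 \<le> C" using holder[of 0 1] by simp

lemma measurable_f [measurable]: "f \<in> borel_measurable borel"
  using cont by (rule borel_measurable_continuous_onI)

lemma f_0 [simp]: "f 0 = 0" using odd[of 0] by simp

lemma f_bound: "\<bar>f x\<bar> \<le> 2 * C"
proof (cases "1 \<le> \<bar>x\<bar>")
  case True then show ?thesis using supp C_nonneg by simp
next
  case False
  have "\<bar>f x - f 0\<bar> \<le> C * sqrt \<bar>x - 0\<bar>" by (rule holder)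
  also have "\<dots> \<le> C * 2" using False C_nonneg by (intro mult_left_mono real_le_lsqrt) auto
  finally show ?thesis by simp
qed

text \<open>The antiderivative of f with compact support: it vanishes to the right of 1 because f is odd. The
lower limit is any point to the left of the support.\<close>

definition F :: "real \<Rightarrow> real" where "F x = integral {-2..x} f"

lemma F_left: "x < -1 \<Longrightarrow> F x = 0"
proof -
  assume "x < -1"
  then have "integral {-2..x} f = integral {-2..x} (\<lambda>x. 0)"
    by (intro integral_cong supp) auto
  then show ?thesis by (simp add: F_def)
qed

lemma DERIV_F: "(F has_real_derivative f x) (at x)"
proof (cases "x < -1")
  case True
  have "\<forall>\<^sub>F y in nhds x. 0 = F y"
    using eventually_nhds_in_open[of "{..<-1}" x] True by (auto elim!: eventually_mono simp: F_left)
  then have "((\<lambda>y. 0) has_real_derivative f x) (at x) \<longleftrightarrow> (F has_real_derivative f x) (at x)"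
    by (intro DERIV_cong_ev) auto
  moreover have "f x = 0" using True by (intro supp) auto
  ultimately show ?thesis by simp
next
  case False
  have "(F has_real_derivative f x) (at x within {-2..x+1})"
    unfolding F_def using False
    by (intro integral_has_real_derivative continuous_on_subset[OF cont]) auto
  moreover have "x \<in> interior {-2..x+1}" using False by simp
  ultimately show ?thesis by (metis at_within_interior)
qed

lemma continuous_F: "continuous_on S F"
  using DERIV_F by (meson DERIV_continuous_on has_field_derivative_at_within)

lemma measurable_F [measurable]: "F \<in> borel_measurable borel"
  using continuous_F by (rule borel_measurable_continuous_onI)

lemma F_outside: "1 < \<bar>x\<bar> \<Longrightarrow> F x = 0"
proof -
  assume x: "1 < \<bar>x\<bar>"
  have even: "F y = F (- y)" for y
  proof -
    have "((\<lambda>y. F y - F (- y)) has_real_derivative 0) (at y)" for y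
      using DERIV_diff[OF DERIV_F[of y] DERIV_chain2[OF DERIV_F[of "- y"] DERIV_minus[OF DERIV_ident]]]
      by (simp add: odd)
    then have "F y - F (- y) = F 0 - F (- 0)"
      using DERIV_isconst_all[of "\<lambda>y. F y - F (- y)"] by blast
    then show ?thesis by simp
  qed
  show ?thesis
  proof (cases "x < 0")
    case True then show ?thesis using x by (intro F_left) auto
  next
    case False
    then have "F (- x) = 0" using x by (intro F_left) auto
    then show ?thesis using even[of x] by simp
  qed
qed

text \<open>This bound dominates the x-difference quotients of (F (x + z) - F x) / z by a multiple of
1 / sqrt |z|, which is integrable near 0.\<close>

lemma increment_bound: "\<bar>(F (y + z) - F y) - (F (x + z) - F x)\<bar> \<le> C * sqrt \<bar>z\<bar> * \<bar>y - x\<bar>"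
proof -
  have "norm ((\<lambda>t. F (t + z) - F t) y - (\<lambda>t. F (t + z) - F t) x) \<le> C * sqrt \<bar>z\<bar> * norm (y - x)"
  proof (rule field_differentiable_bound[where S=UNIV and f' = "\<lambda>t. f (t + z) - f t"])
    show "((\<lambda>t. F (t + z) - F t) has_field_derivative f (t + z) - f t) (at t within UNIV)" for t
      using DERIV_F by (auto intro!: derivative_eq_intros DERIV_chain2[OF DERIV_F])
    show "norm (f (t + z) - f t) \<le> C * sqrt \<bar>z\<bar>" for t using holder[of "t + z" t] by simp
  qed auto
  then show ?thesis by simp
qed

lemma F_lipschitz: "\<bar>F y - F x\<bar> \<le> 2 * C * \<bar>y - x\<bar>"
proof -
  have "norm (F y - F x) \<le> 2 * C * norm (y - x)"
    by (rule field_differentiable_bound[where S=UNIV and f' = f])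
       (use DERIV_F f_bound in auto)
  then show ?thesis by simp
qed

text \<open>After an integration by parts, pi times the potential of f at x is E R x for any large cutoff R:
  an absolutely convergent integral of difference quotients of F. Differentiation under the integral
  sign turns it into D R x, which is -pi times the Hilbert transform of f.\<close>

definition E :: "real \<Rightarrow> real \<Rightarrow> real" where
  "E R x = (LINT z|lborel. indicator {-R..R} z * ((F (x + z) - F x) / z))"

definition D :: "real \<Rightarrow> real \<Rightarrow> real" where
  "D R x = (LINT z|lborel. indicator {-R..R} z * ((f (x + z) - f x) / z))"

lemma quotient_bound: "\<bar>(f (x + z) - f x) / z\<bar> \<le> C * (1 / sqrt \<bar>z\<bar>)"
proof (cases "z = 0")
  case False
  have "\<bar>(f (x + z) - f x) / z\<bar> \<le> (C * sqrt \<bar>z\<bar>) / \<bar>z\<bar>"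
    unfolding abs_divide using holder[of "x + z" x] by (intro divide_right_mono) auto
  also have "\<dots> = C * (1 / sqrt \<bar>z\<bar>)" using False by (simp add: field_simps)
  finally show ?thesis .
qed simp

abbreviation majorant :: "real \<Rightarrow> real \<Rightarrow> real" where
  "majorant R z \<equiv> C * (indicator {-R..R} z * (1 / sqrt \<bar>z\<bar>))"

lemma integrable_majorant:
  "0 \<le> R \<Longrightarrow> integrable lborel (majorant R)"
  by (intro integrable_mult_right integrable_inverse_sqrt)

lemma E_integrable:
  assumes "0 \<le> R"
  shows "integrable lborel (\<lambda>z. indicator {-R..R} z * ((F (x + z) - F x) / z))"
proof (rule Bochner_Integration.integrable_bound)
  show "integrable lborel (\<lambda>z. 2 * C * indicator {-R..R} z :: real)"
    using assms by (intro integrable_mult_right integrable_real_indicator) auto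
  show "AE z in lborel. norm (indicator {-R..R} z * ((F (x + z) - F x) / z)) \<le> norm (2 * C * indicator {-R..R} z :: real)"
  proof (intro AE_I2)
    fix z :: real
    have "\<bar>(F (x + z) - F x) / z\<bar> \<le> 2 * C"
      using F_lipschitz[of "x + z" x] C_nonneg by (cases "z = 0") (auto simp: field_simps)
    then show "norm (indicator {-R..R} z * ((F (x + z) - F x) / z)) \<le> norm (2 * C * indicator {-R..R} z :: real)"
      using C_nonneg by (auto simp: indicator_def)
  qed
qed measurable

lemma D_integrable:
  assumes "0 \<le> R"
  shows "integrable lborel (\<lambda>z. indicator {-R..R} z * ((f (x + z) - f x) / z))"
proof (rule Bochner_Integration.integrable_bound[OF integrable_majorant[OF assms]])
  show "AE z in lborel. norm (indicator {-R..R} z * ((f (x + z) - f x) / z)) \<le> norm (majorant R z)"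
    using quotient_bound[of x] C_nonneg by (intro AE_I2) (auto simp: indicator_def abs_mult)
qed measurable

lemma DERIV_E:
  assumes "0 \<le> R"
  shows "(E R has_real_derivative D R x) (at x)"
  unfolding has_field_derivative_iff tendsto_at_iff_sequentially
proof (intro allI impI)
  fix X assume X: "\<forall>i. X i \<in> UNIV - {x}" "X \<longlonglongrightarrow> x"
  let ?s = "\<lambda>i z. indicator {-R..R} z * ((((F (X i + z) - F (X i)) - (F (x + z) - F x)) / (X i - x)) / z)"
  have eq: "(E R (X i) - E R x) / (X i - x) =
    (LINT z|lborel. ?s i z)" for i
  proof -
    have "E R (X i) - E R x = (LINT z|lborel. indicator {-R..R} z * ((F (X i + z) - F (X i)) / z)
        - indicator {-R..R} z * ((F (x + z) - F x) / z))"
      unfolding E_def by (intro Bochner_Integration.integral_diff[symmetric] E_integrable assms)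
    then have "(E R (X i) - E R x) / (X i - x) = (LINT z|lborel. indicator {-R..R} z * ((F (X i + z) - F (X i)) / z)
        - indicator {-R..R} z * ((F (x + z) - F x) / z)) / (X i - x)"
      by (rule arg_cong)
    also have "\<dots> = (LINT z|lborel. (indicator {-R..R} z * ((F (X i + z) - F (X i)) / z)
        - indicator {-R..R} z * ((F (x + z) - F x) / z)) / (X i - x))"
      by (rule integral_divide_zero[symmetric])
    also have "\<dots> = (LINT z|lborel. ?s i z)"
    proof (intro Bochner_Integration.integral_cong refl)
      have "(c * (A / z) - c * (B / z)) / d = c * (((A - B) / d) / z)" for c A B z d :: real
        by (simp add: divide_inverse algebra_simps)
      then show "(indicator {-R..R} z * ((F (X i + z) - F (X i)) / z)
        - indicator {-R..R} z * ((F (x + z) - F x) / z)) / (X i - x) =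
        ?s i z" for z .
    qed
    finally show ?thesis .
  qed
  have "(\<lambda>i. LINT z|lborel. ?s i z)
     \<longlonglongrightarrow> D R x"
    unfolding D_def
  proof (rule integral_dominated_convergence[where w="majorant R"])
    show "integrable lborel (majorant R)"
      by (rule integrable_majorant[OF assms])
    show "AE z in lborel. norm (?s i z)
       \<le> majorant R z" for i
    proof (intro AE_I2)
      fix z :: real
      have "\<bar>((F (X i + z) - F (X i)) - (F (x + z) - F x)) / (X i - x)\<bar> \<le> C * sqrt \<bar>z\<bar>"
        using increment_bound[of "X i" z x] X(1) by (auto simp: abs_divide pos_divide_le_eq)
      then have "\<bar>((F (X i + z) - F (X i)) - (F (x + z) - F x)) / (X i - x) / z\<bar> \<le> C * sqrt \<bar>z\<bar> / \<bar>z\<bar>"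
        unfolding abs_divide[of _ z] by (intro divide_right_mono) auto
      also have "\<dots> = C * (1 / sqrt \<bar>z\<bar>)"
        by (cases "z = 0") (auto simp: field_simps)
      finally show "norm (?s i z)
       \<le> majorant R z"
        using C_nonneg by (auto simp: indicator_def)
    qed
    show "AE z in lborel. (\<lambda>i. ?s i z)
       \<longlonglongrightarrow> indicator {-R..R} z * ((f (x + z) - f x) / z)"
    proof (intro AE_I2)
      fix z :: real
      have "((\<lambda>t. F (t + z) - F t) has_real_derivative f (x + z) - f x) (at x)"
        using DERIV_F by (auto intro!: derivative_eq_intros DERIV_chain2[OF DERIV_F])
      then have "(\<lambda>i. ((F (X i + z) - F (X i)) - (F (x + z) - F x)) / (X i - x)) \<longlonglongrightarrow> f (x + z) - f x"
        using X unfolding has_field_derivative_iff tendsto_at_iff_sequentially by (auto simp: comp_def)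
      then show "(\<lambda>i. ?s i z)
       \<longlonglongrightarrow> indicator {-R..R} z * ((f (x + z) - f x) / z)"
        by (cases "z = 0") (simp_all only: div_by_0, simp, intro tendsto_mult tendsto_divide tendsto_const)
    qed
  qed measurable
  then show "((\<lambda>y. (E R y - E R x) / (y - x)) \<circ> X) \<longlonglongrightarrow> D R x" by (simp add: comp_def eq)
qed

lemma continuous_D:
  assumes "0 \<le> R"
  shows "continuous_on S (D R)"
proof (rule continuous_at_imp_continuous_on, intro ballI, unfold continuous_at_sequentially, intro allI impI)
  fix x and X :: "nat \<Rightarrow> real" assume X: "X \<longlonglongrightarrow> x"
  have "(\<lambda>i. D R (X i)) \<longlonglongrightarrow> D R x"
    unfolding D_def
  proof (rule integral_dominated_convergence[where w="majorant R"])
    show "integrable lborel (majorant R)"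
      by (rule integrable_majorant[OF assms])
    show "AE z in lborel. norm (indicator {-R..R} z * ((f (X i + z) - f (X i)) / z)) \<le> majorant R z" for i
      using quotient_bound[of "X i"] C_nonneg by (intro AE_I2) (auto simp: indicator_def abs_mult)
    have "(\<lambda>i. f (X i + z)) \<longlonglongrightarrow> f (x + z)" for z
      using X cont by (intro isCont_tendsto_compose[of _ f] tendsto_intros) (auto simp: continuous_on_eq_continuous_at)
    from this this[of 0] show "AE z in lborel. (\<lambda>i. indicator {-R..R} z * ((f (X i + z) - f (X i)) / z)) \<longlonglongrightarrow> indicator {-R..R} z * ((f (x + z) - f x) / z)"
      by (intro AE_I2) (auto simp: divide_inverse intro!: tendsto_intros)
  qed measurable
  then show "(D R \<circ> X) \<longlonglongrightarrow> D R x" by (simp add: comp_def)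
qed

lemma integrable_f_ln: "integrable lborel (\<lambda>y. f y * ln (x - y))"
proof (rule Bochner_Integration.integrable_bound)
  define R where "R = \<bar>x\<bar> + 1"
  have "integrable lborel (\<lambda>y. indicator {-R..R} (x + -1 * y) * ln (x + -1 * y))"
    by (intro lborel_integrable_real_affine integrable_ln) (auto simp: R_def)
  then show "integrable lborel (\<lambda>y. 2 * C * (indicator {-R..R} (x - y) * ln (x - y)))"
    by (intro integrable_mult_right) simp
  show "AE y in lborel. norm (f y * ln (x - y)) \<le> norm (2 * C * (indicator {-R..R} (x - y) * ln (x - y)))"
  proof (intro AE_I2)
    fix y
    show "norm (f y * ln (x - y)) \<le> norm (2 * C * (indicator {-R..R} (x - y) * ln (x - y)))"
    proof (cases "\<bar>y\<bar> \<le> 1")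
      case True
      then have "x - y \<in> {-R..R}" by (auto simp: R_def)
      then show ?thesis using f_bound[of y] C_nonneg by (simp add: abs_mult mult_right_mono)
    qed (simp add: supp)
  qed
qed measurable

text \<open>The function (F y - F x) ln (y - x) is continuous, also at y = x. It has the same value -F x ln R at
y = x + R and at y = x - R, where F vanishes, so the integral of its derivative is 0.\<close>

lemma potential_eq_E:
  assumes "\<bar>x\<bar> < R - 1"
  shows "pi * \<psi> x = E R x"
proof -
  define \<Phi> where "\<Phi> y = (F y - F x) * ln (y - x)" for y
  define g where "g y = f y * ln (y - x) + (F y - F x) / (y - x)" for y
  have R: "R > 1" using assms by linarith
  have "(g has_integral \<Phi> (x + R) - \<Phi> (x - R)) {x - R..x + R}"
  proof (rule fundamental_theorem_of_calculus_interior_strong[where S="{x}"])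
    show "(\<Phi> has_vector_derivative g y) (at y)" if "y \<in> {x - R<..<x + R} - {x}" for y
      unfolding \<Phi>_def g_def has_real_derivative_iff_has_vector_derivative[symmetric]
      using that DERIV_mult[OF DERIV_diff[OF DERIV_F[of y] DERIV_const[of "F x"]]
          DERIV_chain2[OF DERIV_ln_nonzero DERIV_diff[OF DERIV_ident DERIV_const[of x]]]]
      by (simp add: mult.commute)
    have "isCont \<Phi> y" for y
    proof (cases "y = x")
      case False
      then show ?thesis unfolding \<Phi>_def
        using DERIV_isCont[OF DERIV_mult[OF DERIV_diff[OF DERIV_F[of y] DERIV_const[of "F x"]]
          DERIV_chain2[OF DERIV_ln_nonzero DERIV_diff[OF DERIV_ident DERIV_const[of x]]]]] by simp
    next
      case True
      have "((\<lambda>y. \<Phi> y) \<longlongrightarrow> 0) (at x)"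
      proof (rule Lim_null_comparison)
        show "\<forall>\<^sub>F y in at x. norm (\<Phi> y) \<le> 2 * C * (2 * sqrt \<bar>y - x\<bar> + (y - x)\<^sup>2)"
        proof (intro always_eventually allI)
          fix y
          have "\<bar>\<Phi> y\<bar> \<le> (2 * C * \<bar>y - x\<bar>) * \<bar>ln (y - x)\<bar>"
            unfolding \<Phi>_def abs_mult by (intro mult_right_mono F_lipschitz) auto
          also have "\<dots> = 2 * C * \<bar>(y - x) * ln (y - x)\<bar>" by (simp add: abs_mult)
          also have "\<dots> \<le> 2 * C * (2 * sqrt \<bar>y - x\<bar> + (y - x)\<^sup>2)"
            using C_nonneg by (intro mult_left_mono abs_mult_ln_le) auto
          finally show "norm (\<Phi> y) \<le> 2 * C * (2 * sqrt \<bar>y - x\<bar> + (y - x)\<^sup>2)" by simp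
        qed
        show "((\<lambda>y. 2 * C * (2 * sqrt \<bar>y - x\<bar> + (y - x)\<^sup>2)) \<longlongrightarrow> 0) (at x)"
          by (auto intro!: tendsto_eq_intros)
      qed
      moreover have "\<Phi> x = 0" by (simp add: \<Phi>_def)
      ultimately show ?thesis using True by (simp add: isCont_def)
    qed
    then show "continuous_on {x - R..x + R} \<Phi>" by (simp add: continuous_at_imp_continuous_on)
  qed (use R in auto)
  moreover have "\<Phi> (x + R) - \<Phi> (x - R) = 0"
  proof -
    have "F (x + R) = 0" "F (x - R) = 0" using assms by (auto intro!: F_outside)
    then show ?thesis by (simp add: \<Phi>_def ln_minus)
  qed
  ultimately have g0: "(g has_integral 0) {x - R..x + R}" by simp
  have 1: "set_integrable lborel {x - R..x + R} (\<lambda>y. f y * ln (y - x))"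
  proof -
    have "integrable lborel (\<lambda>y. f y * ln (y - x))"
      using integrable_f_ln[of x] by (subst ln_swap)
    then show ?thesis unfolding set_integrable_def by (intro integrable_mult_indicator) auto
  qed
  have ind: "indicator {x - R..x + R} (x + z) = (indicator {-R..R} z :: real)" for z
    by (auto simp: indicator_def)
  have 2: "set_integrable lborel {x - R..x + R} (\<lambda>y. (F y - F x) / (y - x))"
  proof -
    have "integrable lborel (\<lambda>z. indicator {-R..R} (- x + 1 * z) * ((F (x + (- x + 1 * z)) - F x) / (- x + 1 * z)))"
      using R by (intro lborel_integrable_real_affine E_integrable) auto
    also have "(\<lambda>z. indicator {-R..R} (- x + 1 * z) * ((F (x + (- x + 1 * z)) - F x) / (- x + 1 * z)))
       = (\<lambda>y. indicator {x - R..x + R} y *\<^sub>R ((F y - F x) / (y - x)))"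
    proof (rule ext)
      fix z
      have "x + (- x + 1 * z) = z" "- x + 1 * z = z - x" by simp_all
      moreover have "indicator {-R..R} (z - x) = (indicator {x - R..x + R} z :: real)"
        by (auto simp: indicator_def)
      ultimately show "indicator {-R..R} (- x + 1 * z) * ((F (x + (- x + 1 * z)) - F x) / (- x + 1 * z))
         = indicator {x - R..x + R} z *\<^sub>R ((F z - F x) / (z - x))"
        by (simp only: real_scaleR_def)
    qed
    finally show ?thesis unfolding set_integrable_def .
  qed
  have gi: "set_integrable lborel {x - R..x + R} g"
    unfolding g_def by (rule set_integral_add(1)[OF 1 2])
  have "0 = (LINT y:{x - R..x + R}|lborel. g y)"
    unfolding set_borel_integral_eq_integral(2)[OF gi] by (rule integral_unique[OF g0, symmetric])
  also have "\<dots> = (LINT y:{x - R..x + R}|lborel. f y * ln (y - x)) + (LINT y:{x - R..x + R}|lborel. (F y - F x) / (y - x))"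
    unfolding g_def by (rule set_integral_add(2)[OF 1 2])
  also have "(LINT y:{x - R..x + R}|lborel. (F y - F x) / (y - x)) = E R x"
  proof -
    let ?h = "\<lambda>y. indicator {x - R..x + R} y *\<^sub>R ((F y - F x) / (y - x))"
    have "(LINT y|lborel. ?h y) = (LINT z|lborel. ?h (x + z))"
      using lborel_integral_real_affine[of 1 ?h x] by simp
    also have "\<dots> = E R x" unfolding E_def ind by simp
    finally show ?thesis unfolding set_lebesgue_integral_def .
  qed
  also have "(LINT y:{x - R..x + R}|lborel. f y * ln (y - x)) = (LINT y|lborel. f y * ln \<bar>x - y\<bar>)"
    unfolding set_lebesgue_integral_def
  proof (intro Bochner_Integration.integral_cong refl)
    fix y
    show "indicator {x - R..x + R} y *\<^sub>R (f y * ln (y - x)) = f y * ln \<bar>x - y\<bar>"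
    proof (cases "\<bar>y\<bar> \<le> 1")
      case True
      then have "y \<in> {x - R..x + R}" using assms by auto
      then show ?thesis by (simp add: ln_abs_diff)
    qed (simp add: supp)
  qed
  finally have "E R x = - (LINT y|lborel. f y * ln \<bar>x - y\<bar>)" by linarith
  then show ?thesis unfolding inv_half_laplacian_def by simp
qed

lemma DERIV_potential:
  assumes "\<bar>x\<bar> < R - 1"
  shows "(\<psi> has_real_derivative D R x / pi) (at x)"
proof -
  have "((\<lambda>y. E R y / pi) has_real_derivative D R x / pi) (at x)"
    using assms by (intro DERIV_cdivide DERIV_E) auto
  moreover have "\<forall>\<^sub>F y in nhds x. E R y / pi = \<psi> y"
  proof -
    have "open {- (R - 1)<..<R - 1}" "x \<in> {- (R - 1)<..<R - 1}" using assms by auto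
    from eventually_nhds_in_open[OF this] show ?thesis
    proof eventually_elim
      case (elim y)
      then have "\<bar>y\<bar> < R - 1" by auto
      from potential_eq_E[OF this] show ?case by (simp add: field_simps)
    qed
  qed
  ultimately show ?thesis by (rule DERIV_cong_ev[OF refl _ refl, THEN iffD1, rotated])
qed

text \<open>Subtracting f x from f (x + z) does not change the truncated integral, because the truncation is
symmetric in z and 1/z is odd; afterwards the limit exists by dominated convergence.\<close>

lemma hilbert_eq:
  assumes "\<bar>x\<bar> < R - 1"
  shows "hilbert f x = - D R x / pi"
proof -
  have R: "R > 1" using assms by linarith
  have trunc: "(LINT y:{y. \<bar>x - y\<bar> > \<epsilon>}|lborel. f y / (x - y)) =
     - (LINT z|lborel. indicator {-R..R} z * indicator {z. \<bar>z\<bar> > \<epsilon>} z * ((f (x + z) - f x) / z))"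
    if "\<epsilon> > 0" for \<epsilon>
  proof -
    let ?I = "\<lambda>z. indicator {-R..R} z * indicator {z. \<bar>z\<bar> > \<epsilon>} z :: real"
    have int: "integrable lborel (\<lambda>z. ?I z * (h z / z))" if [measurable]: "h \<in> borel_measurable borel" and b: "\<And>z. \<bar>h z\<bar> \<le> B" for h B
    proof (rule Bochner_Integration.integrable_bound[where f="\<lambda>z. B / \<epsilon> * indicator {-R..R} z"])
      show "integrable lborel (\<lambda>z. B / \<epsilon> * indicator {-R..R} z)" using R by (intro integrable_mult_right integrable_real_indicator) auto
      have B0: "0 \<le> B" using b[of 0] by simp
      have "\<bar>h z / z\<bar> \<le> B / \<epsilon>" if "\<bar>z\<bar> > \<epsilon>" for z
        unfolding abs_divide using b[of z] that \<open>\<epsilon> > 0\<close> B0 by (intro frac_le) auto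
      then show "AE z in lborel. norm (?I z * (h z / z)) \<le> norm (B / \<epsilon> * indicator {-R..R} z)"
        using B0 \<open>\<epsilon> > 0\<close> by (intro AE_I2) (auto simp: indicator_def)
    qed measurable
    have "(LINT y:{y. \<bar>x - y\<bar> > \<epsilon>}|lborel. f y / (x - y)) = (LINT z|lborel. - (?I z * (f (x + z) / z)))"
      unfolding set_lebesgue_integral_def
    proof -
      let ?h = "\<lambda>y. indicator {y. \<bar>x - y\<bar> > \<epsilon>} y *\<^sub>R (f y / (x - y))"
      have "(LINT y|lborel. ?h y) = (LINT z|lborel. ?h (x + z))"
        using lborel_integral_real_affine[of 1 ?h x] by simp
      also have "\<dots> = (LINT z|lborel. - (?I z * (f (x + z) / z)))"
      proof (rule Bochner_Integration.integral_cong[OF refl])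
        fix z
        show "?h (x + z) = - (?I z * (f (x + z) / z))"
        proof (cases "\<bar>x + z\<bar> \<le> 1")
          case True
          then have "z \<in> {-R..R}" using assms by auto
          then show ?thesis by (simp add: indicator_def)
        qed (simp add: supp)
      qed
      finally show "(LINT y|lborel. ?h y) = (LINT z|lborel. - (?I z * (f (x + z) / z)))" .
    qed
    also have "\<dots> = - (LINT z|lborel. ?I z * (f (x + z) / z))" by simp
    also have "(LINT z|lborel. ?I z * (f (x + z) / z)) = (LINT z|lborel. ?I z * ((f (x + z) - f x) / z))"
    proof -
      have "(LINT z|lborel. ?I z * (f x / z)) = (LINT z|lborel. ?I (0 + -1 * z) * (f x / (0 + -1 * z)))"
        using lborel_integral_real_affine[of "-1" "\<lambda>z. ?I z * (f x / z)" 0] by simp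
      also have "\<dots> = - (LINT z|lborel. ?I z * (f x / z))"
        by (subst integral_minus[symmetric], intro Bochner_Integration.integral_cong refl) (auto simp: indicator_def)
      finally have "(LINT z|lborel. ?I z * (f x / z)) = 0" by simp
      moreover have "(LINT z|lborel. ?I z * ((f (x + z) - f x) / z)) =
        (LINT z|lborel. ?I z * (f (x + z) / z)) - (LINT z|lborel. ?I z * (f x / z))"
        unfolding diff_divide_distrib right_diff_distrib
        by (intro Bochner_Integration.integral_diff int[of _ "2 * C"] f_bound) measurable
      ultimately show ?thesis by simp
    qed
    finally show ?thesis .
  qed
  have "((\<lambda>\<epsilon>. LINT y:{y. \<bar>x - y\<bar> > \<epsilon>}|lborel. f y / (x - y)) \<longlongrightarrow> - D R x) (at_right 0)"
    unfolding tendsto_at_iff_sequentially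
  proof (intro allI impI)
    fix X :: "nat \<Rightarrow> real" assume X: "\<forall>i. X i \<in> {0<..} - {0}" "X \<longlonglongrightarrow> 0"
    let ?t = "\<lambda>i z. indicator {-R..R} z * indicator {z. \<bar>z\<bar> > X i} z * ((f (x + z) - f x) / z)"
    have "(\<lambda>i. LINT z|lborel. ?t i z) \<longlonglongrightarrow> D R x"
      unfolding D_def
    proof (rule integral_dominated_convergence[where w="majorant R"])
      show "integrable lborel (majorant R)"
        using R by (intro integrable_majorant) auto
      show "AE z in lborel. norm (?t i z) \<le> majorant R z" for i
        using quotient_bound[of x] C_nonneg by (intro AE_I2) (auto simp: indicator_def abs_mult)
      show "AE z in lborel. (\<lambda>i. ?t i z) \<longlonglongrightarrow> indicator {-R..R} z * ((f (x + z) - f x) / z)"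
      proof (intro AE_I2)
        fix z :: real
        show "(\<lambda>i. ?t i z) \<longlonglongrightarrow> indicator {-R..R} z * ((f (x + z) - f x) / z)"
        proof (cases "z = 0")
          case False
          then have "\<forall>\<^sub>F i in sequentially. X i < \<bar>z\<bar>"
            using X(2) by (intro order_tendstoD(2)) auto
          then have "\<forall>\<^sub>F i in sequentially. ?t i z = indicator {-R..R} z * ((f (x + z) - f x) / z)"
            by eventually_elim simp
          then show ?thesis by (rule tendsto_eventually)
        qed simp
      qed
    qed measurable
    then show "((\<lambda>\<epsilon>. LINT y:{y. \<bar>x - y\<bar> > \<epsilon>}|lborel. f y / (x - y)) \<circ> X) \<longlonglongrightarrow> - D R x"
      using X(1) by (auto simp: comp_def trunc intro!: tendsto_minus)
  qed
  then have "Lim (at_right 0) (\<lambda>\<epsilon>. LINT y:{y. \<bar>x - y\<bar> > \<epsilon>}|lborel. f y / (x - y)) = - D R x"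
    by (intro tendsto_Lim) (auto simp: trivial_limit_at_right_real)
  then show ?thesis by (simp add: hilbert_def)
qed

lemma DERIV_potential_hilbert: "(\<psi> has_real_derivative - hilbert f x) (at x)"
  using DERIV_potential[of x "\<bar>x\<bar> + 2"] hilbert_eq[of x "\<bar>x\<bar> + 2"] by simp

lemma isCont_hilbert: "isCont (hilbert f) x"
proof -
  let ?R = "\<bar>x\<bar> + 2"
  have "isCont (D ?R) x" 
    using continuous_D[of ?R UNIV] by (auto simp: continuous_on_eq_continuous_at)
  then have "isCont (\<lambda>x. - D ?R x / pi) x" by (intro continuous_intros) auto
  moreover have "\<forall>\<^sub>F y in nhds x. - D ?R y / pi = hilbert f y"
  proof -
    have "open {x - 1<..<x + 1}" "x \<in> {x - 1<..<x + 1}" by auto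
    from eventually_nhds_in_open[OF this] show ?thesis
      by eventually_elim (subst hilbert_eq[of _ ?R], auto)
  qed
  ultimately show ?thesis by (rule isCont_cong[THEN iffD1, rotated])
qed

lemma potential_odd: "\<psi> (- x) = - \<psi> x"
proof -
  have "(LINT y|lborel. f y * ln \<bar>- x - y\<bar>) = (LINT y|lborel. f (- y) * ln \<bar>- x - (- y)\<bar>)"
    using lborel_integral_real_affine[of "-1" "\<lambda>y. f y * ln \<bar>- x - y\<bar>" 0] by simp
  also have "\<dots> = (LINT y|lborel. - (f y * ln \<bar>x - y\<bar>))"
    by (intro Bochner_Integration.integral_cong refl) (simp add: odd abs_minus_commute)
  finally show ?thesis by (simp add: inv_half_laplacian_def)
qed

end

section \<open>Monotonicity by moving planes\<close>

text \<open>Folding the line onto the half-line turns the kernel -ln |x - y| into this one for odd functions.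
On the diagonal its value is ln 0 = 0.\<close>

definition log_kernel :: "real \<Rightarrow> real \<Rightarrow> real" where "log_kernel x y = ln ((x + y) / (x - y))"

lemma log_kernel_measurable [measurable]: "log_kernel x \<in> borel_measurable borel"
  unfolding log_kernel_def by measurable

lemma log_kernel_nonneg:
  assumes "0 < x" "0 < y"
  shows "0 \<le> log_kernel x y"
proof (cases "x = y")
  case False
  have "1 \<le> \<bar>(x + y) / (x - y)\<bar>" using assms False by (auto simp: abs_divide divide_simps)
  then have "0 \<le> ln \<bar>(x + y) / (x - y)\<bar>" by (rule ln_ge_zero)
  then show ?thesis unfolding ln_abs log_kernel_def .
qed (simp add: log_kernel_def)

context odd_profile
begin

lemma potential_half_line:
  assumes "0 < x"
  shows "integrable lborel (\<lambda>y. indicator {0<..<1} y * (f y * log_kernel x y))"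
    and "(LINT y|lborel. indicator {0<..<1} y * (f y * log_kernel x y)) = pi * \<psi> x"
proof -
  let ?I = "indicator {0<..} :: real \<Rightarrow> real"
  have i1: "integrable lborel (\<lambda>y. ?I y * (f y * ln (x - y)))"
    using integrable_mult_indicator[OF _ integrable_f_ln[of x], of "{0<..}"] by simp
  have i2: "integrable lborel (\<lambda>y. ?I y * (f y * ln (x + y)))"
    using integrable_mult_indicator[OF _ integrable_f_ln[of "- x"], of "{0<..}"] ln_minus[of "x + _"]
    by (simp add: ln_minus[symmetric, of "- x - _"])
  have i3: "integrable lborel (\<lambda>y. indicator {..<0} y * (f y * ln (x - y)))"
    using integrable_mult_indicator[OF _ integrable_f_ln[of x], of "{..<0}"] by simp
  have "(LINT y|lborel. f y * ln (x - y)) = (LINT y|lborel. ?I y * (f y * ln (x - y)) + indicator {..<0} y * (f y * ln (x - y)))"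
    by (intro Bochner_Integration.integral_cong refl) (auto simp: indicator_def)
  also have "\<dots> = (LINT y|lborel. ?I y * (f y * ln (x - y))) + (LINT y|lborel. indicator {..<0} y * (f y * ln (x - y)))"
    using i1 i3 by (rule Bochner_Integration.integral_add)
  also have "(LINT y|lborel. indicator {..<0} y * (f y * ln (x - y))) =
    (LINT y|lborel. indicator {..<0} (- y) * (f (- y) * ln (x - (- y))))"
    using lborel_integral_real_affine[of "-1" "\<lambda>y. indicator {..<0} y * (f y * ln (x - y))" 0] by simp
  also have "\<dots> = (LINT y|lborel. - (?I y * (f y * ln (x + y))))"
    by (intro Bochner_Integration.integral_cong refl) (auto simp: indicator_def odd)
  finally have split: "(LINT y|lborel. f y * ln (x - y)) =
      (LINT y|lborel. ?I y * (f y * ln (x - y))) - (LINT y|lborel. ?I y * (f y * ln (x + y)))"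
    by simp
  have ae: "AE y in lborel. ?I y * (f y * ln (x + y)) - ?I y * (f y * ln (x - y)) = indicator {0<..<1} y * (f y * log_kernel x y)"
    using AE_lborel_singleton[of x]
  proof eventually_elim
    case (elim y)
    then have "0 < y \<Longrightarrow> f y * ln (x + y) - f y * ln (x - y) = f y * log_kernel x y"
      using assms by (simp add: log_kernel_def ln_div right_diff_distrib)
    then show ?case using supp[of y] by (auto simp: indicator_def)
  qed
  have i4: "integrable lborel (\<lambda>y. ?I y * (f y * ln (x + y)) - ?I y * (f y * ln (x - y)))"
    using i2 i1 by (rule Bochner_Integration.integrable_diff)
  show "integrable lborel (\<lambda>y. indicator {0<..<1} y * (f y * log_kernel x y))"
    using i4 by (rule integrable_cong_AE_imp) (use ae in \<open>auto\<close>)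
  have "(LINT y|lborel. indicator {0<..<1} y * (f y * log_kernel x y)) =
      (LINT y|lborel. ?I y * (f y * ln (x + y)) - ?I y * (f y * ln (x - y)))"
    by (rule integral_cong_AE) (use ae in \<open>auto\<close>)
  also have "\<dots> = (LINT y|lborel. ?I y * (f y * ln (x + y))) - (LINT y|lborel. ?I y * (f y * ln (x - y)))"
    using i2 i1 by (rule Bochner_Integration.integral_diff)
  also have "\<dots> = - (LINT y|lborel. f y * ln (x - y))" by (simp add: split)
  finally show "(LINT y|lborel. indicator {0<..<1} y * (f y * log_kernel x y)) = pi * \<psi> x"
    by (simp add: inv_half_laplacian_def ln_abs)
qed

end

text \<open>The integral of 1 / |y - r e|^2, e a unit vector, over the heights z of the points y of the sphere
|y|^2 = m: with z measured along e the squared distance is m + r^2 - 2 r z.\<close>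

lemma nn_integral_inverse_chord:
  assumes "0 < r" "0 < m" "sqrt m \<noteq> r"
  shows "(\<integral>\<^sup>+z. ennreal (indicator {z. z\<^sup>2 < m} z * (1 / (m + r\<^sup>2 - 2 * r * z))) \<partial>lborel)
    = ennreal (log_kernel r (sqrt m) / r)"
proof -
  define q where "q = sqrt m"
  have q: "0 < q" "q \<noteq> r" "q\<^sup>2 = m" using assms by (auto simp: q_def)
  have pos: "0 < m + r\<^sup>2 - 2 * r * z" if "\<bar>z\<bar> \<le> q" for z
  proof -
    have "0 < (q - r)\<^sup>2" using q by simp
    also have "\<dots> = m + r\<^sup>2 - 2 * r * q" using q by (simp add: power2_eq_square algebra_simps)
    also have "\<dots> \<le> m + r\<^sup>2 - 2 * r * z" using that assms by (simp add: mult_left_mono)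
    finally show ?thesis .
  qed
  have "(\<integral>\<^sup>+z. ennreal (indicator {z. z\<^sup>2 < m} z * (1 / (m + r\<^sup>2 - 2 * r * z))) \<partial>lborel)
    = (\<integral>\<^sup>+z. ennreal (1 / (m + r\<^sup>2 - 2 * r * z)) * indicator {-q..q} z \<partial>lborel)"
  proof (rule nn_integral_cong_AE)
    show "AE z in lborel. ennreal (indicator {z. z\<^sup>2 < m} z * (1 / (m + r\<^sup>2 - 2 * r * z)))
      = ennreal (1 / (m + r\<^sup>2 - 2 * r * z)) * indicator {-q..q} z"
      using AE_lborel_singleton[of q] AE_lborel_singleton[of "-q"]
    proof eventually_elim
      case (elim z)
      have "z\<^sup>2 < m \<longleftrightarrow> \<bar>z\<bar> < q"
        using q by (metis abs_square_less_1 abs_of_pos power2_abs power_less_imp_less_base power_strict_mono abs_ge_zero less_imp_le zero_less_numeral)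
      also have "\<dots> \<longleftrightarrow> z \<in> {-q..q}" using elim q by auto
      finally show ?case by (simp add: indicator_def)
    qed
  qed
  also have "\<dots> = ennreal (- (ln (m + r\<^sup>2 - 2 * r * q) / (2 * r)) - - (ln (m + r\<^sup>2 - 2 * r * (- q)) / (2 * r)))"
  proof (rule nn_integral_FTC_Icc)
    fix z assume z: "z \<in> {-q..q}"
    then have "0 < m + r\<^sup>2 - 2 * r * z" by (intro pos) auto
    then show "((\<lambda>z. - (ln (m + r\<^sup>2 - 2 * r * z) / (2 * r))) has_real_derivative 1 / (m + r\<^sup>2 - 2 * r * z)) (at z)"
    proof -
      have "((\<lambda>z. ln (m + r\<^sup>2 - 2 * r * z)) has_real_derivative 1 / (m + r\<^sup>2 - 2 * r * z) * (- (2 * r))) (at z)"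
        by (rule DERIV_chain2[OF DERIV_ln_divide]) (use \<open>0 < m + r\<^sup>2 - 2 * r * z\<close> in \<open>auto intro!: derivative_eq_intros\<close>)
      from DERIV_minus[OF DERIV_cdivide[OF this, of "2 * r"]] show ?thesis
        using assms by (simp add: has_field_derivative_at_within)
    qed
    show "0 \<le> 1 / (m + r\<^sup>2 - 2 * r * z)" using \<open>0 < m + r\<^sup>2 - 2 * r * z\<close> by simp
  qed (use q in auto)
  also have "- (ln (m + r\<^sup>2 - 2 * r * q) / (2 * r)) - - (ln (m + r\<^sup>2 - 2 * r * (- q)) / (2 * r)) = log_kernel r q / r"
  proof -
    have "m + r\<^sup>2 - 2 * r * q = (r - q)\<^sup>2" "m + r\<^sup>2 - 2 * r * (- q) = (r + q)\<^sup>2"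
      using q by (auto simp: power2_eq_square algebra_simps)
    moreover have "ln ((r - q)\<^sup>2) = 2 * ln (r - q)" "ln ((r + q)\<^sup>2) = 2 * ln (r + q)"
      using q assms by (auto simp: power2_eq_square ln_mult)
    moreover have "log_kernel r q = ln (r + q) - ln (r - q)"
      using q assms by (auto simp: log_kernel_def ln_div)
    ultimately show ?thesis using assms by (simp add: field_simps)
  qed
  finally show ?thesis by (simp add: q_def)
qed

locale positive_profile = odd_profile +
  assumes pos: "\<And>x. 0 < x \<Longrightarrow> x < 1 \<Longrightarrow> 0 < f x"
begin

text \<open>The odd function f is regarded as the radial function f |y| / |y| on three-dimensional space. Then
the potential of f divided by the radius is the potential with kernel 1 / (2 pi^2 |x - y|^2) of this radial
function. P expresses the radial function through m = |y|^2, and G r is the integrand of that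
potential at the point of height r on the z-axis, up to a constant, in the coordinates z and n = squared
distance from the axis; the volume element is pi dn dz.\<close>

definition P :: "real \<Rightarrow> real" where
  "P m = (if 0 < m \<and> m < 1 then f (sqrt m) / sqrt m else 0)"

definition G :: "real \<Rightarrow> real \<Rightarrow> real \<Rightarrow> real" where
  "G r n z = indicator {0<..} n * (P (n + z\<^sup>2) / (n + (z - r)\<^sup>2))"

lemma P_measurable [measurable]: "P \<in> borel_measurable borel"
  unfolding P_def by measurable

lemma P_nonneg: "0 \<le> P m"
proof (cases "0 < m \<and> m < 1")
  case True
  then have "0 < f (sqrt m)" by (intro pos) auto
  then show ?thesis using True by (simp add: P_def)
qed (auto simp: P_def)

lemma G_nonneg: "0 \<le> G r n z"
  using P_nonneg by (auto simp: G_def indicator_def)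

lemma G_measurable [measurable]: "(\<lambda>(n, z). G r n z) \<in> borel_measurable (borel \<Otimes>\<^sub>M borel)"
  unfolding G_def split_beta' by measurable

lemma G_measurable1 [measurable]: "G r n \<in> borel_measurable borel" "(\<lambda>n. G r n z) \<in> borel_measurable borel"
  unfolding G_def by measurable

text \<open>For fixed z, passing from n to m = n + z^2 gives the spheres |y|^2 = m; integrating over the
height z first yields the logarithmic kernel.\<close>

lemma nn_integral_G:
  assumes r: "0 < r"
  shows "(\<integral>\<^sup>+n. \<integral>\<^sup>+z. ennreal (G r n z) \<partial>lborel \<partial>lborel) = ennreal (2 * pi * (\<psi> r / r))"
proof -
  let ?c = "\<lambda>m. \<integral>\<^sup>+z. ennreal (indicator {z. z\<^sup>2 < m} z * (1 / (m + r\<^sup>2 - 2 * r * z))) \<partial>lborel"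
  let ?H = "\<lambda>z m. if z\<^sup>2 < m then P m / (m + r\<^sup>2 - 2 * r * z) else 0"
  have "(\<integral>\<^sup>+n. \<integral>\<^sup>+z. ennreal (G r n z) \<partial>lborel \<partial>lborel) = (\<integral>\<^sup>+z. \<integral>\<^sup>+n. ennreal (G r n z) \<partial>lborel \<partial>lborel)"
    by (rule lborel_pair.Fubini') measurable
  also have "\<dots> = (\<integral>\<^sup>+z. \<integral>\<^sup>+m. ennreal (?H z m) \<partial>lborel \<partial>lborel)"
  proof (rule nn_integral_cong)
    fix z
    have "(\<integral>\<^sup>+n. ennreal (G r n z) \<partial>lborel) = (\<integral>\<^sup>+m. ennreal (G r (- z\<^sup>2 + m) z) \<partial>lborel)"
      using nn_integral_real_affine[of "\<lambda>n. ennreal (G r n z)" 1 "- z\<^sup>2"] by simp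
    moreover have "G r (- z\<^sup>2 + m) z = ?H z m" for m
      by (simp add: G_def indicator_def power2_eq_square algebra_simps)
    ultimately show "(\<integral>\<^sup>+n. ennreal (G r n z) \<partial>lborel) = (\<integral>\<^sup>+m. ennreal (?H z m) \<partial>lborel)"
      by simp
  qed
  also have "\<dots> = (\<integral>\<^sup>+m. \<integral>\<^sup>+z. ennreal (?H z m) \<partial>lborel \<partial>lborel)"
    by (rule lborel_pair.Fubini') measurable
  also have "\<dots> = (\<integral>\<^sup>+m. ennreal (P m * (log_kernel r (sqrt m) / r) * indicator {0\<^sup>2..1\<^sup>2} m) \<partial>lborel)"
  proof (rule nn_integral_cong_AE)
    show "AE m in lborel. (\<integral>\<^sup>+z. ennreal (?H z m) \<partial>lborel) = ennreal (P m * (log_kernel r (sqrt m) / r) * indicator {0\<^sup>2..1\<^sup>2} m)"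
      using AE_lborel_singleton[of "r\<^sup>2"]
    proof eventually_elim
      case (elim m)
      show ?case
      proof (cases "0 < m \<and> m < 1")
        case True
        have eq: "ennreal (?H z m) = ennreal (P m) * ennreal (indicator {z. z\<^sup>2 < m} z * (1 / (m + r\<^sup>2 - 2 * r * z)))" for z
          using P_nonneg[of m] by (subst ennreal_mult'[symmetric]) (auto simp: indicator_def)
        have "sqrt m \<noteq> r" using elim True by auto
        then have "(\<integral>\<^sup>+z. ennreal (?H z m) \<partial>lborel) = ennreal (P m) * ennreal (log_kernel r (sqrt m) / r)"
        proof -
          have "(\<integral>\<^sup>+z. ennreal (?H z m) \<partial>lborel) = ennreal (P m) *
            ?c m"
            unfolding eq by (rule nn_integral_cmult) measurable
          also have "?c m
            = ennreal (log_kernel r (sqrt m) / r)"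
            using True r \<open>sqrt m \<noteq> r\<close> by (intro nn_integral_inverse_chord) auto
          finally show ?thesis .
        qed
        also have "\<dots> = ennreal (P m * (log_kernel r (sqrt m) / r))"
          using P_nonneg by (subst ennreal_mult') auto
        finally show ?thesis using True by simp
      next
        case False
        then have "P m = 0" by (auto simp: P_def)
        then show ?thesis by (simp cong: if_cong)
      qed
    qed
  qed
  also have "\<dots> = (\<integral>\<^sup>+R. ennreal (P (R\<^sup>2) * (log_kernel r (sqrt (R\<^sup>2)) / r) * (2 * R) * indicator {0..1} R) \<partial>lborel)"
    by (rule nn_integral_substitution)
       (auto intro!: derivative_eq_intros continuous_intros simp: set_borel_measurable_def)
  also have "\<dots> = (\<integral>\<^sup>+R. ennreal (2 / r) * ennreal (indicator {0<..<1} R * (f R * log_kernel r R)) \<partial>lborel)"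
  proof (rule nn_integral_cong)
    fix R :: real
    show "ennreal (P (R\<^sup>2) * (log_kernel r (sqrt (R\<^sup>2)) / r) * (2 * R) * indicator {0..1} R) =
      ennreal (2 / r) * ennreal (indicator {0<..<1} R * (f R * log_kernel r R))"
    proof (cases "R \<in> {0<..<1}")
      case True
      then have "R\<^sup>2 < 1" by (simp add: power_less_one_iff)
      with True have "P (R\<^sup>2) = f R / R" by (simp add: P_def)
      then show ?thesis using True r pos[of R] log_kernel_nonneg[of r R] by (simp add: ennreal_mult'[symmetric])
    next
      case False
      then have "R \<in> {0..1} \<Longrightarrow> R = 0 \<or> R = 1" by auto
      then show ?thesis using False by (auto simp: indicator_def P_def)
    qed
  qed
  also have "\<dots> = ennreal (2 / r) * (\<integral>\<^sup>+R. ennreal (indicator {0<..<1} R * (f R * log_kernel r R)) \<partial>lborel)"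
    by (rule nn_integral_cmult) measurable
  also have "(\<integral>\<^sup>+R. ennreal (indicator {0<..<1} R * (f R * log_kernel r R)) \<partial>lborel) = ennreal (pi * \<psi> r)"
    unfolding potential_half_line(2)[OF r, symmetric]
  proof (rule nn_integral_eq_integral)
    show "AE R in lborel. 0 \<le> indicator {0<..<1} R * (f R * log_kernel r R)"
    proof (rule AE_I2)
      fix R :: real
      show "0 \<le> indicator {0<..<1} R * (f R * log_kernel r R)"
        using pos[of R] log_kernel_nonneg[OF r, of R] by (auto simp: indicator_def)
    qed
  qed (rule potential_half_line(1)[OF r])
  also have "ennreal (2 / r) * ennreal (pi * \<psi> r) = ennreal (2 / r * (pi * \<psi> r))"
    using r by (subst ennreal_mult') auto
  finally show ?thesis by (simp add: field_simps)
qed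

lemma potential_pos:
  assumes "0 < r"
  shows "0 \<le> \<psi> r"
proof -
  have "0 \<le> (LINT y|lborel. indicator {0<..<1} y * (f y * log_kernel r y))"
  proof (rule Bochner_Integration.integral_nonneg)
    fix R :: real
    show "0 \<le> indicator {0<..<1} R * (f R * log_kernel r R)"
      using pos[of R] log_kernel_nonneg[OF assms, of R] by (auto simp: indicator_def)
  qed
  then show ?thesis using pi_gt_zero by (simp add: potential_half_line(2)[OF assms] zero_le_mult_iff)
qed

text \<open>The reflection in the plane of height \<rho> maps the point of height r on the axis to the one of
height 2 \<rho> - r. The condition says that, for every plane of height at least \<rho>, the radial
function at a point beyond the plane is at most its value at the mirror image; for r > 1 this is
automatic, the radial function being 0 there.\<close>

definition decreasing_beyond :: "real \<Rightarrow> bool" where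
  "decreasing_beyond \<tau> \<longleftrightarrow> (\<forall>s r. 0 < s \<longrightarrow> s < r \<longrightarrow> r \<le> 1 \<longrightarrow> 2 * \<tau> \<le> r + s \<longrightarrow> f r / r \<le> f s / s)"

text \<open>A point beyond the plane and its mirror image have radii R and S with S < R and
R + S \<ge> |z| + |2 \<tau> - z| \<ge> 2 \<tau>.\<close>

lemma P_reflect:
  assumes "decreasing_beyond \<rho>" "\<rho> \<le> \<tau>" "0 < \<tau>" "\<tau> < z" "0 < n"
  shows "P (n + z\<^sup>2) \<le> P (n + (2 * \<tau> - z)\<^sup>2)"
proof (cases "n + z\<^sup>2 < 1")
  case False
  then show ?thesis using P_nonneg by (simp add: P_def)
next
  case True
  define R where "R = sqrt (n + z\<^sup>2)"
  define S where "S = sqrt (n + (2 * \<tau> - z)\<^sup>2)"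
  have "0 < 4 * \<tau> * (z - \<tau>)" using assms by simp
  then have lt: "n + (2 * \<tau> - z)\<^sup>2 < n + z\<^sup>2" by (simp add: power2_eq_square algebra_simps)
  have 0: "0 < n + (2 * \<tau> - z)\<^sup>2" using assms by (simp add: add_pos_nonneg)
  have "S < R" "0 < S" "R \<le> 1" using lt 0 True by (auto simp: R_def S_def)
  moreover have "2 * \<tau> \<le> R + S"
  proof -
    have "\<bar>z\<bar> \<le> R" "\<bar>2 * \<tau> - z\<bar> \<le> S" unfolding R_def S_def
      using assms by (auto intro!: real_le_rsqrt)
    then show ?thesis by linarith
  qed
  ultimately have "f R / R \<le> f S / S"
    using assms(1,2) unfolding decreasing_beyond_def by auto
  then show ?thesis using True lt 0 assms by (simp add: P_def R_def S_def)
qed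

lemma nn_integral_reflect:
  fixes h :: "real \<Rightarrow> real"
  assumes [measurable]: "h \<in> borel_measurable borel" and h: "\<And>z. 0 \<le> h z"
  shows "(\<integral>\<^sup>+z. ennreal (h z) \<partial>lborel) = (\<integral>\<^sup>+z. ennreal (indicator {\<tau><..} z * (h z + h (2 * \<tau> - z))) \<partial>lborel)"
proof -
  let ?r = "\<integral>\<^sup>+z. ennreal (indicator {\<tau><..} z * h z) \<partial>lborel"
  let ?l = "\<integral>\<^sup>+z. ennreal (indicator {..<\<tau>} z * h z) \<partial>lborel"
  have "(\<integral>\<^sup>+z. ennreal (h z) \<partial>lborel) =
    (\<integral>\<^sup>+z. ennreal (indicator {\<tau><..} z * h z) + ennreal (indicator {..<\<tau>} z * h z) \<partial>lborel)"
  proof (rule nn_integral_cong_AE)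
    show "AE z in lborel. ennreal (h z) = ennreal (indicator {\<tau><..} z * h z) + ennreal (indicator {..<\<tau>} z * h z)"
      using AE_lborel_singleton[of \<tau>] by eventually_elim (auto simp: indicator_def)
  qed
  also have "\<dots> = ?r + ?l"
    by (rule nn_integral_add) measurable
  also have "?l =
     (\<integral>\<^sup>+z. ennreal (indicator {..<\<tau>} (2 * \<tau> + -1 * z) * h (2 * \<tau> + -1 * z)) \<partial>lborel)"
    using nn_integral_real_affine[of "\<lambda>z. ennreal (indicator {..<\<tau>} z * h z)" "-1" "2 * \<tau>"] by simp
  also have "\<dots> = (\<integral>\<^sup>+z. ennreal (indicator {\<tau><..} z * h (2 * \<tau> - z)) \<partial>lborel)"
    by (intro nn_integral_cong arg_cong[where f=ennreal]) (auto simp: indicator_def)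
  also have "?r + \<dots> =
    (\<integral>\<^sup>+z. ennreal (indicator {\<tau><..} z * h z) + ennreal (indicator {\<tau><..} z * h (2 * \<tau> - z)) \<partial>lborel)"
    by (rule nn_integral_add[symmetric]) measurable
  also have "\<dots> = (\<integral>\<^sup>+z. ennreal (indicator {\<tau><..} z * (h z + h (2 * \<tau> - z))) \<partial>lborel)"
    using h by (intro nn_integral_cong) (auto simp: indicator_def ennreal_plus)
  finally show ?thesis .
qed

text \<open>The central estimate. Fold the integral of G over the plane of height \<tau> = (r + s) / 2, in which r
and s are mirror images. Beyond the plane the values a at a point and b at its image satisfy a \<le> b,
while r is nearer to the point than s; so a/u + b/v \<le> a/v + b/u for the squared distances u \<le> v
from r and s, which gives the comparison without \<kappa>. The gain \<kappa> comes from a fixed box of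
points outside the unit ball, where a = 0, whose images stay in a compact part of the ball for all
admissible \<tau>, so that b is bounded below.\<close>

lemma potential_gap:
  assumes dec: "decreasing_beyond \<rho>" and l0: "0 < \<rho>" "\<rho> \<le> 1"
  obtains \<kappa> where "0 < \<kappa>"
    and "\<And>s r. 0 < s \<Longrightarrow> s < r \<Longrightarrow> 2 * \<rho> \<le> r + s \<Longrightarrow> r + s \<le> 2 \<Longrightarrow>
      \<psi> r / r + \<kappa> * (r - s) \<le> \<psi> s / s"
proof -
  obtain \<eta> where \<eta>: "0 < \<eta>" "\<And>m. \<rho> / 8 \<le> m \<Longrightarrow> m \<le> 1 - \<rho> / 4 \<Longrightarrow> \<eta> \<le> P m"
  proof -
    let ?K = "{\<rho> / 8..1 - \<rho> / 4}"
    have c: "continuous_on ?K (\<lambda>m. f (sqrt m) / sqrt m)"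
      using l0 by (intro continuous_intros continuous_on_compose2[OF cont]) auto
    have ne: "?K \<noteq> {}" using l0 by simp
    obtain m0 where m0: "m0 \<in> ?K" "\<And>m. m \<in> ?K \<Longrightarrow> f (sqrt m0) / sqrt m0 \<le> f (sqrt m) / sqrt m"
      using continuous_attains_inf[OF compact_Icc ne c] by blast
    show ?thesis
    proof (rule that)
      have "0 < f (sqrt m0)" using m0(1) l0 by (intro pos) auto
      then show "0 < f (sqrt m0) / sqrt m0" using m0(1) l0 by simp
      show "f (sqrt m0) / sqrt m0 \<le> P m" if "\<rho> / 8 \<le> m" "m \<le> 1 - \<rho> / 4" for m
        using m0(2)[of m] that l0 by (simp add: P_def)
    qed
  qed
  \<comment> \<open>The factor 25 bounds u * v on the box, where u and v are at most 5.\<close>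
  define \<kappa>\<^sub>1 where "\<kappa>\<^sub>1 = \<eta> * \<rho> / 25"
  have k1: "0 < \<kappa>\<^sub>1" using \<eta> l0 by (simp add: \<kappa>\<^sub>1_def)
  \<comment> \<open>The box consists of n in A and z in B. Then z > 1, and |2 * t - z| \<le> 1 - \<rho> / 2 for \<rho> \<le> t \<le> 1.\<close>
  define A where "A = {\<rho> / 8..\<rho> / 4}"
  define B where "B = {1 + \<rho> / 2..1 + \<rho>}"
  have [measurable]: "A \<in> sets borel" "B \<in> sets borel" by (auto simp: A_def B_def)
  define \<kappa> where "\<kappa> = \<kappa>\<^sub>1 * (\<rho> / 8 * (\<rho> / 2)) / (2 * pi)"
  show ?thesis
  proof (rule that)
    show "0 < \<kappa>" using k1 l0 by (simp add: \<kappa>_def)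
    fix s r :: real
    assume sr: "0 < s" "s < r" "2 * \<rho> \<le> r + s" "r + s \<le> 2"
    define \<tau> where "\<tau> = (r + s) / 2"
    have lam: "\<rho> \<le> \<tau>" "\<tau> \<le> 1" "0 < \<tau>" "2 * \<tau> - r = s" "2 * \<tau> - s = r"
      using sr l0 by (auto simp: \<tau>_def field_simps)
    define c where "c = \<kappa>\<^sub>1 * (r - s)"
    have c: "0 \<le> c" using k1 sr by (simp add: c_def)
    have pointwise: "G r n z + G r n (2 * \<tau> - z) + c * (indicator A n * indicator B z) \<le> G s n z + G s n (2 * \<tau> - z)"
      if z: "\<tau> < z" for n z
    proof (cases "0 < n")
      case False
      then have "n \<notin> A" using l0 by (auto simp: A_def)
      then show ?thesis using False by (simp add: G_def)
    next
      case n: True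
      define a where "a = P (n + z\<^sup>2)"
      define b where "b = P (n + (2 * \<tau> - z)\<^sup>2)"
      define u where "u = n + (z - r)\<^sup>2"
      define v where "v = n + (z - s)\<^sup>2"
      have ab: "a \<le> b" unfolding a_def b_def
        by (rule P_reflect[OF dec lam(1,3) z n])
      have u: "0 < u" and v: "0 < v" using n by (auto simp: u_def v_def add_pos_nonneg)
      have vu: "v - u = (r - s) * (2 * (z - \<tau>))"
      proof -
        have "2 * (z - \<tau>) = 2 * z - r - s" by (simp add: \<tau>_def field_simps)
        moreover have "v - u = (r - s) * (2 * z - r - s)"
          by (simp add: u_def v_def power2_eq_square algebra_simps)
        ultimately show ?thesis by (simp only:)
      qed
      have uv: "u \<le> v" using vu sr z by (smt (verit) mult_nonneg_nonneg)
      have "2 * \<tau> - z - r = - (z - s)" "2 * \<tau> - z - s = - (z - r)" using lam by auto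
      then have sq: "(2 * \<tau> - z - r)\<^sup>2 = (z - s)\<^sup>2" "(2 * \<tau> - z - s)\<^sup>2 = (z - r)\<^sup>2"
        by (metis power2_minus)+
      have G: "G r n z = a / u" "G r n (2 * \<tau> - z) = b / v" "G s n z = a / v" "G s n (2 * \<tau> - z) = b / u"
        using n by (auto simp: G_def a_def b_def u_def v_def sq)
      have "c * (indicator A n * indicator B z) \<le> (b - a) * (1 / u - 1 / v)"
      proof (cases "n \<in> A \<and> z \<in> B")
        case False
        have "1 / v \<le> 1 / u" using uv u by (simp add: frac_le)
        then show ?thesis using False ab by (auto simp: indicator_def)
      next
        case True
        then have nz: "\<rho> / 8 \<le> n" "n \<le> \<rho> / 4" "1 + \<rho> / 2 \<le> z" "z \<le> 1 + \<rho>" by (auto simp: A_def B_def)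
        have "1 \<le> z\<^sup>2" using nz l0 by (simp add: one_le_power)
        then have a0: "a = 0" using n by (simp add: a_def P_def)
        have abs: "\<bar>2 * \<tau> - z\<bar> \<le> 1 - \<rho> / 2" using nz lam l0 by (auto simp: abs_le_iff)
        have "(2 * \<tau> - z)\<^sup>2 \<le> (1 - \<rho> / 2)\<^sup>2" using abs l0 by (simp add: abs_le_square_iff[symmetric])
        also have "\<dots> \<le> (1 - \<rho> / 2) * 1" unfolding power2_eq_square using l0 by (intro mult_left_mono) auto
        finally have "(2 * \<tau> - z)\<^sup>2 \<le> 1 - \<rho> / 2" by simp
        moreover have "0 \<le> (2 * \<tau> - z)\<^sup>2" by simp
        ultimately have b: "\<eta> \<le> b" unfolding b_def using nz by (intro \<eta>(2)) linarith+
        have "\<bar>z - r\<bar> \<le> 2" "\<bar>z - s\<bar> \<le> 2" using nz sr l0 by auto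
        then have "(z - r)\<^sup>2 \<le> 2\<^sup>2" "(z - s)\<^sup>2 \<le> 2\<^sup>2" by (intro power2_le_iff_abs_le[THEN iffD2]; simp)+
        then have "u \<le> 5" "v \<le> 5" using nz l0 by (auto simp: u_def v_def)
        then have uv25: "u * v \<le> 5 * 5" using u v by (intro mult_mono) auto
        have d: "1 / u - 1 / v = (v - u) / (u * v)" using u v by (simp add: field_simps)
        have "(r - s) * \<rho> / 25 \<le> (v - u) / (u * v)"
          unfolding vu
        proof (rule frac_le)
          show "(r - s) * \<rho> \<le> (r - s) * (2 * (z - \<tau>))" using nz lam sr by (intro mult_left_mono) auto
          show "0 \<le> (r - s) * (2 * (z - \<tau>))" using sr z by simp
        qed (use u v uv25 in auto)
        then have "\<eta> * ((r - s) * \<rho> / 25) \<le> b * ((v - u) / (u * v))"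
          using b \<eta> sr l0 by (intro mult_mono) auto
        then show ?thesis using True a0 by (simp add: d c_def \<kappa>\<^sub>1_def mult_ac)
      qed
      then show ?thesis unfolding G by (simp add: algebra_simps diff_divide_distrib)
    qed
    have inner: "(\<integral>\<^sup>+z. ennreal (G r n z) \<partial>lborel) + ennreal (c * indicator A n * (\<rho> / 2)) \<le> (\<integral>\<^sup>+z. ennreal (G s n z) \<partial>lborel)" for n
    proof -
      have BI: "ennreal (c * indicator A n * (\<rho> / 2)) = (\<integral>\<^sup>+z. ennreal (c * indicator A n * indicator B z) \<partial>lborel)"
      proof -
        have "(\<integral>\<^sup>+z. ennreal (c * indicator A n * indicator B z) \<partial>lborel) = (\<integral>\<^sup>+z. ennreal (c * indicator A n) * indicator B z \<partial>lborel)"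
          by (intro nn_integral_cong) (auto simp: indicator_def)
        also have "\<dots> = ennreal (c * indicator A n) * emeasure lborel B" by (simp add: nn_integral_cmult_indicator)
        also have "emeasure lborel B = ennreal (\<rho> / 2)" using l0 by (simp add: B_def)
        also have "ennreal (c * indicator A n) * ennreal (\<rho> / 2) = ennreal (c * indicator A n * (\<rho> / 2))"
          using c by (subst ennreal_mult'[symmetric]) auto
        finally show ?thesis ..
      qed
      have "(\<integral>\<^sup>+z. ennreal (G r n z) \<partial>lborel) + ennreal (c * indicator A n * (\<rho> / 2)) =
        (\<integral>\<^sup>+z. ennreal (indicator {\<tau><..} z * (G r n z + G r n (2 * \<tau> - z))) + ennreal (c * indicator A n * indicator B z) \<partial>lborel)"
        unfolding BI nn_integral_reflect[of "G r n" \<tau>, OF G_measurable1(1) G_nonneg]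
        by (rule nn_integral_add[symmetric]) measurable
      also have "\<dots> \<le> (\<integral>\<^sup>+z. ennreal (indicator {\<tau><..} z * (G s n z + G s n (2 * \<tau> - z))) \<partial>lborel)"
      proof (rule nn_integral_mono)
        fix z
        show "ennreal (indicator {\<tau><..} z * (G r n z + G r n (2 * \<tau> - z))) + ennreal (c * indicator A n * indicator B z)
          \<le> ennreal (indicator {\<tau><..} z * (G s n z + G s n (2 * \<tau> - z)))"
        proof (cases "\<tau> < z")
          case True
          have "ennreal (G r n z + G r n (2 * \<tau> - z)) + ennreal (c * indicator A n * indicator B z)
             = ennreal (G r n z + G r n (2 * \<tau> - z) + c * (indicator A n * indicator B z))"
            using c G_nonneg[of r n] by (subst ennreal_plus[symmetric]) (auto simp: mult.assoc)
          also have "\<dots> \<le> ennreal (G s n z + G s n (2 * \<tau> - z))"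
            by (intro ennreal_leI pointwise True)
          finally show ?thesis using True by simp
        next
          case False
          then have "z \<notin> B" using lam l0 by (auto simp: B_def)
          with False show ?thesis by simp
        qed
      qed
      also have "\<dots> = (\<integral>\<^sup>+z. ennreal (G s n z) \<partial>lborel)"
        by (rule nn_integral_reflect[symmetric]) (auto simp: G_nonneg)
      finally show ?thesis .
    qed
    have "ennreal (2 * pi * (\<psi> r / r)) + ennreal (c * (\<rho> / 2) * (\<rho> / 8))
      = (\<integral>\<^sup>+n. \<integral>\<^sup>+z. ennreal (G r n z) \<partial>lborel \<partial>lborel) + (\<integral>\<^sup>+n. ennreal (c * indicator A n * (\<rho> / 2)) \<partial>lborel)"
    proof -
      have "(\<integral>\<^sup>+n. ennreal (c * indicator A n * (\<rho> / 2)) \<partial>lborel) = (\<integral>\<^sup>+n. ennreal (c * (\<rho> / 2)) * indicator A n \<partial>lborel)"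
        by (intro nn_integral_cong) (auto simp: indicator_def)
      also have "\<dots> = ennreal (c * (\<rho> / 2)) * emeasure lborel A" by (simp add: nn_integral_cmult_indicator)
      also have "emeasure lborel A = ennreal (\<rho> / 8)" using l0 by (simp add: A_def)
      also have "ennreal (c * (\<rho> / 2)) * ennreal (\<rho> / 8) = ennreal (c * (\<rho> / 2) * (\<rho> / 8))"
        using c l0 by (subst ennreal_mult'[symmetric]) auto
      finally show ?thesis using sr by (subst nn_integral_G) auto
    qed
    also have "\<dots> = (\<integral>\<^sup>+n. (\<integral>\<^sup>+z. ennreal (G r n z) \<partial>lborel) + ennreal (c * indicator A n * (\<rho> / 2)) \<partial>lborel)"
      by (rule nn_integral_add[symmetric]) measurable
    also have "\<dots> \<le> (\<integral>\<^sup>+n. \<integral>\<^sup>+z. ennreal (G s n z) \<partial>lborel \<partial>lborel)"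
      by (intro nn_integral_mono inner)
    also have "\<dots> = ennreal (2 * pi * (\<psi> s / s))" using sr by (intro nn_integral_G) auto
    finally have le: "ennreal (2 * pi * (\<psi> r / r)) + ennreal (c * (\<rho> / 2) * (\<rho> / 8)) \<le> ennreal (2 * pi * (\<psi> s / s))" .
    have nn: "0 \<le> 2 * pi * (\<psi> r / r)" "0 \<le> 2 * pi * (\<psi> s / s)" "0 \<le> c * (\<rho> / 2) * (\<rho> / 8)"
      using sr c l0 potential_pos[of r] potential_pos[of s] by auto
    from le have "2 * pi * (\<psi> r / r) + c * (\<rho> / 2) * (\<rho> / 8) \<le> 2 * pi * (\<psi> s / s)"
      using nn by (simp add: ennreal_plus[symmetric] ennreal_le_iff del: ennreal_plus)
    moreover have "c * (\<rho> / 2) * (\<rho> / 8) = 2 * pi * (\<kappa> * (r - s))" by (simp add: c_def \<kappa>_def)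
    ultimately have "2 * pi * (\<psi> r / r + \<kappa> * (r - s)) \<le> 2 * pi * (\<psi> s / s)"
      by (simp add: distrib_left)
    then show "\<psi> r / r + \<kappa> * (r - s) \<le> \<psi> s / s"
      by (rule mult_left_le_imp_le) simp
  qed
qed

end

context odd_profile
begin

text \<open>The derivative of the function \<psi> x / x.\<close>

definition radial_potential' :: "real \<Rightarrow> real" where
  "radial_potential' x = - (\<psi> x + x * hilbert f x) / x\<^sup>2"

lemma DERIV_radial_potential:
  assumes "x \<noteq> 0"
  shows "((\<lambda>x. \<psi> x / x) has_real_derivative radial_potential' x) (at x)"
proof (rule DERIV_cong[OF DERIV_divide[OF DERIV_potential_hilbert DERIV_ident assms]])
  show "(- hilbert f x * x - \<psi> x * 1) / (x * x) = radial_potential' x"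
    by (simp add: radial_potential'_def power2_eq_square algebra_simps)
qed

lemma isCont_potential: "isCont (\<psi>) x"
  using DERIV_potential_hilbert by (rule DERIV_isCont)

lemma isCont_radial_potential': "x \<noteq> 0 \<Longrightarrow> isCont radial_potential' x"
  unfolding radial_potential'_def
  by (intro continuous_intros isCont_potential isCont_hilbert) auto

end

text \<open>By oddness the equation on [0,1] amounts to the eigenvalue equation of M on the whole line.\<close>

locale eigenprofile = odd_profile +
  fixes \<mu> :: real
  assumes eig: "\<And>x. 0 \<le> x \<Longrightarrow> x \<le> 1 \<Longrightarrow> \<mu> * f x = \<psi> x - \<psi> 1 * x"
begin

lemma quotient_eq:
  assumes "0 < x" "x \<le> 1"
  shows "\<mu> * (f x / x) = \<psi> x / x - \<psi> 1"
  using eig[of x] assms by (simp add: field_simps)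

end

context positive_profile
begin

text \<open>The symmetric difference quotient at x of the radial potential uses exactly the mirror pairs
x + h and x - h of the plane of height x. At x = 1 one point of the pair lies outside the ball, so
the plane of height 1 gives the estimate at the boundary.\<close>

lemma radial_potential'_neg:
  assumes "decreasing_beyond \<rho>" "0 < \<rho>" "\<rho> \<le> x" "x \<le> 1"
  shows "radial_potential' x < 0"
proof -
  obtain \<kappa> where k: "0 < \<kappa>" and gap: "\<And>s r. 0 < s \<Longrightarrow> s < r \<Longrightarrow> 2 * \<rho> \<le> r + s \<Longrightarrow> r + s \<le> 2 \<Longrightarrow>
      \<psi> r / r + \<kappa> * (r - s) \<le> \<psi> s / s"
    using potential_gap[OF assms(1,2)] assms by auto
  let ?I = "\<lambda>x. \<psi> x / x"
  let ?g = "\<lambda>h. ?I (x + h) - ?I (x - h) + 2 * \<kappa> * h"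
  have x: "0 < x" using assms by simp
  have "(?g has_real_derivative 2 * (radial_potential' x + \<kappa>)) (at 0)"
  proof -
    have 1: "((\<lambda>h. ?I (x + h)) has_real_derivative radial_potential' (x + 0) * 1) (at 0)"
      by (rule DERIV_chain2[where f="?I"], rule DERIV_radial_potential) (use x in \<open>auto intro!: derivative_eq_intros\<close>)
    have 2: "((\<lambda>h. ?I (x - h)) has_real_derivative radial_potential' (x - 0) * (-1)) (at 0)"
      by (rule DERIV_chain2[where f="?I"], rule DERIV_radial_potential) (use x in \<open>auto intro!: derivative_eq_intros\<close>)
    show ?thesis
      by (rule DERIV_cong[OF DERIV_add[OF DERIV_diff[OF 1 2] DERIV_cmult[OF DERIV_ident, of "2 * \<kappa>"]]]) simp
  qed
  moreover have "\<not> 0 < 2 * (radial_potential' x + \<kappa>)"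
  proof
    assume "0 < 2 * (radial_potential' x + \<kappa>)"
    from DERIV_pos_inc_right[OF calculation this]
    obtain d where d: "0 < d" "\<And>h. 0 < h \<Longrightarrow> h < d \<Longrightarrow> ?g 0 < ?g (0 + h)" by auto
    define h where "h = min (d / 2) (x / 2)"
    have h: "0 < h" "h < d" "h < x" using d x by (auto simp: h_def)
    have "?I (x + h) + \<kappa> * ((x + h) - (x - h)) \<le> ?I (x - h)"
      using h assms by (intro gap) auto
    then have "?g h \<le> 0" by (simp add: algebra_simps)
    with d(2)[OF h(1,2)] show False by simp
  qed
  ultimately show ?thesis using k by simp
qed

lemma decreasing_beyond_1: "decreasing_beyond 1"
  by (auto simp: decreasing_beyond_def)

end

locale positive_eigenprofile = positive_profile + eigenprofile
begin

text \<open>The radial potential decreases strictly towards 1, and \<mu> f x / x is its excess over the value at 1.\<close>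

lemma eigenvalue_pos: "0 < \<mu>"
proof (rule ccontr)
  assume "\<not> 0 < \<mu>"
  have "radial_potential' 1 < 0"
    by (rule radial_potential'_neg[OF decreasing_beyond_1]) auto
  from DERIV_neg_dec_left[OF DERIV_radial_potential this]
  obtain d where d: "0 < d" "\<And>h. 0 < h \<Longrightarrow> h < d \<Longrightarrow> \<psi> 1 / 1 < \<psi> (1 - h) / (1 - h)"
    by auto
  define h where "h = min (d / 2) (1 / 2)"
  have h: "0 < h" "h < d" "h < 1" using d by (auto simp: h_def)
  have "0 < \<mu> * (f (1 - h) / (1 - h))"
    using d(2)[OF h(1,2)] h by (subst quotient_eq) auto
  moreover have "0 < f (1 - h) / (1 - h)" using h pos[of "1 - h"] by simp
  ultimately show False using \<open>\<not> 0 < \<mu>\<close> mult_nonpos_nonneg[of \<mu> "f (1 - h) / (1 - h)"] by linarith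
qed

lemma quotient_le_iff:
  assumes "0 < s" "s \<le> 1" "0 < r" "r \<le> 1"
  shows "f r / r \<le> f s / s \<longleftrightarrow> \<psi> r / r \<le> \<psi> s / s"
proof -
  have "f r / r \<le> f s / s \<longleftrightarrow> \<mu> * (f r / r) \<le> \<mu> * (f s / s)"
    using mult_le_cancel_left_pos[OF eigenvalue_pos, of "f r / r" "f s / s"] by (rule sym)
  then show ?thesis using assms by (simp only: quotient_eq) simp
qed

text \<open>The plane can always be moved a little further. A pair (s,r) that is new for a slightly lower plane
either lies in the range where the derivative of the radial potential is still negative, by
continuity; or s stays away from r, and moving r up by at most 2 \<epsilon> gives an old pair, for which the
gap \<kappa> (r - s) outweighs the oscillation of the radial potential.\<close>

lemma decreasing_beyond_step:
  assumes dec: "decreasing_beyond \<rho>" and rho: "0 < \<rho>" "\<rho> \<le> 1"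
  obtains \<rho>' where "0 < \<rho>'" "\<rho>' < \<rho>" "decreasing_beyond \<rho>'"
proof -
  let ?I = "\<lambda>x. \<psi> x / x"
  obtain \<kappa> where k: "0 < \<kappa>" and gap: "\<And>s r. 0 < s \<Longrightarrow> s < r \<Longrightarrow> 2 * \<rho> \<le> r + s \<Longrightarrow> r + s \<le> 2 \<Longrightarrow>
      ?I r + \<kappa> * (r - s) \<le> ?I s"
    using potential_gap[OF dec rho] by auto
  obtain \<delta> where del: "0 < \<delta>" "\<delta> < \<rho>" "\<And>x. \<rho> - \<delta> \<le> x \<Longrightarrow> x \<le> 1 \<Longrightarrow> radial_potential' x < 0"
  proof -
    have "radial_potential' \<rho> < 0" by (rule radial_potential'_neg[OF dec]) (use rho in auto)
    moreover have "(radial_potential' \<longlongrightarrow> radial_potential' \<rho>) (at \<rho>)"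
      using isCont_radial_potential'[of \<rho>] rho by (simp add: isCont_def)
    ultimately have "\<forall>\<^sub>F x in at \<rho>. radial_potential' x < 0"
      by (rule order_tendstoD(2)[rotated])
    then obtain d where d: "0 < d" "\<And>x. x \<noteq> \<rho> \<Longrightarrow> \<bar>x - \<rho>\<bar> < d \<Longrightarrow> radial_potential' x < 0"
      by (auto simp: eventually_at dist_real_def)
    show ?thesis
    proof (rule that[of "min (d / 2) (\<rho> / 2)"])
      fix x assume x: "\<rho> - min (d / 2) (\<rho> / 2) \<le> x" "x \<le> 1"
      show "radial_potential' x < 0"
      proof (cases "\<rho> \<le> x")
        case True then show ?thesis using x rho by (intro radial_potential'_neg[OF dec]) auto
      next
        case False
        moreover have "min (d / 2) (\<rho> / 2) < d" using d by simp
        ultimately show ?thesis using x by (intro d(2)) (auto simp: abs_less_iff)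
      qed
    qed (use d rho in auto)
  qed
  have "uniformly_continuous_on {\<rho>..3} ?I"
    using rho by (intro compact_uniformly_continuous continuous_at_imp_continuous_on ballI
        DERIV_isCont[OF DERIV_radial_potential]) auto
  moreover have "0 < \<kappa> * \<delta>" using k del by simp
  ultimately have "\<exists>e>0. \<forall>x\<in>{\<rho>..3}. \<forall>y\<in>{\<rho>..3}. dist y x < e \<longrightarrow> dist (?I y) (?I x) < \<kappa> * \<delta>"
    unfolding uniformly_continuous_on_def by blast
  then obtain e where e: "0 < e" "\<And>x y. x \<in> {\<rho>..3} \<Longrightarrow> y \<in> {\<rho>..3} \<Longrightarrow> dist y x < e \<Longrightarrow> dist (?I y) (?I x) < \<kappa> * \<delta>"
    by blast
  define \<epsilon> where "\<epsilon> = min (\<delta> / 4) (e / 4)"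
  have eps: "0 < \<epsilon>" "\<epsilon> \<le> \<delta> / 4" "\<epsilon> \<le> e / 4" using del e by (auto simp: \<epsilon>_def)
  show ?thesis
  proof (rule that)
    show "0 < \<rho> - \<epsilon>" "\<rho> - \<epsilon> < \<rho>" using eps del by auto
    show "decreasing_beyond (\<rho> - \<epsilon>)"
      unfolding decreasing_beyond_def
    proof (intro allI impI)
      fix s r assume sr: "0 < s" "s < r" "r \<le> 1" "2 * (\<rho> - \<epsilon>) \<le> r + s"
      consider "2 * \<rho> \<le> r + s" | "\<rho> - \<delta> \<le> s" | "r + s < 2 * \<rho>" "s < \<rho> - \<delta>" by linarith
      then show "f r / r \<le> f s / s"
      proof cases
        case 1
        then show ?thesis using dec sr unfolding decreasing_beyond_def by blast
      next
        case 2
        have "?I r \<le> ?I s"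
        proof (rule DERIV_nonpos_imp_nonincreasing[where f="?I"])
          fix x assume x: "s \<le> x" "x \<le> r"
          have "radial_potential' x < 0" using x 2 sr by (intro del(3)) auto
          moreover have "x \<noteq> 0" using x sr by simp
          ultimately show "\<exists>y. (?I has_real_derivative y) (at x) \<and> y \<le> 0"
            using DERIV_radial_potential[of x] by (intro exI[of _ "radial_potential' x"]) simp
        qed (use sr in simp)
        then show ?thesis using quotient_le_iff[of s r] sr by simp
      next
        case 3
        define r' where "r' = 2 * \<rho> - s"
        have r': "r < r'" "r' - r \<le> 2 * \<epsilon>" "\<rho> \<le> r" "r' \<le> 3" "s < r'" "2 * \<delta> < r' - s"
          using 3 sr rho eps by (auto simp: r'_def)
        have "?I r' + \<kappa> * (r' - s) \<le> ?I s"
          using sr 3 rho r' by (intro gap) (auto simp: r'_def)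
        moreover have "\<kappa> * (2 * \<delta>) < \<kappa> * (r' - s)" using k r' by (intro mult_strict_left_mono) auto
        moreover have "dist (?I r) (?I r') < \<kappa> * \<delta>"
          using r' eps e(1) sr by (intro e(2)) (auto simp: dist_real_def)
        moreover have "0 < \<kappa> * \<delta>" using k del by simp
        ultimately have "?I r \<le> ?I s" by (simp add: dist_real_def abs_less_iff)
        then show ?thesis using quotient_le_iff[of s r] sr by simp
      qed
    qed
  qed
qed

text \<open>The condition passes to the infimum of the admissible heights by continuity, so an infimum above 0
contradicts the previous lemma.\<close>

lemma decreasing_beyond_all:
  assumes "0 < \<rho>"
  shows "decreasing_beyond \<rho>"
proof (rule ccontr)
  assume not: "\<not> decreasing_beyond \<rho>"
  let ?I = "\<lambda>x. \<psi> x / x"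
  define S where "S = {t. t \<le> 1 \<and> decreasing_beyond t}"
  have up: "decreasing_beyond t'" if "decreasing_beyond t" "t \<le> t'" for t t'
    unfolding decreasing_beyond_def
  proof (intro allI impI)
    fix s r assume "0 < s" "s < r" "r \<le> 1" "2 * t' \<le> r + s"
    moreover from this have "2 * t \<le> r + s" using that by simp
    ultimately show "f r / r \<le> f s / s" using that(1) unfolding decreasing_beyond_def by blast
  qed
  have lb: "\<rho> \<le> t" if "t \<in> S" for t
    using up[of t \<rho>] not that by (force simp: S_def)
  have S1: "1 \<in> S" using decreasing_beyond_1 by (simp add: S_def)
  define t0 where "t0 = Inf S"
  have bdd: "bdd_below S" using lb by (auto simp: bdd_below_def)
  have t0: "\<rho> \<le> t0" "t0 \<le> 1"
    using lb S1 bdd by (auto simp: t0_def intro!: cInf_greatest cInf_lower)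
  have dec0: "decreasing_beyond t0"
    unfolding decreasing_beyond_def
  proof (intro allI impI)
    fix s r assume sr: "0 < s" "s < r" "r \<le> 1" "2 * t0 \<le> r + s"
    have strict: "f r / r \<le> f s' / s'" if "s < s'" "s' < r" for s'
    proof -
      have "t0 < (r + s') / 2" using sr that by simp
      then obtain t where t: "t \<in> S" "t < (r + s') / 2"
        using cInf_lessD[of S "(r + s') / 2"] S1 unfolding t0_def by blast
      then have "decreasing_beyond t" by (simp add: S_def)
      moreover have "2 * t \<le> r + s'" using t by simp
      ultimately show ?thesis
        using sr that unfolding decreasing_beyond_def by auto
    qed
    have "isCont ?I s" by (rule DERIV_isCont[OF DERIV_radial_potential]) (use sr in simp)
    then have "(?I \<longlongrightarrow> ?I s) (at_right s)"
      unfolding isCont_def by (rule tendsto_within_subset) simp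
    moreover have "\<forall>\<^sub>F s' in at_right s. ?I r \<le> ?I s'"
      using eventually_at_right_real[OF sr(2)]
    proof eventually_elim
      case (elim s')
      then show ?case using strict[of s'] quotient_le_iff[of s' r] sr by auto
    qed
    ultimately have "?I r \<le> ?I s" by (rule tendsto_lowerbound) simp
    then show "f r / r \<le> f s / s" using quotient_le_iff[of s r] sr by simp
  qed
  obtain t where "0 < t" "t < t0" "decreasing_beyond t"
    using decreasing_beyond_step[OF dec0] t0 assms by auto
  then have "t \<in> S" using t0 by (simp add: S_def)
  then show False using cInf_lower[OF _ bdd] \<open>t < t0\<close> by (force simp: t0_def)
qed

theorem radial_potential_decreasing:
  assumes "0 < x" "x \<le> 1"
  shows "radial_potential' x < 0"
  using radial_potential'_neg[OF decreasing_beyond_all] assms by blast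

end

section \<open>A positive symmetric kernel for the eigenvalue problem\<close>

lemma log_kernel_sym: "log_kernel x y = log_kernel y x"
proof -
  have "(y + x) / (y - x) = - ((x + y) / (x - y))"
    by (metis add.commute minus_diff_eq minus_divide_right)
  then show ?thesis by (simp only: log_kernel_def ln_minus)
qed

text \<open>The estimate 2 artanh t \<ge> 2 t at t = y / x.\<close>

lemma log_kernel_ge:
  assumes "0 < y" "y < x"
  shows "2 * (y / x) \<le> log_kernel x y"
proof -
  define r where "r = y / x"
  have r: "0 < r" "r < 1" using assms by (auto simp: r_def)
  have "ln (1 + 0) - ln (1 - 0) - 2 * 0 \<le> ln (1 + r) - ln (1 - r) - 2 * r"
  proof (rule DERIV_nonneg_imp_nondecreasing[where f="\<lambda>t. ln (1 + t) - ln (1 - t) - 2 * t"])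
    fix t assume t: "0 \<le> t" "t \<le> r"
    have "((\<lambda>t. ln (1 + t) - ln (1 - t) - 2 * t) has_real_derivative 1 / (1 + t) + 1 / (1 - t) - 2) (at t)"
      using t r by (auto intro!: derivative_eq_intros)
    moreover have "0 \<le> 1 / (1 + t) + 1 / (1 - t) - 2"
    proof -
      have "1 / (1 + t) + 1 / (1 - t) - 2 = 2 * t\<^sup>2 / ((1 + t) * (1 - t))"
      proof -
        have "1 + t \<noteq> 0" "1 - t \<noteq> 0" using t r by auto
        then show ?thesis by (simp add: divide_simps) (simp add: power2_eq_square algebra_simps)
      qed
      then show ?thesis using t r by simp
    qed
    ultimately show "\<exists>y. ((\<lambda>t. ln (1 + t) - ln (1 - t) - 2 * t) has_real_derivative y) (at t) \<and> 0 \<le> y" by blast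
  qed (use r in simp)
  moreover have "log_kernel x y = ln (1 + r) - ln (1 - r)"
  proof -
    have "(x + y) / (x - y) = (1 + r) / (1 - r)"
      using assms by (simp add: r_def field_simps)
    then show ?thesis using r by (simp add: log_kernel_def ln_divide_pos)
  qed
  ultimately show ?thesis by (simp add: r_def)
qed

text \<open>On (0,1) and up to the factor 1/pi, the operator M acts on the negative derivatives of f x / x by this
kernel and division by x^2. In contrast to the kernel of M on f itself, which changes sign, it
is positive. The value 0 on the diagonal makes it non-negative on the whole positive quadrant.\<close>

definition radial_kernel :: "real \<Rightarrow> real \<Rightarrow> real" where
  "radial_kernel x t = (if x = t then 0 else (x\<^sup>2 + t\<^sup>2) / 2 * log_kernel x t - x * t)"

lemma radial_kernel_sym: "radial_kernel x t = radial_kernel t x"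
  by (simp add: radial_kernel_def log_kernel_sym[of x t] add.commute mult.commute)

lemma radial_kernel_pos:
  assumes "0 < x" "0 < t" "x \<noteq> t"
  shows "0 < radial_kernel x t"
proof -
  have less: "0 < radial_kernel x t" if "0 < t" "t < x" for x t
  proof -
    have "(x\<^sup>2 + t\<^sup>2) / 2 * (2 * (t / x)) \<le> (x\<^sup>2 + t\<^sup>2) / 2 * log_kernel x t"
      using log_kernel_ge[OF that] by (intro mult_left_mono) auto
    moreover have "(x\<^sup>2 + t\<^sup>2) / 2 * (2 * (t / x)) - x * t = t\<^sup>2 * t / x"
      using that by (simp add: field_simps power2_eq_square)
    moreover have "0 < t\<^sup>2 * t / x" using that by simp
    moreover have "radial_kernel x t = (x\<^sup>2 + t\<^sup>2) / 2 * log_kernel x t - x * t" using that by (simp add: radial_kernel_def)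
    ultimately show ?thesis by linarith
  qed
  show ?thesis
  proof (cases "t < x")
    case True then show ?thesis using less assms by blast
  next
    case False then show ?thesis using less[of x t] assms radial_kernel_sym[of x t] by simp
  qed
qed

lemma radial_kernel_measurable [measurable]: "case_prod radial_kernel \<in> borel_measurable (borel \<Otimes>\<^sub>M borel)"
  unfolding radial_kernel_def log_kernel_def split_beta' by measurable

lemma radial_kernel_measurable1 [measurable]: "radial_kernel x \<in> borel_measurable borel"
  unfolding radial_kernel_def by measurable

lemma radial_kernel_bound:
  assumes "0 < x" "x < 1" "0 < t" "t < 1"
  shows "radial_kernel x t / t \<le> 4 / x + 2 / x * (1 + \<bar>ln (t - x)\<bar>)"
proof (cases "x = t")
  case True
  then show ?thesis using assms by (simp add: radial_kernel_def)
next
  case False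
  have pos: "0 \<le> 4 / x" "0 \<le> 2 / x * (1 + \<bar>ln (t - x)\<bar>)" using assms by auto
  have "radial_kernel x t \<le> log_kernel x t"
  proof -
    have "x\<^sup>2 \<le> 1" "t\<^sup>2 \<le> 1" using assms by (auto intro!: power_le_one)
    then have "(x\<^sup>2 + t\<^sup>2) / 2 * log_kernel x t \<le> 1 * log_kernel x t"
      using log_kernel_nonneg[of x t] assms by (intro mult_right_mono) auto
    moreover have "0 < x * t" using assms by simp
    ultimately show ?thesis using False by (simp add: radial_kernel_def)
  qed
  then have 1: "radial_kernel x t / t \<le> log_kernel x t / t" using assms by (intro divide_right_mono) auto
  show ?thesis
  proof (cases "t \<le> x / 2")
    case True
    then have tx: "0 < (x + t) / (x - t)" using assms by simp
    have "log_kernel x t \<le> (x + t) / (x - t) - 1" unfolding log_kernel_def by (rule ln_le_minus_one[OF tx])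
    also have "\<dots> = 2 * t / (x - t)" using True assms by (simp add: field_simps)
    also have "\<dots> \<le> 2 * t / (x / 2)" using True assms by (intro divide_left_mono) auto
    finally have "log_kernel x t / t \<le> 4 / x" using assms by (simp add: field_simps)
    then show ?thesis using 1 pos by linarith
  next
    case gt: False
    have "log_kernel x t = ln (x + t) - ln (x - t)" using assms False by (simp add: log_kernel_def ln_div)
    moreover have "ln (x + t) \<le> x + t - 1" using assms by (intro ln_le_minus_one) auto
    ultimately have k: "log_kernel x t \<le> 1 + \<bar>ln (t - x)\<bar>" using assms ln_swap[of t x] by linarith
    have "log_kernel x t / t \<le> (1 + \<bar>ln (t - x)\<bar>) / (x / 2)"
      using k gt assms log_kernel_nonneg[of x t] by (intro frac_le) auto
    moreover have "(1 + \<bar>ln (t - x)\<bar>) / (x / 2) = 2 / x * (1 + \<bar>ln (t - x)\<bar>)" by simp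
    ultimately show ?thesis using 1 pos by linarith
  qed
qed

lemma radial_kernel_integrable:
  assumes "0 < x" "x < 1"
  shows "integrable lborel (\<lambda>t. indicator {0<..<1} t * (radial_kernel x t / t))"
proof (rule Bochner_Integration.integrable_bound)
  have "integrable lborel (\<lambda>z::real. \<bar>indicator {-1..1} z * ln z\<bar>)"
    using integrable_ln[of 1] by simp
  then have "integrable lborel (\<lambda>t. \<bar>indicator {-1..1} (- x + 1 * t) * ln (- x + 1 * t)\<bar>)"
    by (intro lborel_integrable_real_affine) auto
  then have i: "integrable lborel (\<lambda>t. \<bar>indicator {-1..1} (t - x) * ln (t - x)\<bar>)" by simp
  have j: "integrable lborel (indicator {0<..<1::real} :: real \<Rightarrow> real)" by (intro integrable_real_indicator) auto
  show "integrable lborel (\<lambda>t. (4 / x + 2 / x) * indicator {0<..<1} t + 2 / x * \<bar>indicator {-1..1} (t - x) * ln (t - x)\<bar>)"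
    using i j by (intro Bochner_Integration.integrable_add integrable_mult_right)
  show "AE t in lborel. norm (indicator {0<..<1} t * (radial_kernel x t / t)) \<le>
    norm ((4 / x + 2 / x) * indicator {0<..<1} t + 2 / x * \<bar>indicator {-1..1} (t - x) * ln (t - x)\<bar>)"
  proof (rule AE_I2)
    fix t
    show "norm (indicator {0<..<1} t * (radial_kernel x t / t)) \<le>
    norm ((4 / x + 2 / x) * indicator {0<..<1} t + 2 / x * \<bar>indicator {-1..1} (t - x) * ln (t - x)\<bar>)"
    proof (cases "t \<in> {0<..<1}")
      case True
      then have "t - x \<in> {-1..1}" using assms by auto
      moreover have "0 \<le> radial_kernel x t" using radial_kernel_pos[of x t] True assms by (cases "x = t") (auto simp: radial_kernel_def)
      moreover have "radial_kernel x t / t \<le> 4 / x + 2 / x * (1 + \<bar>ln (t - x)\<bar>)"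
        using radial_kernel_bound[of x t] True assms by auto
      ultimately show ?thesis using True assms by (simp add: distrib_left abs_mult)
    qed simp
  qed
qed measurable

lemma DERIV_log_kernel:
  assumes "0 < x" "0 < y" "y \<noteq> x"
  shows "(log_kernel x has_real_derivative 2 * x / ((x + y) * (x - y))) (at y)"
proof -
  have 1: "((\<lambda>y. (x + y) / (x - y)) has_real_derivative 2 * x / (x - y)\<^sup>2) (at y)"
    using assms by (auto intro!: derivative_eq_intros simp: power2_eq_square)
  have "((\<lambda>y. ln ((x + y) / (x - y))) has_real_derivative 1 / ((x + y) / (x - y)) * (2 * x / (x - y)\<^sup>2)) (at y)"
    by (rule DERIV_chain2[OF DERIV_ln_nonzero 1]) (use assms in auto)
  moreover have "1 / ((x + y) / (x - y)) * (2 * x / (x - y)\<^sup>2) = 2 * x / ((x + y) * (x - y))"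
    using assms by (simp add: power2_eq_square)
  ultimately show ?thesis unfolding log_kernel_def[abs_def] by simp
qed

text \<open>The singularity of the kernel on the diagonal is logarithmic.\<close>

lemma tendsto_mult_log_kernel:
  assumes "0 < x"
  shows "((\<lambda>y. (y - x) * log_kernel x y) \<longlongrightarrow> 0) (at x)"
proof -
  have "((\<lambda>y. (y - x) * ln (y - x)) \<longlongrightarrow> 0) (at x)"
  proof (rule Lim_null_comparison)
    show "\<forall>\<^sub>F y in at x. norm ((y - x) * ln (y - x)) \<le> 2 * sqrt \<bar>y - x\<bar> + (y - x)\<^sup>2"
      using abs_mult_ln_le by (intro always_eventually allI) simp
    show "((\<lambda>y. 2 * sqrt \<bar>y - x\<bar> + (y - x)\<^sup>2) \<longlongrightarrow> 0) (at x)"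
      by (auto intro!: tendsto_eq_intros)
  qed
  moreover have "((\<lambda>y. (y - x) * ln (x + y)) \<longlongrightarrow> (x - x) * ln (x + x)) (at x)"
    using assms by (intro tendsto_intros) auto
  ultimately have "((\<lambda>y. (y - x) * ln (x + y) - (y - x) * ln (y - x)) \<longlongrightarrow> (x - x) * ln (x + x) - 0) (at x)"
    by (intro tendsto_diff)
  moreover have "\<forall>\<^sub>F y in at x. (y - x) * ln (x + y) - (y - x) * ln (y - x) = (y - x) * log_kernel x y"
    using eventually_at_in_open[of "{0<..}" x] assms
    by (auto simp: log_kernel_def ln_div ln_swap[of _ x] right_diff_distrib elim!: eventually_mono)
  ultimately show ?thesis by (simp add: filterlim_cong)
qed

context odd_profile
begin

text \<open>If \<mu> f x = \<psi> x - \<psi> 1 * x, with \<psi> the potential of f, then this is \<mu> (f x - x f' x): the multiple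
of x which distinguishes M f from the potential drops out.\<close>

definition w :: "real \<Rightarrow> real" where "w x = \<psi> x + x * hilbert f x"

lemma isCont_w: "isCont w x"
  unfolding w_def[abs_def] by (intro continuous_intros isCont_potential isCont_hilbert)

lemma w_bound:
  obtains K where "0 \<le> K" "\<And>t. 0 \<le> t \<Longrightarrow> t \<le> 1 \<Longrightarrow> \<bar>w t\<bar> \<le> K * t"
    "\<And>t. 0 \<le> t \<Longrightarrow> t \<le> 1 \<Longrightarrow> \<bar>\<psi> t\<bar> \<le> K * t"
proof -
  have "compact (hilbert f ` {0..1})"
    by (intro compact_continuous_image continuous_at_imp_continuous_on ballI isCont_hilbert) auto
  then obtain M where M: "\<And>x. 0 \<le> x \<Longrightarrow> x \<le> 1 \<Longrightarrow> \<bar>hilbert f x\<bar> \<le> M"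
    using compact_imp_bounded bounded_iff by (metis atLeastAtMost_iff image_eqI real_norm_def)
  have M0: "0 \<le> M" using M[of 0] by simp
  have psi: "\<bar>\<psi> t\<bar> \<le> M * t" if "0 \<le> t" "t \<le> 1" for t
  proof -
    have "norm (\<psi> t - \<psi> 0) \<le> M * norm (t - 0)"
      by (rule field_differentiable_bound[where S="{0..1}" and f'="\<lambda>x. - hilbert f x"])
         (use that M in \<open>auto intro: has_field_derivative_at_within DERIV_potential_hilbert\<close>)
    moreover have "\<psi> 0 = 0" using potential_odd[of 0] by simp
    ultimately show ?thesis using that by simp
  qed
  show ?thesis
  proof (rule that[of "2 * M"])
    fix t :: real assume t: "0 \<le> t" "t \<le> 1"
    have "\<bar>w t\<bar> \<le> \<bar>\<psi> t\<bar> + \<bar>t * hilbert f t\<bar>" unfolding w_def by (rule abs_triangle_ineq)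
    also have "\<bar>t * hilbert f t\<bar> \<le> t * M" using t M by (simp add: abs_mult mult_left_mono)
    finally show "\<bar>w t\<bar> \<le> 2 * M * t" using psi[OF t] by (simp add: mult.commute[of t M])
    show "\<bar>\<psi> t\<bar> \<le> 2 * M * t" using psi[OF t] mult_nonneg_nonneg[OF M0 t(1)] by simp
  qed (use M0 in simp)
qed

text \<open>The singular integral D folded onto [0,1]: outside [-1,1] the numerator is -f x, which contributes
the logarithm.\<close>

lemma difference_quotient_integral:
  assumes x: "0 < x" "x < 1"
  shows "((\<lambda>y. (f y - f x) / (y - x) + (f y + f x) / (y + x)) has_integral D 3 x + f x * log_kernel x 1) {0..1}"
proof -
  define g where "g y = (f y - f x) / (y - x)" for y
  have ind: "indicator {x - 3..x + 3} (x + z) = (indicator {-3..3} z :: real)" for z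
    by (auto simp: indicator_def)
  have gx: "g (x + z) = (f (x + z) - f x) / z" for z by (simp add: g_def)
  have "integrable lborel (\<lambda>z. indicator {x - 3..x + 3} (x + 1 * z) *\<^sub>R g (x + 1 * z))"
    using D_integrable[of 3 x] by (simp add: ind gx)
  then have gi: "set_integrable lborel {x - 3..x + 3} g"
    unfolding set_integrable_def by (subst (asm) lborel_integrable_real_affine_iff) auto
  have "(LINT y:{x - 3..x + 3}|lborel. g y) = D 3 x"
    unfolding set_lebesgue_integral_def D_def
    by (subst lborel_integral_real_affine[of 1 _ x]) (simp_all add: ind gx)
  then have gI: "g integrable_on {x - 3..x + 3}" "integral {x - 3..x + 3} g = D 3 x"
    using set_borel_integral_eq_integral[OF gi] by auto
  have sub: "g integrable_on {a..b}" if "x - 3 \<le> a" "b \<le> x + 3" for a b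
    by (rule integrable_on_subinterval[OF gI(1)]) (use that in auto)
  have outside: "(g has_integral (- f x * ln (b - x) - (- f x * ln (a - x)))) {a..b}"
    if "a \<le> b" and away: "\<And>y. y \<in> {a..b} \<Longrightarrow> y \<noteq> x \<and> 1 \<le> \<bar>y\<bar>" for a b
  proof (rule fundamental_theorem_of_calculus)
    fix y assume y: "y \<in> {a..b}"
    have "((\<lambda>y. - f x * ln (y - x)) has_real_derivative - f x * (1 / (y - x) * 1)) (at y)"
      by (intro DERIV_cmult DERIV_chain2[OF DERIV_ln_nonzero]) (use away[OF y] in \<open>auto intro!: derivative_eq_intros\<close>)
    moreover have "g y = - f x * (1 / (y - x) * 1)" using supp[of y] away[OF y] by (simp add: g_def)
    ultimately show "((\<lambda>y. - f x * ln (y - x)) has_vector_derivative g y) (at y within {a..b})"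
      by (simp add: has_real_derivative_iff_has_vector_derivative[symmetric] has_field_derivative_at_within)
  qed (rule that)
  have right: "(g has_integral (- f x * ln (x + 3 - x) - (- f x * ln (1 - x)))) {1..x + 3}"
    by (rule outside) (use x in auto)
  have left: "(g has_integral (- f x * ln (-1 - x) - (- f x * ln (x - 3 - x)))) {x - 3..-1}"
    by (rule outside) (use x in auto)
  have "integral {x - 3..-1} g + integral {-1..x + 3} g = integral {x - 3..x + 3} g"
    by (rule Henstock_Kurzweil_Integration.integral_combine) (use x gI in auto)
  moreover have "integral {-1..1} g + integral {1..x + 3} g = integral {-1..x + 3} g"
    by (rule Henstock_Kurzweil_Integration.integral_combine) (use x in \<open>auto intro!: sub\<close>)
  moreover have "integral {-1..0} g + integral {0..1} g = integral {-1..1} g"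
    by (rule Henstock_Kurzweil_Integration.integral_combine) (use x in \<open>auto intro!: sub\<close>)
  ultimately have total: "integral {-1..0} g + integral {0..1} g = D 3 x - integral {x - 3..-1} g - integral {1..x + 3} g"
    using gI(2) by linarith
  have "integral {x - 3..-1} g + integral {1..x + 3} g = - f x * log_kernel x 1"
  proof -
    have "ln (-1 - x) = ln (1 + x)" using ln_minus[of "1 + x"] by simp
    moreover have "log_kernel x 1 = ln (1 + x) - ln (1 - x)" using x ln_swap[of x 1] by (simp add: log_kernel_def ln_div add.commute)
    then have "f x * log_kernel x 1 = f x * ln (1 + x) - f x * ln (1 - x)" by (simp only: right_diff_distrib)
    ultimately show ?thesis
      using integral_unique[OF left] integral_unique[OF right] by (simp add: ln_minus algebra_simps)
  qed
  with total have tot: "integral {-1..0} g + integral {0..1} g = D 3 x + f x * log_kernel x 1" by linarith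
  have "((\<lambda>y. g (- y)) has_integral integral {-1..0} g) {0..1}"
    using has_integral_reflect_real[THEN iffD2, OF integrable_integral[OF sub[of "-1" 0]]] x by simp
  moreover have "(g has_integral integral {0..1} g) {0..1}" using x by (intro integrable_integral sub) auto
  ultimately have "((\<lambda>y. g y + g (- y)) has_integral integral {0..1} g + integral {-1..0} g) {0..1}"
    by (intro has_integral_add)
  moreover have "g y + g (- y) = (f y - f x) / (y - x) + (f y + f x) / (y + x)" for y
  proof -
    have "(- f y - f x) / (- y - x) = (f y + f x) / (y + x)"
    proof -
      have "- f y - f x = - (f y + f x)" "- y - x = - (y + x)" by simp_all
      then show ?thesis by (simp only: minus_divide_divide)
    qed
    then show ?thesis by (simp add: g_def odd)
  qed
  ultimately show ?thesis using tot by (simp add: add.commute)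
qed

end

context eigenprofile
begin

text \<open>For \<mu> \<noteq> 0 this is the negative derivative of f x / x on (0,1).\<close>

definition q :: "real \<Rightarrow> real" where "q t = w t / (\<mu> * t\<^sup>2)"

lemma DERIV_quotient:
  assumes "\<mu> \<noteq> 0" "0 < y" "y < 1"
  shows "((\<lambda>y. f y / y) has_real_derivative - q y) (at y)"
proof -
  have 1: "((\<lambda>y. (\<psi> y / y - \<psi> 1) / \<mu>) has_real_derivative (radial_potential' y - 0) / \<mu>) (at y)"
    using assms by (intro DERIV_cdivide DERIV_diff DERIV_radial_potential DERIV_const) auto
  have 2: "(radial_potential' y - 0) / \<mu> = - q y"
  proof -
    have "(- A / y\<^sup>2 - 0) / \<mu> = - (A / (\<mu> * y\<^sup>2))" for A by (simp add: mult.commute)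
    then show ?thesis unfolding radial_potential'_def q_def w_def .
  qed
  have "\<forall>\<^sub>F z in nhds y. (\<psi> z / z - \<psi> 1) / \<mu> = f z / z"
  proof -
    have "\<forall>\<^sub>F z in nhds y. z \<in> {0<..<1}" using assms by (intro eventually_nhds_in_open) auto
    then show ?thesis
    proof eventually_elim
      case (elim z)
      then have "\<psi> z / z - \<psi> 1 = \<mu> * (f z / z)"
        by (intro quotient_eq[symmetric]) auto
      then show ?case using assms(1) by simp
    qed
  qed
  then show ?thesis by (rule DERIV_cong_ev[OF refl _ refl, THEN iffD1, OF _ DERIV_cong[OF 1 2]])
qed

lemma quotient_bounded:
  assumes "\<mu> \<noteq> 0"
  obtains B where "\<And>y. 0 \<le> y \<Longrightarrow> y \<le> 1 \<Longrightarrow> \<bar>f y / y\<bar> \<le> B"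
proof -
  obtain K where K: "0 \<le> K" "\<And>t. 0 \<le> t \<Longrightarrow> t \<le> 1 \<Longrightarrow> \<bar>\<psi> t\<bar> \<le> K * t"
    using w_bound by metis
  show ?thesis
  proof (rule that)
    fix y :: real assume y: "0 \<le> y" "y \<le> 1"
    show "\<bar>f y / y\<bar> \<le> (K + \<bar>\<psi> 1\<bar>) / \<bar>\<mu>\<bar>"
    proof (cases "y = 0")
      case False
      with y have y: "0 < y" "y \<le> 1" by auto
      have "\<bar>\<psi> y / y\<bar> \<le> K" using K(2)[of y] y by (simp add: abs_divide pos_divide_le_eq)
      then have "\<bar>\<mu> * (f y / y)\<bar> \<le> K + \<bar>\<psi> 1\<bar>"
        unfolding quotient_eq[OF y] by linarith
      then have "\<bar>f y / y\<bar> * \<bar>\<mu>\<bar> \<le> K + \<bar>\<psi> 1\<bar>" by (simp add: abs_mult mult.commute)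
      then show ?thesis using assms by (simp add: pos_le_divide_eq)
    qed (use K assms in simp)
  qed
qed

text \<open>Integration by parts. With p y = f y / y, the function
\<Phi> y = ((x^2 + y^2) / 2 * p y - x^2 * p x) * log_kernel x y - x f y is continuous on [0,1], since the
first factor vanishes at y = x and the logarithmic singularity is harmless there. Its
derivative consists of the integrands of the potential, of the singular integral D and of the kernel
term, so the fundamental theorem of calculus relates the three integrals.\<close>

lemma kernel_identity:
  assumes mu: "\<mu> \<noteq> 0" and x: "0 < x" "x < 1"
  shows "((\<lambda>t. radial_kernel x t * q t) has_integral pi * w x) {0..1}"
proof -
  define \<Phi> where "\<Phi> y = (x\<^sup>2 + y\<^sup>2) / 2 * (f y / y) * log_kernel x y - x * f x * log_kernel x y - x * f y" for y
  define g where "g y = (f y - f x) / (y - x) + (f y + f x) / (y + x)" for y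
  define \<phi> where "\<phi> y = f y * log_kernel x y - radial_kernel x y * q y - x * g y" for y
  have deriv: "(\<Phi> has_real_derivative \<phi> y) (at y)" if y: "0 < y" "y < 1" "y \<noteq> x" for y
  proof -
    note p = DERIV_quotient[OF mu y(1,2)]
    note k = DERIV_log_kernel[OF x(1) y(1,3)]
    have f: "(f has_real_derivative f y / y - y * q y) (at y)"
    proof -
      have "((\<lambda>y. y * (f y / y)) has_real_derivative f y / y - y * q y) (at y)"
        by (rule DERIV_cong[OF DERIV_mult[OF DERIV_ident p]]) (simp add: mult.commute)
      moreover have "(\<lambda>y. y * (f y / y)) = f" by (auto simp: fun_eq_iff)
      ultimately show ?thesis by simp
    qed
    have s: "((\<lambda>y. (x\<^sup>2 + y\<^sup>2) / 2) has_real_derivative y) (at y)"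
      by (auto intro!: derivative_eq_intros)
    let ?d = "(y * (f y / y) + - q y * ((x\<^sup>2 + y\<^sup>2) / 2)) * log_kernel x y + 2 * x / ((x + y) * (x - y)) * ((x\<^sup>2 + y\<^sup>2) / 2 * (f y / y))
      - x * f x * (2 * x / ((x + y) * (x - y))) - x * (f y / y - y * q y)"
    have "(\<Phi> has_real_derivative ?d) (at y)"
      unfolding \<Phi>_def[abs_def]
      by (intro DERIV_diff DERIV_mult DERIV_cmult s p k f)
    moreover have "?d = \<phi> y"
    proof -
      define p where "p = f y / y"
      have fy: "f y = y * p" using y by (simp add: p_def)
      have frac: "2 * x / ((x + y) * (x - y)) * ((x\<^sup>2 + y\<^sup>2) / 2 * p) - x * f x * (2 * x / ((x + y) * (x - y))) - x * p
         = - x * ((y * p - f x) / (y - x) + (y * p + f x) / (y + x))"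
      proof -
        have nz: "x + y \<noteq> 0" "x - y \<noteq> 0" "y - x \<noteq> 0" "y + x \<noteq> 0" using x y by auto
        define d where "d = (x + y) * (x - y)"
        have d: "d \<noteq> 0" using nz by (simp add: d_def)
        have sum: "(y * p - f x) / (y - x) + (y * p + f x) / (y + x) = - (2 * y * (y * p) - 2 * x * f x) / d"
          using nz unfolding d_def by (simp add: divide_simps) (simp add: algebra_simps)
        have lhs: "2 * x / d * ((x\<^sup>2 + y\<^sup>2) / 2 * p) - x * f x * (2 * x / d) - x * p
          = (x * (x\<^sup>2 + y\<^sup>2) * p - 2 * x * x * f x - x * p * d) / d"
          using d by (simp add: field_simps)
        have "x * (x\<^sup>2 + y\<^sup>2) * p - 2 * x * x * f x - x * p * d = x * (2 * y * (y * p) - 2 * x * f x)"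
          unfolding d_def by (simp add: power2_eq_square algebra_simps)
        then have "2 * x / d * ((x\<^sup>2 + y\<^sup>2) / 2 * p) - x * f x * (2 * x / d) - x * p
          = x * (2 * y * (y * p) - 2 * x * f x) / d" using lhs by simp
        also have "\<dots> = - x * (- (2 * y * (y * p) - 2 * x * f x) / d)" by (simp only: minus_divide_left[symmetric] times_divide_eq_right minus_mult_minus)
        finally show ?thesis unfolding sum unfolding d_def .
      qed
      have "\<phi> y = y * p * log_kernel x y - ((x\<^sup>2 + y\<^sup>2) / 2 * log_kernel x y - x * y) * q y
        - x * ((y * p - f x) / (y - x) + (y * p + f x) / (y + x))"
        unfolding \<phi>_def g_def fy using y by (simp add: radial_kernel_def)
      also have "\<dots> = y * p * log_kernel x y - ((x\<^sup>2 + y\<^sup>2) / 2 * log_kernel x y - x * y) * q y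
        + (2 * x / ((x + y) * (x - y)) * ((x\<^sup>2 + y\<^sup>2) / 2 * p) - x * f x * (2 * x / ((x + y) * (x - y))) - x * p)"
        unfolding frac by simp
      finally have phi: "\<phi> y = \<dots>" .
      have alg: "(y * p + - q * S) * K + T * (S * p) - x * X * T - x * (p - y * q)
        = y * p * K - (S * K - x * y) * q + (T * (S * p) - x * X * T - x * p)" for S T K p q X :: real
        by (simp add: algebra_simps)
      show ?thesis unfolding phi p_def[symmetric] by (rule alg)
    qed
    ultimately show ?thesis by (rule DERIV_cong)
  qed
  have contf: "isCont f y" for y using cont by (simp add: continuous_on_eq_continuous_at)
  have contk: "isCont (log_kernel x) y" if "0 \<le> y" "y \<noteq> x" for y
  proof -
    have nz: "(x + y) / (x - y) \<noteq> 0" using that x by auto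
    have "isCont (\<lambda>y. (x + y) / (x - y)) y" using that by (intro continuous_intros) auto
    then have "isCont (\<lambda>y. ln ((x + y) / (x - y))) y"
      by (rule isCont_o2) (rule DERIV_isCont[OF DERIV_ln_nonzero[OF nz]])
    then show ?thesis by (simp add: log_kernel_def[abs_def])
  qed
  have cont\<Phi>: "continuous_on {0..1} \<Phi>"
    unfolding continuous_on_eq_continuous_within
  proof
    fix y assume "y \<in> {0..1::real}"
    then consider "y = 0" | "y = x" | "0 < y" "y \<noteq> x" by force
    then show "continuous (at y within {0..1}) \<Phi>"
    proof cases
      case 3
      then have "isCont \<Phi> y" unfolding \<Phi>_def[abs_def]
        by (intro continuous_intros contf contk) auto
      then show ?thesis by (rule continuous_at_imp_continuous_at_within)
    next
      case 1
      obtain B where B: "\<And>y. 0 \<le> y \<Longrightarrow> y \<le> 1 \<Longrightarrow> \<bar>f y / y\<bar> \<le> B" using quotient_bounded[OF mu] by blast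
      have k0: "(log_kernel x \<longlongrightarrow> 0) (at 0 within {0..1})"
      proof -
        have "isCont (log_kernel x) 0" using x by (intro contk) auto
        then have "(log_kernel x \<longlongrightarrow> log_kernel x 0) (at 0 within {0..1})" unfolding isCont_def by (rule tendsto_within_subset) simp
        then show ?thesis using x by (simp add: log_kernel_def)
      qed
      have f0: "(f \<longlongrightarrow> f 0) (at 0 within {0..1})" using contf[of 0] unfolding isCont_def by (rule tendsto_within_subset) simp
      have pk: "((\<lambda>y. f y / y * log_kernel x y) \<longlongrightarrow> 0) (at 0 within {0..1})"
      proof (rule Lim_null_comparison)
        show "\<forall>\<^sub>F y in at 0 within {0..1}. norm (f y / y * log_kernel x y) \<le> B * \<bar>log_kernel x y\<bar>"
          using B unfolding eventually_at_filter
          by (intro always_eventually allI impI) (simp only: real_norm_def abs_mult, intro mult_right_mono, auto)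
        show "((\<lambda>y. B * \<bar>log_kernel x y\<bar>) \<longlongrightarrow> 0) (at 0 within {0..1})"
          using k0 by (auto intro!: tendsto_eq_intros)
      qed
      have "((\<lambda>y. (x\<^sup>2 + y\<^sup>2) / 2 * (f y / y * log_kernel x y) - x * f x * log_kernel x y - x * f y) \<longlongrightarrow>
         (x\<^sup>2 + 0\<^sup>2) / 2 * 0 - x * f x * 0 - x * f 0) (at 0 within {0..1})"
        by (intro tendsto_intros pk k0 f0) auto
      moreover have "\<Phi> 0 = 0" using x by (simp add: \<Phi>_def log_kernel_def)
      moreover have "(\<lambda>y. (x\<^sup>2 + y\<^sup>2) / 2 * (f y / y * log_kernel x y) - x * f x * log_kernel x y - x * f y) = \<Phi>"
        by (simp only: \<Phi>_def[abs_def] mult.assoc)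
      ultimately have "(\<Phi> \<longlongrightarrow> \<Phi> 0) (at 0 within {0..1})" by simp
      then show ?thesis using 1 by (simp add: continuous_within)
    next
      case 2
      define b where "b y = (x\<^sup>2 + y\<^sup>2) / 2 * (f y / y) - x * f x" for y
      have bx: "b x = 0" using x by (simp add: b_def power2_eq_square field_simps)
      have "(b has_real_derivative (x * (f x / x) + - q x * ((x\<^sup>2 + x\<^sup>2) / 2)) - 0) (at x)"
        unfolding b_def[abs_def]
        by (intro DERIV_diff DERIV_mult DERIV_const DERIV_quotient[OF mu x]) (auto intro!: derivative_eq_intros)
      then obtain b' where "((\<lambda>y. (b y - b x) / (y - x)) \<longlongrightarrow> b') (at x)"
        unfolding has_field_derivative_iff by blast
      then have "((\<lambda>y. (b y - b x) / (y - x) * ((y - x) * log_kernel x y)) \<longlongrightarrow> b' * 0) (at x)"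
        using tendsto_mult_log_kernel[OF x(1)] by (rule tendsto_mult)
      moreover have "\<forall>\<^sub>F y in at x. (b y - b x) / (y - x) * ((y - x) * log_kernel x y) = b y * log_kernel x y"
        by (auto simp: eventually_at_filter bx)
      ultimately have "((\<lambda>y. b y * log_kernel x y) \<longlongrightarrow> 0) (at x)" by (simp add: filterlim_cong)
      then have "((\<lambda>y. b y * log_kernel x y - x * f y) \<longlongrightarrow> 0 - x * f x) (at x)"
        using contf[of x] by (intro tendsto_intros) (auto simp: isCont_def)
      moreover have "\<Phi> x = - (x * f x)" by (simp add: \<Phi>_def log_kernel_def)
      moreover have "(\<lambda>y. b y * log_kernel x y - x * f y) = \<Phi>"
        by (simp only: \<Phi>_def[abs_def] b_def left_diff_distrib)
      ultimately have "isCont \<Phi> x" by (simp add: isCont_def)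
      then show ?thesis using 2 continuous_at_imp_continuous_at_within by blast
    qed
  qed
  have phi: "(\<phi> has_integral \<Phi> 1 - \<Phi> 0) {0..1}"
    by (rule fundamental_theorem_of_calculus_interior_strong[where S="{x}"])
       (use deriv cont\<Phi> in \<open>auto simp: has_real_derivative_iff_has_vector_derivative[symmetric]\<close>)
  have Phi01: "\<Phi> 1 - \<Phi> 0 = - (x * f x * log_kernel x 1)"
    using x by (simp add: \<Phi>_def supp) (simp add: log_kernel_def)
  have fk: "((\<lambda>y. f y * log_kernel x y) has_integral pi * \<psi> x) {0..1}"
  proof -
    have eq: "(\<lambda>y. indicator {0<..<1} y * (f y * log_kernel x y)) = (\<lambda>y. indicator {0..1} y *\<^sub>R (f y * log_kernel x y))"
    proof (rule ext)
      fix y :: real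
      have "y \<in> {0<..<1} \<or> y \<notin> {0..1} \<or> y = 0 \<or> y = 1" by auto
      then show "indicator {0<..<1} y * (f y * log_kernel x y) = indicator {0..1} y *\<^sub>R (f y * log_kernel x y)"
        using supp[of 1] by (elim disjE) auto
    qed
    have i: "set_integrable lborel {0..1} (\<lambda>y. f y * log_kernel x y)"
      using potential_half_line(1)[OF x(1)] unfolding eq set_integrable_def .
    show ?thesis
      using set_borel_integral_eq_integral[OF i] potential_half_line(2)[OF x(1)]
      unfolding eq set_lebesgue_integral_def by (metis integrable_integral)
  qed
  have gI: "(g has_integral D 3 x + f x * log_kernel x 1) {0..1}"
    unfolding g_def[abs_def] by (rule difference_quotient_integral[OF x])
  have "((\<lambda>y. f y * log_kernel x y - x * g y - \<phi> y) has_integral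
      pi * \<psi> x - x * (D 3 x + f x * log_kernel x 1) - (\<Phi> 1 - \<Phi> 0)) {0..1}"
    by (intro has_integral_diff fk phi has_integral_mult_right gI)
  moreover have "f y * log_kernel x y - x * g y - \<phi> y = radial_kernel x y * q y" for y by (simp add: \<phi>_def)
  moreover have "pi * \<psi> x - x * (D 3 x + f x * log_kernel x 1) - (\<Phi> 1 - \<Phi> 0) = pi * w x"
  proof -
    have "hilbert f x = - D 3 x / pi" using x by (intro hilbert_eq) auto
    then have "D 3 x = - pi * hilbert f x" by simp
    then show ?thesis unfolding Phi01 w_def by (simp add: algebra_simps)
  qed
  ultimately show ?thesis by simp
qed

lemma q_measurable [measurable]: "q \<in> borel_measurable borel"
proof -
  have "w \<in> borel_measurable borel"
    by (intro borel_measurable_continuous_onI continuous_at_imp_continuous_on ballI isCont_w)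
  then show ?thesis unfolding q_def[abs_def] by measurable
qed

lemma kernel_identity_lebesgue:
  assumes mu: "\<mu> \<noteq> 0" and x: "0 < x" "x < 1"
  shows "set_integrable lborel {0<..<1} (\<lambda>t. radial_kernel x t * q t)"
    and "(LINT t:{0<..<1}|lborel. radial_kernel x t * q t) = pi * \<mu> * (x\<^sup>2 * q x)"
proof -
  obtain K where K: "0 \<le> K" "\<And>t. 0 \<le> t \<Longrightarrow> t \<le> 1 \<Longrightarrow> \<bar>w t\<bar> \<le> K * t" using w_bound by metis
  show i: "set_integrable lborel {0<..<1} (\<lambda>t. radial_kernel x t * q t)"
    unfolding set_integrable_def
  proof (rule Bochner_Integration.integrable_bound)
    show "integrable lborel (\<lambda>t. K / \<bar>\<mu>\<bar> * (indicator {0<..<1} t * (radial_kernel x t / t)))"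
      using radial_kernel_integrable[OF x] by (rule integrable_mult_right)
    show "AE t in lborel. norm (indicator {0<..<1} t *\<^sub>R (radial_kernel x t * q t)) \<le> norm (K / \<bar>\<mu>\<bar> * (indicator {0<..<1} t * (radial_kernel x t / t)))"
    proof (rule AE_I2)
      fix t :: real
      show "norm (indicator {0<..<1} t *\<^sub>R (radial_kernel x t * q t)) \<le> norm (K / \<bar>\<mu>\<bar> * (indicator {0<..<1} t * (radial_kernel x t / t)))"
      proof (cases "t \<in> {0<..<1}")
        case True
        have "\<bar>q t\<bar> \<le> K * t / (\<bar>\<mu>\<bar> * t\<^sup>2)"
          unfolding q_def abs_divide using K(2)[of t] True mu by (simp add: abs_mult divide_right_mono)
        also have "\<dots> = K / \<bar>\<mu>\<bar> / t" using True by (simp add: power2_eq_square)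
        finally have "\<bar>radial_kernel x t\<bar> * \<bar>q t\<bar> \<le> \<bar>radial_kernel x t\<bar> * (K / \<bar>\<mu>\<bar> / t)" by (intro mult_left_mono) auto
        then show ?thesis using True K(1) by (simp add: abs_mult mult_ac)
      qed simp
    qed
  qed measurable
  have "((\<lambda>t. radial_kernel x t * q t) has_integral pi * w x) {0<..<1}"
    using kernel_identity[OF assms] by (simp add: has_integral_Icc_iff_Ioo)
  then show "(LINT t:{0<..<1}|lborel. radial_kernel x t * q t) = pi * \<mu> * (x\<^sup>2 * q x)"
    using set_borel_integral_eq_integral(2)[OF i] mu x by (simp add: integral_unique q_def)
qed

end

section \<open>The largest eigenvalue and its simplicity\<close>

text \<open>The ground state substitution. With \<rho> = h / g, the integral of
K x y g x g y (\<rho> x - \<rho> y)^2 over the product is non-negative; expanding the square and using the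
two eigenvalue equations, it equals 2 (a - b) times the integral of m h^2. If a = b, the
integrand vanishes almost everywhere.\<close>

lemma ground_state_comparison:
  fixes K :: "'a \<Rightarrow> 'a \<Rightarrow> real" and g h m :: "'a \<Rightarrow> real" and a b :: real
  assumes "sigma_finite_measure M"
    and K [measurable]: "case_prod K \<in> borel_measurable (M \<Otimes>\<^sub>M M)"
    and [measurable]: "g \<in> borel_measurable M" "h \<in> borel_measurable M" "m \<in> borel_measurable M"
    and sym: "\<And>x y. K x y = K y x"
    and nonneg: "\<And>x y. x \<in> space M \<Longrightarrow> y \<in> space M \<Longrightarrow> 0 \<le> K x y"
    and gpos: "\<And>x. x \<in> space M \<Longrightarrow> 0 < g x"
    and gi: "\<And>x. x \<in> space M \<Longrightarrow> integrable M (\<lambda>y. K x y * g y)"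
    and ge: "\<And>x. x \<in> space M \<Longrightarrow> (\<integral>y. K x y * g y \<partial>M) = a * (m x * g x)"
    and hi: "\<And>x. x \<in> space M \<Longrightarrow> integrable M (\<lambda>y. K x y * h y)"
    and he: "\<And>x. x \<in> space M \<Longrightarrow> (\<integral>y. K x y * h y \<partial>M) = b * (m x * h x)"
    and mh: "integrable M (\<lambda>x. m x * (h x)\<^sup>2)"
  shows "b * (\<integral>x. m x * (h x)\<^sup>2 \<partial>M) \<le> a * (\<integral>x. m x * (h x)\<^sup>2 \<partial>M)"
    and "a = b \<Longrightarrow> AE x in M. AE y in M. K x y * (h x / g x - h y / g y)\<^sup>2 = 0"
proof -
  interpret sigma_finite_measure M by fact
  interpret pair_sigma_finite M M ..
  define Q where "Q = (\<integral>x. m x * (h x)\<^sup>2 \<partial>M)"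
  define T1 where "T1 = (\<lambda>(x, y). K x y * (h x)\<^sup>2 * (g y / g x))"
  define T2 where "T2 = (\<lambda>(x, y). K x y * (h y)\<^sup>2 * (g x / g y))"
  define T3 where "T3 = (\<lambda>(x, y). K x y * (h x * h y))"
  have Kc [measurable]: "(\<lambda>p. K (fst p) (snd p)) \<in> borel_measurable (M \<Otimes>\<^sub>M M)"
    using K by (simp add: split_beta')
  have [measurable]: "T1 \<in> borel_measurable (M \<Otimes>\<^sub>M M)" "T3 \<in> borel_measurable (M \<Otimes>\<^sub>M M)"
    unfolding T1_def T3_def split_beta' by measurable
  have inner1: "integrable M (\<lambda>y. T1 (x, y))" "(\<integral>y. T1 (x, y) \<partial>M) = a * (m x * (h x)\<^sup>2)" if x: "x \<in> space M" for x
  proof -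
    have eq: "T1 (x, y) = (h x)\<^sup>2 / g x * (K x y * g y)" for y by (simp add: T1_def)
    show "integrable M (\<lambda>y. T1 (x, y))" unfolding eq using gi[OF x] by (rule integrable_mult_right)
    show "(\<integral>y. T1 (x, y) \<partial>M) = a * (m x * (h x)\<^sup>2)"
      unfolding eq using ge[OF x] gpos[OF x] by simp
  qed
  have T1_nonneg: "0 \<le> T1 (x, y)" if "x \<in> space M" "y \<in> space M" for x y
    using nonneg[OF that] gpos[OF that(1)] gpos[OF that(2)] by (simp add: T1_def)
  have i1: "integrable (M \<Otimes>\<^sub>M M) T1"
  proof (rule Fubini_integrable)
    have "integrable M (\<lambda>x. a * (m x * (h x)\<^sup>2))" using mh by (rule integrable_mult_right)
    moreover have "a * (m x * (h x)\<^sup>2) = (\<integral>y. norm (T1 (x, y)) \<partial>M)" if "x \<in> space M" for x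
      unfolding inner1(2)[OF that, symmetric]
      by (intro Bochner_Integration.integral_cong refl) (use T1_nonneg that in auto)
    ultimately show "integrable M (\<lambda>x. \<integral>y. norm (T1 (x, y)) \<partial>M)"
      by (subst Bochner_Integration.integrable_cong[OF refl, symmetric])
    show "AE x in M. integrable M (\<lambda>y. T1 (x, y))" using inner1(1) by (intro AE_I2)
  qed measurable
  have T2: "T2 = (\<lambda>(x, y). T1 (y, x))" by (auto simp: T1_def T2_def sym fun_eq_iff)
  have i2: "integrable (M \<Otimes>\<^sub>M M) T2" unfolding T2 by (rule integrable_product_swap[OF i1])
  have i3: "integrable (M \<Otimes>\<^sub>M M) T3"
  proof (rule Bochner_Integration.integrable_bound)
    show "integrable (M \<Otimes>\<^sub>M M) (\<lambda>p. T1 p + T2 p)" using i1 i2 by (rule Bochner_Integration.integrable_add)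
    show "AE p in M \<Otimes>\<^sub>M M. norm (T3 p) \<le> norm (T1 p + T2 p)"
    proof (rule AE_I2, clarify)
      fix x y assume "(x, y) \<in> space (M \<Otimes>\<^sub>M M)"
      then have xy: "x \<in> space M" "y \<in> space M" by (auto simp: space_pair_measure)
      \<comment> \<open>By the inequality of the means the mixed term is dominated by the two square terms.\<close>
      define u where "u = \<bar>h x\<bar> * sqrt (g y / g x)"
      define v where "v = \<bar>h y\<bar> * sqrt (g x / g y)"
      have gg: "0 < g x" "0 < g y" using gpos xy by auto
      have uv: "u * v = \<bar>h x * h y\<bar>"
        using gg by (simp add: u_def v_def abs_mult real_sqrt_divide)
      have u2: "u\<^sup>2 = (h x)\<^sup>2 * (g y / g x)" "v\<^sup>2 = (h y)\<^sup>2 * (g x / g y)"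
        using gg by (simp_all add: u_def v_def power_mult_distrib)
      have "0 \<le> (u - v)\<^sup>2" by simp
      then have "2 * (u * v) \<le> u\<^sup>2 + v\<^sup>2" by (simp add: power2_eq_square algebra_simps)
      moreover have "0 \<le> u * v" unfolding uv by simp
      ultimately have "\<bar>h x * h y\<bar> \<le> u\<^sup>2 + v\<^sup>2" unfolding uv[symmetric] by linarith
      then have "K x y * \<bar>h x * h y\<bar> \<le> K x y * (u\<^sup>2 + v\<^sup>2)" using nonneg[OF xy] by (rule mult_left_mono)
      moreover have "T1 (x, y) + T2 (x, y) = K x y * (u\<^sup>2 + v\<^sup>2)" by (simp add: T1_def T2_def u2 distrib_left)
      ultimately show "norm (T3 (x, y)) \<le> norm (T1 (x, y) + T2 (x, y))"
        using nonneg[OF xy] by (simp add: T3_def abs_mult)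
    qed
  qed measurable
  have I1: "integral\<^sup>L (M \<Otimes>\<^sub>M M) T1 = a * Q"
  proof -
    have "integral\<^sup>L (M \<Otimes>\<^sub>M M) T1 = (\<integral>x. (\<integral>y. T1 (x, y) \<partial>M) \<partial>M)" by (rule integral_fst'[OF i1, symmetric])
    also have "\<dots> = (\<integral>x. a * (m x * (h x)\<^sup>2) \<partial>M)"
      by (intro Bochner_Integration.integral_cong refl inner1(2))
    finally show ?thesis by (simp add: Q_def)
  qed
  have I2: "integral\<^sup>L (M \<Otimes>\<^sub>M M) T2 = a * Q"
    unfolding T2 I1[symmetric] by (rule integral_product_swap) measurable
  have I3: "integral\<^sup>L (M \<Otimes>\<^sub>M M) T3 = b * Q"
  proof -
    have "integral\<^sup>L (M \<Otimes>\<^sub>M M) T3 = (\<integral>x. (\<integral>y. T3 (x, y) \<partial>M) \<partial>M)" by (rule integral_fst'[OF i3, symmetric])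
    also have "\<dots> = (\<integral>x. b * (m x * (h x)\<^sup>2) \<partial>M)"
    proof (intro Bochner_Integration.integral_cong refl)
      fix x assume x: "x \<in> space M"
      have eq: "T3 (x, y) = h x * (K x y * h y)" for y by (simp add: T3_def)
      show "(\<integral>y. T3 (x, y) \<partial>M) = b * (m x * (h x)\<^sup>2)"
        unfolding eq using he[OF x] by (simp add: power2_eq_square)
    qed
    finally show ?thesis by (simp add: Q_def)
  qed
  define T where "T p = T1 p + T2 p - 2 * T3 p" for p
  have iT: "integrable (M \<Otimes>\<^sub>M M) T"
    unfolding T_def using i1 i2 i3 by auto
  have IT: "integral\<^sup>L (M \<Otimes>\<^sub>M M) T = 2 * (a - b) * Q"
  proof -
    have "integral\<^sup>L (M \<Otimes>\<^sub>M M) T = integral\<^sup>L (M \<Otimes>\<^sub>M M) (\<lambda>p. T1 p + T2 p) - integral\<^sup>L (M \<Otimes>\<^sub>M M) (\<lambda>p. 2 * T3 p)"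
      unfolding T_def using i1 i2 i3 by (intro Bochner_Integration.integral_diff) auto
    also have "\<dots> = a * Q + a * Q - 2 * (b * Q)" using i1 i2 I1 I2 I3 by simp
    finally show ?thesis by (simp add: algebra_simps)
  qed
  have T_eq: "T (x, y) = K x y * (g x * g y) * (h x / g x - h y / g y)\<^sup>2" if "x \<in> space M" "y \<in> space M" for x y
  proof -
    have gg: "0 < g x" "0 < g y" using gpos that by auto
    have sq: "(g x * g y) * (h x / g x - h y / g y)\<^sup>2 = (h x)\<^sup>2 * (g y / g x) + (h y)\<^sup>2 * (g x / g y) - 2 * (h x * h y)"
    proof -
      define s where "s = h x / g x"
      define t where "t = h y / g y"
      have eqs: "h x = s * g x" "h y = t * g y" using gg by (auto simp: s_def t_def)
      have e1: "(s * g x)\<^sup>2 * (g y / g x) = s\<^sup>2 * (g x * g y)" "(t * g y)\<^sup>2 * (g x / g y) = t\<^sup>2 * (g x * g y)"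
        using gg by (simp_all add: power2_eq_square)
      show ?thesis unfolding s_def[symmetric] t_def[symmetric] unfolding eqs e1
        by (simp add: power2_eq_square algebra_simps)
    qed
    show ?thesis unfolding mult.assoc[of "K x y"] sq by (simp add: T_def T1_def T2_def T3_def algebra_simps)
  qed
  have T_nonneg: "AE p in M \<Otimes>\<^sub>M M. 0 \<le> T p"
  proof (rule AE_I2, clarify)
    fix x y assume "(x, y) \<in> space (M \<Otimes>\<^sub>M M)"
    then have xy: "x \<in> space M" "y \<in> space M" by (auto simp: space_pair_measure)
    then show "0 \<le> T (x, y)"
      unfolding T_eq[OF xy] using nonneg[OF xy] gpos[OF xy(1)] gpos[OF xy(2)] by simp
  qed
  have "0 \<le> integral\<^sup>L (M \<Otimes>\<^sub>M M) T" by (rule integral_nonneg_AE[OF T_nonneg])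
  then show "b * (\<integral>x. m x * (h x)\<^sup>2 \<partial>M) \<le> a * (\<integral>x. m x * (h x)\<^sup>2 \<partial>M)"
    unfolding IT Q_def[symmetric] by (simp add: algebra_simps)
  show "AE x in M. AE y in M. K x y * (h x / g x - h y / g y)\<^sup>2 = 0" if "a = b"
  proof -
    have "integral\<^sup>L (M \<Otimes>\<^sub>M M) T = 0" using IT that by simp
    then have "AE p in M \<Otimes>\<^sub>M M. T p = 0"
      using integral_nonneg_eq_0_iff_AE[OF iT T_nonneg] by simp
    from AE_pair[OF this] have ae: "AE x in M. AE y in M. T (x, y) = 0" .
    show ?thesis
      using ae AE_space
    proof eventually_elim
      case (elim x)
      then have x: "x \<in> space M" by simp
      show ?case
        using elim(1) AE_space
      proof eventually_elim
        case (elim y)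
        have "g x \<noteq> 0" "g y \<noteq> 0" using gpos[OF x] gpos[OF elim(2)] by auto
        then show ?case using elim T_eq[OF x elim(2)] by auto
      qed
    qed
  qed
qed

text \<open>The exceptional set is open and null, hence empty.\<close>

lemma AE_continuous_eq_zero:
  fixes r :: "real \<Rightarrow> real"
  assumes "open S" "continuous_on S r" and ae: "AE x in lborel. x \<in> S \<longrightarrow> r x = 0" and "x \<in> S"
  shows "r x = 0"
proof (rule ccontr)
  assume "r x \<noteq> 0"
  let ?U = "S \<inter> r -` (- {0})"
  have "open ?U" using assms(1,2) by (intro continuous_open_preimage) auto
  moreover have "?U \<noteq> {}" using \<open>r x \<noteq> 0\<close> \<open>x \<in> S\<close> by auto
  ultimately have "\<not> negligible ?U" by (rule open_not_negligible)
  moreover have "negligible ?U"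
  proof -
    have "AE x in lebesgue. x \<in> S \<longrightarrow> r x = 0" using ae by (rule AE_completion)
    then have "{x. \<not> (x \<in> S \<longrightarrow> r x = 0)} \<in> null_sets lebesgue"
      by (simp add: AE_iff_null_sets eventually_ae_filter) 
         (metis (mono_tags, lifting) null_sets_completion_subset)
    moreover have "{x. \<not> (x \<in> S \<longrightarrow> r x = 0)} = ?U" by auto
    ultimately show ?thesis by (simp add: negligible_iff_null_sets)
  qed
  ultimately show False by simp
qed

text \<open>The negative derivative of f x / x is positive by the moving plane argument, so it is a positive
eigenfunction of the positive symmetric kernel with weight x^2, and the ground state comparison
applies to every other eigenfunction h. Since h x / x and f x / x vanish at 1, proportional
derivatives force proportional functions.\<close>

theorem leading_eigenprofile:
  assumes "positive_eigenprofile f C \<mu>" "eigenprofile h C' \<nu>" "h \<noteq> (\<lambda>x. 0)" and nu: "0 < \<nu>"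
  shows "\<nu> \<le> \<mu>" and "\<nu> = \<mu> \<Longrightarrow> \<exists>\<gamma>. \<forall>x. h x = \<gamma> * f x"
proof -
  interpret f: positive_eigenprofile f C \<mu> by fact
  interpret h: eigenprofile h C' \<nu> by fact
  let ?E = "{0<..<1::real}"
  define M where "M = restrict_space lborel ?E"
  have space: "space M = ?E" by (simp add: M_def space_restrict_space)
  have fq: "0 < f.q x" if "x \<in> ?E" for x
  proof -
    have "f.radial_potential' x < 0" using that by (intro f.radial_potential_decreasing) auto
    then have "0 < f.w x" using that by (simp add: f.radial_potential'_def f.w_def divide_less_0_iff)
    then show ?thesis using that f.eigenvalue_pos by (simp add: f.q_def)
  qed
  have contq: "continuous_on ?E f.q" "continuous_on ?E h.q"
    unfolding f.q_def[abs_def] h.q_def[abs_def]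
    using f.isCont_w h.isCont_w f.eigenvalue_pos nu
    by (auto intro!: continuous_intros continuous_at_imp_continuous_on)
  have sf: "sigma_finite_measure M" unfolding M_def
    by (rule sigma_finite_measure_restrict_space) (auto intro: sigma_finite_lborel)
  have restr: "u \<in> borel_measurable M" if "u \<in> borel_measurable borel" for u :: "real \<Rightarrow> real"
    unfolding M_def using that by (intro measurable_restrict_space1) simp
  have int: "integrable M u \<longleftrightarrow> set_integrable lborel ?E u" "integral\<^sup>L M u = (LINT x:?E|lborel. u x)" for u :: "real \<Rightarrow> real"
    unfolding M_def set_integrable_def set_lebesgue_integral_def
    by (simp_all add: integrable_restrict_space integral_restrict_space)
  have idm: "(\<lambda>x. x) \<in> measurable M borel" unfolding M_def by (intro measurable_restrict_space1) simp
  have Km: "case_prod radial_kernel \<in> borel_measurable (M \<Otimes>\<^sub>M M)"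
  proof -
    have [measurable]: "fst \<in> measurable (M \<Otimes>\<^sub>M M) borel" "snd \<in> measurable (M \<Otimes>\<^sub>M M) borel"
      by (rule measurable_compose[OF measurable_fst idm], rule measurable_compose[OF measurable_snd idm])
    have "(\<lambda>p. case_prod radial_kernel (fst p, snd p)) \<in> borel_measurable (M \<Otimes>\<^sub>M M)"
      by (rule measurable_compose[OF measurable_Pair radial_kernel_measurable]) measurable
    then show ?thesis by simp
  qed
  have nonneg: "0 \<le> radial_kernel x y" if "x \<in> space M" "y \<in> space M" for x y
    using radial_kernel_pos[of x y] that by (cases "x = y") (auto simp: space radial_kernel_def)
  have mh: "integrable M (\<lambda>x. x\<^sup>2 * (h.q x)\<^sup>2)"
    unfolding int set_integrable_def
  proof -
    obtain K where K: "0 \<le> K" "\<And>t. 0 \<le> t \<Longrightarrow> t \<le> 1 \<Longrightarrow> \<bar>h.w t\<bar> \<le> K * t" using h.w_bound by metis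
    show "integrable lborel (\<lambda>x. indicator ?E x *\<^sub>R (x\<^sup>2 * (h.q x)\<^sup>2))"
    proof (rule Bochner_Integration.integrable_bound)
      show "integrable lborel (\<lambda>x::real. (K / \<nu>)\<^sup>2 * indicator ?E x)"
        by (intro integrable_mult_right integrable_real_indicator) auto
      show "AE x in lborel. norm (indicator ?E x *\<^sub>R (x\<^sup>2 * (h.q x)\<^sup>2)) \<le> norm ((K / \<nu>)\<^sup>2 * indicator ?E x)"
      proof (rule AE_I2)
        fix x :: real
        show "norm (indicator ?E x *\<^sub>R (x\<^sup>2 * (h.q x)\<^sup>2)) \<le> norm ((K / \<nu>)\<^sup>2 * indicator ?E x)"
        proof (cases "x \<in> ?E")
          case True
          have "\<bar>x * h.q x\<bar> \<le> K / \<nu>"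
          proof -
            have "\<bar>x * h.q x\<bar> = \<bar>h.w x\<bar> / (\<nu> * x)"
              using True nu by (simp add: h.q_def abs_mult power2_eq_square)
            also have "\<dots> \<le> K * x / (\<nu> * x)" using K(2)[of x] True nu by (intro divide_right_mono) auto
            finally show ?thesis using True by simp
          qed
          then have "(x * h.q x)\<^sup>2 \<le> (K / \<nu>)\<^sup>2" using K nu by (simp add: abs_le_square_iff[symmetric])
          then show ?thesis using True by (simp add: power_mult_distrib)
        qed simp
      qed
    qed measurable
  qed
  define Q where "Q = (\<integral>x. x\<^sup>2 * (h.q x)\<^sup>2 \<partial>M)"
  have mu: "0 < \<mu>" by (rule f.eigenvalue_pos)
  have ki: "integrable M (\<lambda>y. radial_kernel x y * f.q y)" "(\<integral>y. radial_kernel x y * f.q y \<partial>M) = pi * \<mu> * (x\<^sup>2 * f.q x)"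
    "integrable M (\<lambda>y. radial_kernel x y * h.q y)" "(\<integral>y. radial_kernel x y * h.q y \<partial>M) = pi * \<nu> * (x\<^sup>2 * h.q x)" if "x \<in> space M" for x
    using that f.kernel_identity_lebesgue[of x] h.kernel_identity_lebesgue[of x] mu nu unfolding int space by auto
  have gpos: "0 < f.q x" if "x \<in> space M" for x using fq that by (simp only: space)
  have mm: "(\<lambda>x. x\<^sup>2) \<in> borel_measurable M" by (rule restr) measurable
  note comparison = ground_state_comparison[where M=M and K=radial_kernel and m="\<lambda>x. x\<^sup>2", OF sf Km
      restr[OF f.q_measurable] restr[OF h.q_measurable] mm radial_kernel_sym nonneg gpos ki(1,2,3,4) mh]
  have 1: "pi * \<nu> * Q \<le> pi * \<mu> * Q"
    unfolding Q_def by (rule comparison(1))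
  have 2: "AE x in M. AE y in M. radial_kernel x y * (h.q x / f.q x - h.q y / f.q y)\<^sup>2 = 0" if "\<nu> = \<mu>"
  proof (rule comparison(2))
    show "pi * \<mu> = pi * \<nu>" using that by simp
  qed
  have recover: "h x = \<gamma> * f x" if q: "\<And>y. y \<in> ?E \<Longrightarrow> h.q y = \<gamma> * f.q y" for x \<gamma>
  proof -
    have *: "h x = \<gamma> * f x" if x: "0 < x" "x < 1" for x
    proof -
      let ?d = "\<lambda>y. h y / y - \<gamma> * (f y / y)"
      have "?d 1 = ?d x"
      proof (rule DERIV_isconst_end[OF x(2)])
        show "continuous_on {x..1} ?d"
          by (intro continuous_intros continuous_on_subset[OF h.cont] continuous_on_subset[OF f.cont]) (use x in auto)
        fix y assume y: "x < y" "y < 1"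
        have "(?d has_real_derivative - h.q y - \<gamma> * (- f.q y)) (at y)"
          using y x mu nu by (intro DERIV_diff DERIV_cmult h.DERIV_quotient f.DERIV_quotient) auto
        then show "(?d has_real_derivative 0) (at y)" using q[of y] y x by simp
      qed
      then show ?thesis using x h.supp[of 1] f.supp[of 1] by (simp add: field_simps)
    qed
    consider "1 \<le> \<bar>x\<bar>" | "x = 0" | "0 < x" "x < 1" | "0 < - x" "- x < 1" by linarith
    then show ?thesis
    proof cases
      case 4
      then show ?thesis using *[of "- x"] by (simp add: h.odd f.odd)
    qed (use * in \<open>auto simp: h.supp f.supp\<close>)
  qed
  have Qpos: "0 < Q"
  proof (rule ccontr)
    assume "\<not> 0 < Q"
    have iQ: "integrable lborel (\<lambda>x. indicator ?E x *\<^sub>R (x\<^sup>2 * (h.q x)\<^sup>2))"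
      using mh unfolding int set_integrable_def .
    have Q: "Q = (LINT x|lborel. indicator ?E x *\<^sub>R (x\<^sup>2 * (h.q x)\<^sup>2))"
      unfolding Q_def int set_lebesgue_integral_def ..
    have nn: "AE x in lborel. 0 \<le> indicator ?E x *\<^sub>R (x\<^sup>2 * (h.q x)\<^sup>2)" by (intro AE_I2) simp
    have "Q = 0" using \<open>\<not> 0 < Q\<close> integral_nonneg_AE[OF nn] Q by linarith
    then have "AE x in lborel. indicator ?E x *\<^sub>R (x\<^sup>2 * (h.q x)\<^sup>2) = 0"
      using integral_nonneg_eq_0_iff_AE[OF iQ nn] Q by simp
    then have ae: "AE x in lborel. x \<in> ?E \<longrightarrow> h.q x = 0" by eventually_elim auto
    have "h.q y = 0 * f.q y" if "y \<in> ?E" for y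
      using AE_continuous_eq_zero[OF _ contq(2) ae that] by simp
    from recover[OF this] have "h = (\<lambda>x. 0)" by auto
    with \<open>h \<noteq> (\<lambda>x. 0)\<close> show False by simp
  qed
  show "\<nu> \<le> \<mu>" using 1 Qpos by simp
  show "\<exists>\<gamma>. \<forall>x. h x = \<gamma> * f x" if eq: "\<nu> = \<mu>"
  proof -
    have "\<exists>x\<in>?E. AE y in M. radial_kernel x y * (h.q x / f.q x - h.q y / f.q y)\<^sup>2 = 0"
    proof (rule ccontr)
      assume none: "\<not> ?thesis"
      from 2[OF eq] have "AE x in M. False"
        by (rule AE_mp) (rule AE_I2, use none space in blast)
      then have "emeasure M (space M) = 0" by (simp add: eventually_False ae_filter_eq_bot_iff)
      then show False unfolding space by (simp add: M_def emeasure_restrict_space)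
    qed
    then obtain x where x: "x \<in> ?E" and ae: "AE y in M. radial_kernel x y * (h.q x / f.q x - h.q y / f.q y)\<^sup>2 = 0" by blast
    define \<gamma> where "\<gamma> = h.q x / f.q x"
    have ae': "AE y in lborel. y \<in> ?E \<longrightarrow> radial_kernel x y * (h.q x / f.q x - h.q y / f.q y)\<^sup>2 = 0"
      using ae unfolding M_def by (simp add: AE_restrict_space_iff)
    have "AE y in lborel. y \<in> ?E \<longrightarrow> \<gamma> - h.q y / f.q y = 0"
      using ae' AE_lborel_singleton[of x]
    proof eventually_elim
      case (elim y)
      show ?case
      proof
        assume y: "y \<in> ?E"
        have "0 < radial_kernel x y" using radial_kernel_pos[of x y] x y elim(2) by auto
        with elim(1) y show "\<gamma> - h.q y / f.q y = 0" by (simp add: \<gamma>_def)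
      qed
    qed
    moreover have "continuous_on ?E (\<lambda>y. \<gamma> - h.q y / f.q y)"
      using contq fq by (intro continuous_intros) (auto dest: fq)
    ultimately have "\<gamma> - h.q y / f.q y = 0" if "y \<in> ?E" for y
      using AE_continuous_eq_zero[of ?E "\<lambda>y. \<gamma> - h.q y / f.q y" y] that by auto
    then have "h.q y = \<gamma> * f.q y" if "y \<in> ?E" for y
      using fq[OF that] that by (simp add: field_simps)
    from recover[OF this] show ?thesis by blast
  qed
qed

section \<open>Identification of the profile\<close>

text \<open>Continuity forces the value 0 at the end points of the support.\<close>

lemma VV_odd_profile:
  assumes "f \<in> VV"
  obtains C where "odd_profile f C"
proof -
  have f: "odd_fun f" "f \<in> H1" "\<And>x. x \<notin> {-1..1} \<Longrightarrow> f x = 0" using assms by (auto simp: VV_def H10_def)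
  obtain C where C: "\<And>a b. \<bar>f a - f b\<bar> \<le> C * sqrt \<bar>a - b\<bar>" using H1_holder[OF f(2)] by metis
  have cont: "continuous_on UNIV f" using f(2) by (simp add: H1_def)
  have odd: "f (- x) = - f x" for x using f(1) by (simp add: odd_fun_def)
  have f1: "f 1 = 0"
  proof -
    have "(f \<longlongrightarrow> f 1) (at_right 1)"
      using cont by (auto simp: continuous_on_eq_continuous_at isCont_def intro: tendsto_within_subset)
    moreover have "\<forall>\<^sub>F x in at_right 1. f x = 0"
      using f(3) by (auto simp: eventually_at_filter intro!: always_eventually)
    ultimately show ?thesis using tendsto_eventually tendsto_unique trivial_limit_at_right_real by blast
  qed
  have "f x = 0" if "1 \<le> \<bar>x\<bar>" for x
  proof -
    have "x \<notin> {-1..1} \<or> x = 1 \<or> x = -1" using that by (auto simp: abs_if split: if_splits)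
    then show ?thesis using f(3) f1 odd[of 1] by auto
  qed
  then show ?thesis using that[of C] cont odd C by (simp add: odd_profile_def)
qed

lemma eigenfunction_iff_eigenprofile:
  assumes "odd_profile f C"
  shows "MM f = (\<lambda>x. \<mu> * f x) \<longleftrightarrow> eigenprofile f C \<mu>"
proof -
  interpret odd_profile f C by fact
  show ?thesis
  proof
    assume M: "MM f = (\<lambda>x. \<mu> * f x)"
    show "eigenprofile f C \<mu>"
    proof unfold_locales
      fix x :: real assume "0 \<le> x" "x \<le> 1"
      then show "\<mu> * f x = inv_half_laplacian f x - inv_half_laplacian f 1 * x"
        using fun_cong[OF M, of x] by (simp add: MM_def c_const_def)
    qed
  next
    assume "eigenprofile f C \<mu>"
    then interpret eigenprofile f C \<mu> .
    show "MM f = (\<lambda>x. \<mu> * f x)"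
    proof
      fix x :: real
      have "1 < \<bar>x\<bar> \<or> 0 \<le> x \<and> x \<le> 1 \<or> 0 \<le> - x \<and> - x \<le> 1" by linarith
      then consider "1 < \<bar>x\<bar>" | "0 \<le> x" "x \<le> 1" | "0 \<le> - x" "- x \<le> 1" by blast
      then show "MM f x = \<mu> * f x"
      proof cases
        case 1
        then have "x \<notin> {-1..1}" by auto
        then show ?thesis using supp[of x] 1 by (simp add: MM_def)
      next
        case 2
        then show ?thesis using eig[of x] by (simp add: MM_def c_const_def)
      next
        case 3
        then show ?thesis using eig[of "- x"] by (simp add: MM_def c_const_def odd potential_odd)
      qed
    qed
  qed
qed

lemma inv_half_laplacian_uminus: "inv_half_laplacian (\<lambda>x. - f x) x = - inv_half_laplacian f x"
  by (simp add: inv_half_laplacian_def)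

text \<open>The velocity is u = -\<psi>, where \<psi> is the potential of \<Omega>, so with c = \<psi> 1 the profile equation
reads (c x - \<psi>) \<Omega>' = (c x - \<psi>)' \<Omega>. Thus \<Omega> is a multiple of c x - \<psi> on (0,1), which is the
eigenvalue equation of M. The function c x - \<psi> does not vanish identically on (0,1), since
\<psi> x / x has a non-zero derivative at 1.\<close>

lemma negative_profile_eigenprofile:
  assumes V: "\<Omega> \<in> VV" and neg: "\<And>x. 0 < x \<Longrightarrow> x < 1 \<Longrightarrow> \<Omega> x < 0"
    and prof: "self_similar_profile \<Omega> (inv_half_laplacian \<Omega> 1) (inv_half_laplacian \<Omega> 1)"
  obtains C \<mu> where "positive_eigenprofile (\<lambda>x. - \<Omega> x) C \<mu>"
proof -
  obtain C where "odd_profile \<Omega> C" using VV_odd_profile[OF V] .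
  then interpret \<Omega>: odd_profile \<Omega> C .
  let ?f = "\<lambda>x. - \<Omega> x"
  interpret f: positive_profile ?f C
    using \<Omega>.cont \<Omega>.odd \<Omega>.supp \<Omega>.holder neg
    by unfold_locales (auto intro!: continuous_intros simp: abs_minus_commute)
  define c where "c = inv_half_laplacian \<Omega> 1"
  obtain u V where u0: "u 0 = 0" and du: "\<And>x. (u has_real_derivative hilbert \<Omega> x) (at x)"
    and wV: "has_weak_derivative \<Omega> V"
    and ae: "AE x in lborel. (c * x + u x) * V x = (c + hilbert \<Omega> x) * \<Omega> x"
    using prof unfolding self_similar_profile_def c_def by blast
  have u: "u x = - inv_half_laplacian \<Omega> x" for x
  proof -
    have "((\<lambda>x. u x + inv_half_laplacian \<Omega> x) has_real_derivative 0) (at x)" for x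
      by (rule DERIV_cong[OF DERIV_add[OF du \<Omega>.DERIV_potential_hilbert]]) simp
    then have "u x + inv_half_laplacian \<Omega> x = u 0 + inv_half_laplacian \<Omega> 0"
      using DERIV_isconst_all[of "\<lambda>x. u x + inv_half_laplacian \<Omega> x"] by blast
    moreover have "inv_half_laplacian \<Omega> 0 = 0" using \<Omega>.potential_odd[of 0] by simp
    ultimately show ?thesis using u0 by simp
  qed
  define \<psi> where "\<psi> x = c * x + u x" for x
  have d\<psi>: "(\<psi> has_real_derivative c + hilbert \<Omega> x) (at x)" for x
    unfolding \<psi>_def[abs_def] by (rule DERIV_cong[OF DERIV_add[OF DERIV_cmult[OF DERIV_ident] du]]) simp
  have c\<psi>': "continuous_on UNIV (\<lambda>x. c + hilbert \<Omega> x)"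
    by (intro continuous_at_imp_continuous_on ballI continuous_intros \<Omega>.isCont_hilbert)
  have "\<exists>x0\<in>{0<..<1}. \<psi> x0 \<noteq> 0"
  proof (rule ccontr)
    assume "\<not> ?thesis"
    then have zero: "inv_half_laplacian ?f x / x = - c" if "0 < x" "x < 1" for x
      using that by (force simp: \<psi>_def u inv_half_laplacian_uminus field_simps)
    have "f.radial_potential' 1 < 0" by (rule f.radial_potential'_neg[OF f.decreasing_beyond_1]) auto
    from DERIV_neg_dec_left[OF f.DERIV_radial_potential this]
    obtain d where d: "0 < d" "\<And>h. 0 < h \<Longrightarrow> h < d \<Longrightarrow> inv_half_laplacian ?f 1 / 1 < inv_half_laplacian ?f (1 - h) / (1 - h)"
      by auto
    define h where "h = min (d / 2) (1 / 2)"
    have h: "0 < h" "h < d" "h < 1" using d by (auto simp: h_def)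
    have "- c < - c"
      using d(2)[OF h(1,2)] zero[of "1 - h"] h by (simp add: inv_half_laplacian_uminus c_def)
    then show False by simp
  qed
  then obtain x0 where x0: "x0 \<in> {0<..<1}" "\<psi> x0 \<noteq> 0" by blast
  define k where "k = \<Omega> x0 / \<psi> x0"
  have proportional: "\<forall>x\<in>{0<..<1}. \<Omega> x = k * \<psi> x"
    unfolding k_def
  proof (rule proportional_of_logarithmic_derivative[OF wV \<Omega>.cont d\<psi> c\<psi>' _ _ x0])
    show "AE x in lborel. x \<in> {0<..<1} \<longrightarrow> \<psi> x * V x = (c + hilbert \<Omega> x) * \<Omega> x"
      using ae by eventually_elim (simp add: \<psi>_def)
    show "\<Omega> x \<noteq> 0" if "x \<in> {0<..<1}" for x using neg[of x] that by auto
  qed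
  have "\<Omega> x0 \<noteq> 0" using neg[of x0] x0(1) by auto
  then have k: "k \<noteq> 0" using x0(2) by (simp add: k_def)
  have "positive_eigenprofile ?f C (- 1 / k)"
  proof unfold_locales
    fix x :: real assume x: "0 \<le> x" "x \<le> 1"
    then consider "x = 0" | "x = 1" | "0 < x" "x < 1" by linarith
    then show "- 1 / k * ?f x = inv_half_laplacian ?f x - inv_half_laplacian ?f 1 * x"
    proof cases
      case 1
      then show ?thesis using \<Omega>.potential_odd[of 0] by (simp add: inv_half_laplacian_uminus)
    next
      case 2
      then show ?thesis using \<Omega>.supp[of 1] by simp
    next
      case 3
      then have "\<Omega> x = k * \<psi> x" using proportional by simp
      then have "- 1 / k * ?f x = \<psi> x" using k by simp
      then show ?thesis by (simp add: \<psi>_def u inv_half_laplacian_uminus c_def)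
    qed
  qed
  then show ?thesis by (rule that)
qed

theorem corollary3p13:
  fixes W \<Omega> :: "real \<Rightarrow> real" and b\<^sub>l b\<^sub>w c\<^sub>l c\<^sub>w \<alpha> \<beta> :: real
  assumes "W \<in> H1" and "self_similar_profile W b\<^sub>l b\<^sub>w"
    and "\<alpha> \<noteq> 0" and "\<beta> \<noteq> 0"
    and "\<Omega> = rescale \<alpha> \<beta> W" and "c\<^sub>l = \<alpha> * b\<^sub>l" and "c\<^sub>w = \<alpha> * b\<^sub>w"
    and "odd_fun \<Omega>"
    and "\<And>x. x \<notin> {-1..1} \<Longrightarrow> \<Omega> x = 0"
    and "\<And>x. x \<in> {0<..<1} \<Longrightarrow> \<Omega> x < 0"
    and "self_similar_profile \<Omega> c\<^sub>l c\<^sub>w"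
    and "c\<^sub>l = inv_half_laplacian \<Omega> 1" and "c\<^sub>w = inv_half_laplacian \<Omega> 1"
  shows "(\<exists>f. leading_eigenfunction f) \<and>
         (\<forall>f. leading_eigenfunction f \<longrightarrow>
            (\<exists>\<gamma>. \<gamma> \<noteq> 0 \<and> \<Omega> = (\<lambda>x. \<gamma> * f x)) \<and>
            (\<exists>a b. a \<noteq> 0 \<and> b \<noteq> 0 \<and> W = rescale a b f))"
proof -
  have V: "\<Omega> \<in> VV"
    using H1_scale[OF assms(1,4), of \<alpha>] assms(5,8,9) by (simp add: VV_def H10_def rescale_def)
  have prof: "self_similar_profile \<Omega> (inv_half_laplacian \<Omega> 1) (inv_half_laplacian \<Omega> 1)"
    using assms(11) unfolding assms(12,13) .
  obtain C \<mu> where pe: "positive_eigenprofile (\<lambda>x. - \<Omega> x) C \<mu>"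
    using negative_profile_eigenprofile[OF V _ prof] assms(10) by auto
  interpret f: positive_eigenprofile "\<lambda>x. - \<Omega> x" C \<mu> by (rule pe)
  let ?f = "\<lambda>x. - \<Omega> x"
  have fV: "?f \<in> VV"
  proof -
    have "?f \<in> H1" using H1_scale[of \<Omega> 1 "-1"] V by (simp add: VV_def H10_def)
    then show ?thesis using V by (simp add: VV_def H10_def odd_fun_def)
  qed
  have f0: "?f \<noteq> (\<lambda>x. 0)"
  proof
    assume "?f = (\<lambda>x. 0)"
    from fun_cong[OF this, of "1/2"] show False using f.pos[of "1/2"] by simp
  qed
  have ef: "eigenfunction \<mu> ?f"
    unfolding eigenfunction_def
    using fV f0 eigenfunction_iff_eigenprofile[OF f.odd_profile_axioms] f.eigenprofile_axioms by blast
  have max: "\<nu> \<le> \<mu>" and simple: "\<nu> = \<mu> \<Longrightarrow> \<exists>\<gamma>. \<forall>x. g x = \<gamma> * ?f x" if "eigenfunction \<nu> g" for \<nu> g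
  proof -
    have g: "g \<in> VV" "g \<noteq> (\<lambda>x. 0)" "MM g = (\<lambda>x. \<nu> * g x)" using that by (auto simp: eigenfunction_def)
    obtain C' where "odd_profile g C'" using VV_odd_profile[OF g(1)] .
    then have ge: "eigenprofile g C' \<nu>" using eigenfunction_iff_eigenprofile g(3) by blast
    show "\<nu> \<le> \<mu>"
    proof (cases "0 < \<nu>")
      case True then show ?thesis using leading_eigenprofile(1)[OF pe ge g(2)] by simp
    next
      case False then show ?thesis using f.eigenvalue_pos by simp
    qed
    show "\<nu> = \<mu> \<Longrightarrow> \<exists>\<gamma>. \<forall>x. g x = \<gamma> * ?f x"
      using leading_eigenprofile(2)[OF pe ge g(2)] f.eigenvalue_pos by simp
  qed
  have lead: "leading_eigenfunction ?f"
    using ef max unfolding leading_eigenfunction_def by blast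
  show ?thesis
  proof (intro conjI allI impI)
    show "\<exists>f. leading_eigenfunction f" using lead by blast
  next
    fix h assume "leading_eigenfunction h"
    then obtain \<nu> where h: "eigenfunction \<nu> h" "\<And>\<nu>' g. eigenfunction \<nu>' g \<Longrightarrow> \<nu>' \<le> \<nu>"
      by (auto simp: leading_eigenfunction_def)
    have "\<nu> = \<mu>" using h(2)[OF ef] max[OF h(1)] by simp
    then obtain \<gamma> where \<gamma>: "\<And>x. h x = \<gamma> * - \<Omega> x" using simple[OF h(1)] by blast
    have "\<gamma> \<noteq> 0" using \<gamma> h(1) by (auto simp: eigenfunction_def)
    then have \<Omega>h: "\<Omega> x = (- 1 / \<gamma>) * h x" for x by (simp add: \<gamma>)
    show "\<exists>\<gamma>. \<gamma> \<noteq> 0 \<and> \<Omega> = (\<lambda>x. \<gamma> * h x)"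
      using \<open>\<gamma> \<noteq> 0\<close> \<Omega>h by (intro exI[of _ "- 1 / \<gamma>"]) auto
    have "W x = rescale (- 1 / (\<alpha> * \<gamma>)) (1 / \<beta>) h x" for x
    proof -
      have "\<alpha> * W x = \<Omega> (x / \<beta>)" using assms(4) by (simp add: assms(5) rescale_def)
      then have "W x = \<Omega> (x / \<beta>) / \<alpha>" using assms(3) by (simp add: field_simps)
      also have "\<dots> = - 1 / (\<alpha> * \<gamma>) * h (x / \<beta>)" unfolding \<Omega>h by simp
      finally show ?thesis by (simp add: rescale_def)
    qed
    then show "\<exists>a b. a \<noteq> 0 \<and> b \<noteq> 0 \<and> W = rescale a b h"
      using \<open>\<gamma> \<noteq> 0\<close> assms(3,4) by (intro exI[of _ "- 1 / (\<alpha> * \<gamma>)"] exI[of _ "1 / \<beta>"]) auto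
  qed
qed

end
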